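(* Each of the following classes of interpretable topological spaces (in $\mathbb{M}$) is closed under finite disjoint unions and finite products: 1. the class of locally definable spaces; 2. the class of locally Euclidean spaces; 3. the class of definably dominated spaces; 4. the class of manifold dominated spaces; 5. the class of admissible spaces; 6. the class of strongly admissible spaces.
   Context: Setting. Fix a prime $p$. A $p$-adically closed field is a field elementarily equivalent to $\mathbb{Q}_p$, and $p\mathrm{CF}$ is the theory of such fields. $\mathbb{M}$ is a monster model of $p\mathrm{CF}$ ($\kappa$-saturated and strongly $\kappa$-homogeneous for some large cardinal $\kappa$). "Definable" means a subset of some $\mathbb{M}^n$ definable with parameters. "Interpretable" means definable with parameters in $\mathbb{M}^{\mathrm{eq}}$; up to identification, interpretable sets are quotients $D/E$ with $D\subseteq\mathbb{M}^n$ definable and $E$ a definable equivalence relation on $D$. A map is interpretable if its graph is. Topology. $\mathbb{M}$ has the valuation topology, $\mathbb{M}^n$ the product topology, and definable subsets of $\mathbb{M}^n$ the subspace topology. A topology on an interpretable set $X$ is interpretable if it has a basis of the form $\{S_a : a\in I\}$ for some interpretable family $\{S_a\}_{a\in I}$; an interpretable topological space is an interpretable set with an interpretable topology. "Open map" always means continuous open map. The following notions are defined for Hausdorff interpretable topological spaces $X$ (so each of them includes being Hausdorff): - $X$ is a definable manifold if $X$ is covered by finitely many open subsets $U_1,\dots,U_m$ such that each $U_i$ is interpretably homeomorphic to an open definable subset of $\mathbb{M}^{k_i}$ for some $k_i$. - $X$ is locally Euclidean (resp. locally definable) if every point of $X$ has a neighborhood interpretably homeomorphic to an open definable subset (resp.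 a definable subspace) of $\mathbb{M}^n$ for some $n$ depending on the point. - $X$ is definably dominated (resp. manifold dominated) if there is an interpretable surjective open map $Y\to X$ for some definable set $Y\subseteq\mathbb{M}^n$ with the subspace topology (resp. some definable manifold $Y$). - $X$ is admissible if it is definably dominated and locally definable. - $X$ is strongly admissible if it is manifold dominated and locally Euclidean. Disjoint unions carry the disjoint union topology and products the product topology. *)

theory Defs
  imports "HOL-Analysis.Analysis" "HOL-Algebra.QuotRing" "HOL-Computational_Algebra.Primes"
begin

section \<open>First-order logic in the language of rings\<close>

datatype rtm = Var nat | Zero | One | Add rtm rtm | Neg rtm | Mul rtm rtm

text \<open>Variables are de Bruijn indices: in \<^term>\<open>Ex \<phi>\<close> the bound variable is
  number 0 and the outer variable i is referred to as i + 1.\<close>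

datatype rfm = Eq rtm rtm | Not rfm | And rfm rfm | Ex rfm

hide_const (open) Var Zero One Add Neg Mul Eq Not And Ex

primrec tm_val :: "('a, 'b) ring_scheme \<Rightarrow> (nat \<Rightarrow> 'a) \<Rightarrow> rtm \<Rightarrow> 'a" where
  "tm_val R e (rtm.Var i) = e i"
| "tm_val R e rtm.Zero = \<zero>\<^bsub>R\<^esub>"
| "tm_val R e rtm.One = \<one>\<^bsub>R\<^esub>"
| "tm_val R e (rtm.Add s t) = tm_val R e s \<oplus>\<^bsub>R\<^esub> tm_val R e t"
| "tm_val R e (rtm.Neg t) = \<ominus>\<^bsub>R\<^esub> tm_val R e t"
| "tm_val R e (rtm.Mul s t) = tm_val R e s \<otimes>\<^bsub>R\<^esub> tm_val R e t"

primrec sat :: "('a, 'b) ring_scheme \<Rightarrow> (nat \<Rightarrow> 'a) \<Rightarrow> rfm \<Rightarrow> bool" where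
  "sat R e (rfm.Eq s t) \<longleftrightarrow> tm_val R e s = tm_val R e t"
| "sat R e (rfm.Not \<phi>) \<longleftrightarrow> \<not> sat R e \<phi>"
| "sat R e (rfm.And \<phi> \<psi>) \<longleftrightarrow> sat R e \<phi> \<and> sat R e \<psi>"
| "sat R e (rfm.Ex \<phi>) \<longleftrightarrow> (\<exists>a\<in>carrier R. sat R (case_nat a e) \<phi>)"

primrec tm_vars :: "rtm \<Rightarrow> nat set" where
  "tm_vars (rtm.Var i) = {i}"
| "tm_vars rtm.Zero = {}"
| "tm_vars rtm.One = {}"
| "tm_vars (rtm.Add s t) = tm_vars s \<union> tm_vars t"
| "tm_vars (rtm.Neg t) = tm_vars t"
| "tm_vars (rtm.Mul s t) = tm_vars s \<union> tm_vars t"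

primrec free_vars :: "rfm \<Rightarrow> nat set" where
  "free_vars (rfm.Eq s t) = tm_vars s \<union> tm_vars t"
| "free_vars (rfm.Not \<phi>) = free_vars \<phi>"
| "free_vars (rfm.And \<phi> \<psi>) = free_vars \<phi> \<union> free_vars \<psi>"
| "free_vars (rfm.Ex \<phi>) = {i. Suc i \<in> free_vars \<phi>}"

definition elementarily_equivalent :: "('a, 'b) ring_scheme \<Rightarrow> ('c, 'd) ring_scheme \<Rightarrow> bool" where
  "elementarily_equivalent R S \<longleftrightarrow>
    (\<forall>\<phi>. free_vars \<phi> = {} \<longrightarrow> sat R (\<lambda>_. \<zero>\<^bsub>R\<^esub>) \<phi> = sat S (\<lambda>_. \<zero>\<^bsub>S\<^esub>) \<phi>)"


section \<open>The field of p-adic numbers and p-adically closed fields\<close>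

definition padic_abs :: "nat \<Rightarrow> rat \<Rightarrow> real" where
  "padic_abs p x =
    (if x = 0 then 0
     else let (a, b) = quotient_of x
          in real p powi (int (multiplicity (int p) b) - int (multiplicity (int p) a)))"

definition padic_cauchy_ring :: "nat \<Rightarrow> (nat \<Rightarrow> rat) ring" where
  "padic_cauchy_ring p =
    \<lparr>carrier = {s. \<forall>\<epsilon>>0. \<exists>N. \<forall>m\<ge>N. \<forall>n\<ge>N. padic_abs p (s m - s n) < \<epsilon>},
     mult = (\<lambda>s t n. s n * t n), one = (\<lambda>_. 1),
     zero = (\<lambda>_. 0), add = (\<lambda>s t n. s n + t n)\<rparr>"

definition padic_null :: "nat \<Rightarrow> (nat \<Rightarrow> rat) set" where
  "padic_null p = {s. (\<lambda>n. padic_abs p (s n)) \<longlonglongrightarrow> 0}"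

text \<open>The completion of the rationals with respect to the p-adic absolute value.\<close>

definition padic_field :: "nat \<Rightarrow> (nat \<Rightarrow> rat) set ring" where
  "padic_field p = padic_cauchy_ring p Quot padic_null p"

definition padic_integers :: "nat \<Rightarrow> (nat \<Rightarrow> rat) set set" where
  "padic_integers p = {X \<in> carrier (padic_field p). \<exists>s\<in>X. \<forall>n. padic_abs p (s n) \<le> 1}"

definition padically_closed :: "nat \<Rightarrow> ('a, 'b) ring_scheme \<Rightarrow> bool" where
  "padically_closed p M \<longleftrightarrow> field M \<and> elementarily_equivalent M (padic_field p)"

text \<open>The valuation on a p-adically closed field comes from the fact that the p-adic integers
  are definable without parameters in the field of p-adic numbers (for every prime p, for
  example by the formula \<open>\<exists>y. y\<^sup>2 = 1 + p\<^sup>3 x\<^sup>4\<close>).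
  Any two defining formulas agree on every p-adically closed field, so the existential
  quantifier over formulas below could equally well be a universal one.\<close>

definition valuation_ring :: "nat \<Rightarrow> ('a, 'b) ring_scheme \<Rightarrow> 'a set" where
  "valuation_ring p M =
    {x \<in> carrier M. \<exists>\<phi>. free_vars \<phi> \<subseteq> {0} \<and>
        {a \<in> carrier (padic_field p). sat (padic_field p) (\<lambda>_. a) \<phi>} = padic_integers p \<and>
        sat M (\<lambda>_. x) \<phi>}"

text \<open>The generating family below is already closed under unions and finite intersections
  when M is p-adically closed, so it is exactly the family of open sets.\<close>

definition valuation_topology :: "nat \<Rightarrow> ('a, 'b) ring_scheme \<Rightarrow> 'a topology" where
  "valuation_topology p M = topology_generated_by
    {U. U \<subseteq> carrier M \<and>
        (\<forall>x\<in>U. \<exists>b\<in>carrier M - {\<zero>\<^bsub>M\<^esub>}. \<forall>z\<in>valuation_ring p M. x \<oplus>\<^bsub>M\<^esub> b \<otimes>\<^bsub>M\<^esub> z \<in> U)}"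


section \<open>Definable sets and monster models\<close>

definition tuples :: "('a, 'b) ring_scheme \<Rightarrow> nat \<Rightarrow> (nat \<Rightarrow> 'a) set" where
  "tuples M n = {..<n} \<rightarrow>\<^sub>E carrier M"

definition tuple_topology :: "nat \<Rightarrow> ('a, 'b) ring_scheme \<Rightarrow> nat \<Rightarrow> (nat \<Rightarrow> 'a) topology" where
  "tuple_topology p M n = product_topology (\<lambda>_. valuation_topology p M) {..<n}"

text \<open>The assignment that gives the first n variables the values in x, and to
  all other variables (the parameters of a formula in n variables) the values in e.\<close>

definition assign :: "nat \<Rightarrow> (nat \<Rightarrow> 'a) \<Rightarrow> (nat \<Rightarrow> 'a) \<Rightarrow> nat \<Rightarrow> 'a" where
  "assign n x e = (\<lambda>i. if i < n then x i else e i)"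

definition definable :: "('a, 'b) ring_scheme \<Rightarrow> nat \<Rightarrow> (nat \<Rightarrow> 'a) set \<Rightarrow> bool" where
  "definable M n D \<longleftrightarrow>
    (\<exists>\<phi>. \<exists>e \<in> UNIV \<rightarrow> carrier M. D = {x \<in> tuples M n. sat M (assign n x e) \<phi>})"

text \<open>A set of formulas in n variables with parameters in A is represented by
  pairs of a formula and an assignment of its remaining variables in A.\<close>

definition saturated_model :: "'k rel \<Rightarrow> ('a, 'b) ring_scheme \<Rightarrow> bool" where
  "saturated_model \<kappa> M \<longleftrightarrow>
    (\<forall>A n \<Sigma>. A \<subseteq> carrier M \<and> (card_of A, \<kappa>) \<in> ordLess \<and>
       (\<forall>(\<phi>, e)\<in>\<Sigma>. \<forall>i\<in>free_vars \<phi>. n \<le> i \<longrightarrow> e i \<in> A) \<and>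
       (\<forall>\<Sigma>0\<subseteq>\<Sigma>. finite \<Sigma>0 \<longrightarrow>
          (\<exists>x\<in>tuples M n. \<forall>(\<phi>, e)\<in>\<Sigma>0. sat M (assign n x e) \<phi>)) \<longrightarrow>
       (\<exists>x\<in>tuples M n. \<forall>(\<phi>, e)\<in>\<Sigma>. sat M (assign n x e) \<phi>))"

definition partial_elementary :: "('a, 'b) ring_scheme \<Rightarrow> 'a set \<Rightarrow> ('a \<Rightarrow> 'a) \<Rightarrow> bool" where
  "partial_elementary M A f \<longleftrightarrow> A \<subseteq> carrier M \<and> f ` A \<subseteq> carrier M \<and>
    (\<forall>\<phi> e. (\<forall>i\<in>free_vars \<phi>. e i \<in> A) \<longrightarrow> sat M e \<phi> = sat M (f \<circ> e) \<phi>)"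

definition strongly_homogeneous :: "'k rel \<Rightarrow> ('a, 'b) ring_scheme \<Rightarrow> bool" where
  "strongly_homogeneous \<kappa> M \<longleftrightarrow>
    (\<forall>A f. partial_elementary M A f \<and> (card_of A, \<kappa>) \<in> ordLess \<longrightarrow>
       (\<exists>\<sigma>\<in>ring_iso M M. \<forall>a\<in>A. \<sigma> a = f a))"

definition monster_model :: "nat \<Rightarrow> 'k rel \<Rightarrow> ('a, 'b) ring_scheme \<Rightarrow> bool" where
  "monster_model p \<kappa> M \<longleftrightarrow>
    padically_closed p M \<and> Card_order \<kappa> \<and> (natLeq, \<kappa>) \<in> ordLess \<and>
    saturated_model \<kappa> M \<and> strongly_homogeneous \<kappa> M"


section \<open>Interpretable sets\<close>

text \<open>An interpretable set is presented as the quotient of a definable set of tuples of length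
  \<open>amb_dim\<close> by a definable equivalence relation; its elements are
  the equivalence classes.\<close>

record 'a iset =
  amb_dim :: nat
  idom :: "(nat \<Rightarrow> 'a) set"
  irel :: "((nat \<Rightarrow> 'a) \<times> (nat \<Rightarrow> 'a)) set"

definition points :: "('a, 'b) iset_scheme \<Rightarrow> (nat \<Rightarrow> 'a) set set" where
  "points X = idom X // irel X"

definition tuple_append :: "nat \<Rightarrow> nat \<Rightarrow> (nat \<Rightarrow> 'a) \<Rightarrow> (nat \<Rightarrow> 'a) \<Rightarrow> nat \<Rightarrow> 'a" where
  "tuple_append m n x y = (\<lambda>i\<in>{..<m + n}. if i < m then x i else y (i - m))"

definition interpretable_set :: "('a, 'b) ring_scheme \<Rightarrow> ('a, 'c) iset_scheme \<Rightarrow> bool" where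
  "interpretable_set M X \<longleftrightarrow>
    definable M (amb_dim X) (idom X) \<and> equiv (idom X) (irel X) \<and>
    definable M (amb_dim X + amb_dim X)
      {tuple_append (amb_dim X) (amb_dim X) x y | x y. (x, y) \<in> irel X}"

text \<open>A relation between two interpretable sets is interpretable if its preimage in the
  product of the two definable sets is definable.\<close>

definition interpretable_rel ::
  "('a, 'b) ring_scheme \<Rightarrow> ('a, 'c) iset_scheme \<Rightarrow> ('a, 'd) iset_scheme \<Rightarrow>
    ((nat \<Rightarrow> 'a) set \<times> (nat \<Rightarrow> 'a) set) set \<Rightarrow> bool" where
  "interpretable_rel M X Y R \<longleftrightarrow> R \<subseteq> points X \<times> points Y \<and>
    definable M (amb_dim X + amb_dim Y)
      {tuple_append (amb_dim X) (amb_dim Y) x y | x y.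
         x \<in> idom X \<and> y \<in> idom Y \<and> (irel X `` {x}, irel Y `` {y}) \<in> R}"

text \<open>Maps defined on a subset U of X.\<close>

definition interpretable_map_on ::
  "('a, 'b) ring_scheme \<Rightarrow> ('a, 'c) iset_scheme \<Rightarrow> (nat \<Rightarrow> 'a) set set \<Rightarrow>
    ('a, 'd) iset_scheme \<Rightarrow> ((nat \<Rightarrow> 'a) set \<Rightarrow> (nat \<Rightarrow> 'a) set) \<Rightarrow> bool" where
  "interpretable_map_on M X U Y f \<longleftrightarrow> interpretable_rel M X Y {(u, f u) | u. u \<in> U}"


section \<open>Interpretable topological spaces\<close>

record 'a ispace = "'a iset" +
  itop :: "(nat \<Rightarrow> 'a) set topology"

definition topologized_iset :: "('a, 'b) ring_scheme \<Rightarrow> 'a ispace \<Rightarrow> bool" where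
  "topologized_iset M X \<longleftrightarrow> interpretable_set M X \<and> topspace (itop X) = points X"

definition interpretable_space :: "('a, 'b) ring_scheme \<Rightarrow> 'a ispace \<Rightarrow> bool" where
  "interpretable_space M X \<longleftrightarrow> topologized_iset M X \<and>
    (\<exists>(I :: 'a iset) S. interpretable_set M I \<and>
       interpretable_rel M I X {(a, u). a \<in> points I \<and> u \<in> S a} \<and>
       openin (itop X) = arbitrary union_of (\<lambda>U. U \<in> S ` points I))"

definition hausdorff_ispace :: "('a, 'b) ring_scheme \<Rightarrow> 'a ispace \<Rightarrow> bool" where
  "hausdorff_ispace M X \<longleftrightarrow> interpretable_space M X \<and> Hausdorff_space (itop X)"

text \<open>A set D of n-tuples with the subspace topology; the tuple x becomes the
  point \<open>{x}\<close> of the quotient by equality.\<close>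

definition tuple_space :: "nat \<Rightarrow> ('a, 'b) ring_scheme \<Rightarrow> nat \<Rightarrow> (nat \<Rightarrow> 'a) set \<Rightarrow> 'a ispace" where
  "tuple_space p M n D =
    \<lparr>amb_dim = n, idom = D, irel = Id_on D,
     itop = pullback_topology ((\<lambda>x. {x}) ` D) the_elem (tuple_topology p M n)\<rparr>"

definition interp_homeomorphic_to_tuples ::
  "nat \<Rightarrow> ('a, 'b) ring_scheme \<Rightarrow> 'a ispace \<Rightarrow> (nat \<Rightarrow> 'a) set set \<Rightarrow> nat \<Rightarrow> (nat \<Rightarrow> 'a) set \<Rightarrow> bool"
where
  "interp_homeomorphic_to_tuples p M X U n D \<longleftrightarrow>
    (\<exists>f. interpretable_map_on M X U (tuple_space p M n D) f \<and>
         homeomorphic_map (subtopology (itop X) U) (itop (tuple_space p M n D)) f)"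

definition interp_open_surjection ::
  "('a, 'b) ring_scheme \<Rightarrow> 'a ispace \<Rightarrow> 'a ispace \<Rightarrow> ((nat \<Rightarrow> 'a) set \<Rightarrow> (nat \<Rightarrow> 'a) set) \<Rightarrow> bool"
where
  "interp_open_surjection M Y X f \<longleftrightarrow>
    interpretable_map_on M Y (points Y) X f \<and> f ` points Y = points X \<and>
    continuous_map (itop Y) (itop X) f \<and> open_map (itop Y) (itop X) f"

definition definable_manifold :: "nat \<Rightarrow> ('a, 'b) ring_scheme \<Rightarrow> 'a ispace \<Rightarrow> bool" where
  "definable_manifold p M X \<longleftrightarrow> hausdorff_ispace M X \<and>
    (\<exists>\<U>. finite \<U> \<and> \<Union>\<U> = points X \<and>
       (\<forall>U\<in>\<U>. openin (itop X) U \<and>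
          (\<exists>k D. definable M k D \<and> openin (tuple_topology p M k) D \<and>
                 interp_homeomorphic_to_tuples p M X U k D)))"

definition is_neighborhood :: "'a ispace \<Rightarrow> (nat \<Rightarrow> 'a) set \<Rightarrow> (nat \<Rightarrow> 'a) set set \<Rightarrow> bool" where
  "is_neighborhood X x N \<longleftrightarrow> N \<subseteq> points X \<and> (\<exists>W. openin (itop X) W \<and> x \<in> W \<and> W \<subseteq> N)"

definition locally_euclidean :: "nat \<Rightarrow> ('a, 'b) ring_scheme \<Rightarrow> 'a ispace \<Rightarrow> bool" where
  "locally_euclidean p M X \<longleftrightarrow> hausdorff_ispace M X \<and>
    (\<forall>x\<in>points X. \<exists>N n D. is_neighborhood X x N \<and>
       definable M n D \<and> openin (tuple_topology p M n) D \<and>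
       interp_homeomorphic_to_tuples p M X N n D)"

definition locally_definable :: "nat \<Rightarrow> ('a, 'b) ring_scheme \<Rightarrow> 'a ispace \<Rightarrow> bool" where
  "locally_definable p M X \<longleftrightarrow> hausdorff_ispace M X \<and>
    (\<forall>x\<in>points X. \<exists>N n D. is_neighborhood X x N \<and>
       definable M n D \<and> interp_homeomorphic_to_tuples p M X N n D)"

definition definably_dominated :: "nat \<Rightarrow> ('a, 'b) ring_scheme \<Rightarrow> 'a ispace \<Rightarrow> bool" where
  "definably_dominated p M X \<longleftrightarrow> hausdorff_ispace M X \<and>
    (\<exists>n D f. definable M n D \<and> interp_open_surjection M (tuple_space p M n D) X f)"

definition manifold_dominated :: "nat \<Rightarrow> ('a, 'b) ring_scheme \<Rightarrow> 'a ispace \<Rightarrow> bool" where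
  "manifold_dominated p M X \<longleftrightarrow> hausdorff_ispace M X \<and>
    (\<exists>Y f. definable_manifold p M Y \<and> interp_open_surjection M Y X f)"

definition admissible :: "nat \<Rightarrow> ('a, 'b) ring_scheme \<Rightarrow> 'a ispace \<Rightarrow> bool" where
  "admissible p M X \<longleftrightarrow> definably_dominated p M X \<and> locally_definable p M X"

definition strongly_admissible :: "nat \<Rightarrow> ('a, 'b) ring_scheme \<Rightarrow> 'a ispace \<Rightarrow> bool" where
  "strongly_admissible p M X \<longleftrightarrow> manifold_dominated p M X \<and> locally_euclidean p M X"


section \<open>Finite disjoint unions and products\<close>

text \<open>Disjoint unions and products of interpretable sets are only determined up to interpretable
  bijection (there is no canonical coding in a quotient of a set of tuples). So \<open>Z\<close> is a
  disjoint union of \<open>X 0, \<dots>, X (m - 1)\<close> if it is identified with the topological sum by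
  interpretable inclusions, and a product if it is identified with the topological product
  by interpretable projections. That the topology of \<open>Z\<close> is interpretable is
  not required here.\<close>

definition is_disjoint_union ::
  "('a, 'b) ring_scheme \<Rightarrow> nat \<Rightarrow> (nat \<Rightarrow> 'a ispace) \<Rightarrow> 'a ispace \<Rightarrow> bool" where
  "is_disjoint_union M m X Z \<longleftrightarrow> topologized_iset M Z \<and>
    (\<exists>inc. (\<forall>i<m. interpretable_map_on M (X i) (points (X i)) Z (inc i)) \<and>
       homeomorphic_map (sum_topology (\<lambda>i. itop (X i)) {..<m}) (itop Z) (\<lambda>(i, x). inc i x))"

definition is_product ::
  "('a, 'b) ring_scheme \<Rightarrow> nat \<Rightarrow> (nat \<Rightarrow> 'a ispace) \<Rightarrow> 'a ispace \<Rightarrow> bool" where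
  "is_product M m X Z \<longleftrightarrow> topologized_iset M Z \<and>
    (\<exists>pr. (\<forall>i<m. interpretable_map_on M Z (points Z) (X i) (pr i)) \<and>
       homeomorphic_map (itop Z) (product_topology (\<lambda>i. itop (X i)) {..<m})
         (\<lambda>z. \<lambda>i\<in>{..<m}. pr i z))"

definition closed_under_disjoint_unions ::
  "('a, 'b) ring_scheme \<Rightarrow> ('a ispace \<Rightarrow> bool) \<Rightarrow> bool" where
  "closed_under_disjoint_unions M C \<longleftrightarrow>
    (\<forall>m X. (\<forall>i<m. C (X i)) \<longrightarrow>
       (\<exists>Z. is_disjoint_union M m X Z) \<and> (\<forall>Z. is_disjoint_union M m X Z \<longrightarrow> C Z))"

definition closed_under_products ::
  "('a, 'b) ring_scheme \<Rightarrow> ('a ispace \<Rightarrow> bool) \<Rightarrow> bool" where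
  "closed_under_products M C \<longleftrightarrow>
    (\<forall>m X. (\<forall>i<m. C (X i)) \<longrightarrow>
       (\<exists>Z. is_product M m X Z) \<and> (\<forall>Z. is_product M m X Z \<longrightarrow> C Z))"

end

theory Submission
  imports Defs
begin

text \<open>Interpretable relations between quotients of definable sets are closed under composition,
  converse and finite unions and intersections, so every map and every basis below is
  interpretable as soon as the inclusions of a sum and the projections of a product are.
  Topologically, bases, charts and open surjections are combined factor by factor; a chart or a
  dominating definable set for the product lives in the space of concatenated tuples.

  The one place where the valuation is used is the domination of a disjoint union:
  the dominating sets are put side by side by prefixing the i-th unit vector to the tuples in
  the i-th set, and the pieces are open because some open set contains 1 but not 0. In the field
  of p-adic numbers such a set is 1 + pO with O the p-adic integers, and its existence is
  expressed by a sentence about any formula that defines O.\<close>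

section \<open>Definable predicates\<close>

text \<open>The obstacle is that a disjoint union or product \<open>Z\<close> is arbitrary: it is
  known only through its inclusions or projections, and its topology is not assumed to be
  interpretable. Standard codings (blocks of one long tuple, tagged tuples) therefore serve only to
  build auxiliary objects: index sets of bases, dominating spaces, targets of charts, and one
  example of \<open>Z\<close>. The results reach an arbitrary \<open>Z\<close> by composing graphs
  with its inclusions or projections.

  Definability is treated semantically, through predicates closed under the logical operations,
  since explicit formulas with de Bruijn indices would grow with every composition. Formulas are
  written out only for the transfer of sentences to the monster model.

  The two kinds of domination differ in one respect. A manifold is an abstract space, so manifolds
  can be added freely. A dominating definable set must carry the subspace topology of a single power
  of the field, so its pieces have to be pulled apart inside that power. The sentence used for this
  quantifies over a uniformizer \<open>b\<close> instead of naming p.\<close>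

primrec rename_tm :: "rtm \<Rightarrow> (nat \<Rightarrow> nat) \<Rightarrow> rtm" where
  "rename_tm (rtm.Var i) r = rtm.Var (r i)"
| "rename_tm rtm.Zero r = rtm.Zero"
| "rename_tm rtm.One r = rtm.One"
| "rename_tm (rtm.Add s t) r = rtm.Add (rename_tm s r) (rename_tm t r)"
| "rename_tm (rtm.Neg t) r = rtm.Neg (rename_tm t r)"
| "rename_tm (rtm.Mul s t) r = rtm.Mul (rename_tm s r) (rename_tm t r)"

text \<open>Under a quantifier the renaming is lifted: index 0 is the bound variable and stays
  fixed, outer indices move up by one. The map \<open>r\<close> need not be injective; collapsing
  all variables to one is used later to instantiate a formula in one variable.\<close>

primrec rename_fm :: "rfm \<Rightarrow> (nat \<Rightarrow> nat) \<Rightarrow> rfm" where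
  "rename_fm (rfm.Eq s t) r = rfm.Eq (rename_tm s r) (rename_tm t r)"
| "rename_fm (rfm.Not \<phi>) r = rfm.Not (rename_fm \<phi> r)"
| "rename_fm (rfm.And \<phi> \<psi>) r = rfm.And (rename_fm \<phi> r) (rename_fm \<psi> r)"
| "rename_fm (rfm.Ex \<phi>) r = rfm.Ex (rename_fm \<phi> (case_nat 0 (\<lambda>i. Suc (r i))))"

lemma tm_val_rename_tm: "tm_val R e (rename_tm t r) = tm_val R (\<lambda>i. e (r i)) t"
  by (induction t) auto

lemma sat_rename_fm: "sat R e (rename_fm \<phi> r) \<longleftrightarrow> sat R (\<lambda>i. e (r i)) \<phi>"
\<comment> \<open>Both are generalised, because a quantifier extends the assignment and lifts the
  renaming.\<close>
proof (induction \<phi> arbitrary: e r)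
  case (Ex \<phi>)
  have "(\<lambda>i. case_nat a e (case_nat 0 (\<lambda>i. Suc (r i)) i)) = case_nat a (\<lambda>i. e (r i))" for a
    by (auto split: nat.split)
  then show ?case by (simp add: Ex)
qed (simp_all add: tm_val_rename_tm)

text \<open>Predicates are on assignments of all variables, so that several tuples, possibly of
  different lengths, can be read off one assignment by means of tuple terms.\<close>

definition definable_pred :: "('a, 'b) ring_scheme \<Rightarrow> ((nat \<Rightarrow> 'a) \<Rightarrow> bool) \<Rightarrow> bool" where
  "definable_pred M P \<longleftrightarrow> (\<exists>n \<phi>. \<exists>e\<in>UNIV \<rightarrow> carrier M.
     \<forall>x\<in>UNIV \<rightarrow> carrier M. P x \<longleftrightarrow> sat M (assign n x e) \<phi>)"

text \<open>Each entry is a constant of the field (\<open>None\<close>) or a variable of the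
  assignment (\<open>Some j\<close>). Constants are allowed because tags put zeros and ones into
  tuples.\<close>

definition tuple_term :: "('a, 'b) ring_scheme \<Rightarrow> nat \<Rightarrow> ((nat \<Rightarrow> 'a) \<Rightarrow> nat \<Rightarrow> 'a) \<Rightarrow> bool" where
  "tuple_term M n t \<longleftrightarrow> (\<exists>r. \<exists>c\<in>UNIV \<rightarrow> carrier M. \<forall>x.
     t x = (\<lambda>i\<in>{..<n}. case r i of None \<Rightarrow> c i | Some j \<Rightarrow> x j))"

lemma definable_predI:
  assumes "e \<in> UNIV \<rightarrow> carrier M"
    and "\<And>x. x \<in> UNIV \<rightarrow> carrier M \<Longrightarrow> P x \<longleftrightarrow> sat M (\<lambda>i. assign n x e (r i)) \<phi>"
  shows "definable_pred M P"
  unfolding definable_pred_def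
  by (rule exI[of _ n], rule exI[of _ "rename_fm \<phi> r"], rule bexI[of _ e])
    (use assms in \<open>auto simp: sat_rename_fm\<close>)

lemma definable_pred_cong:
  assumes "\<And>x. x \<in> UNIV \<rightarrow> carrier M \<Longrightarrow> P x \<longleftrightarrow> Q x"
  shows "definable_pred M P \<longleftrightarrow> definable_pred M Q"
  unfolding definable_pred_def using assms by simp

lemma definable_pred_not:
  assumes "definable_pred M P"
  shows "definable_pred M (\<lambda>x. \<not> P x)"
proof -
  obtain n \<phi> e where "e \<in> UNIV \<rightarrow> carrier M"
    "\<forall>x\<in>UNIV \<rightarrow> carrier M. P x \<longleftrightarrow> sat M (assign n x e) \<phi>"
    using assms by (auto simp: definable_pred_def)
  then show ?thesis
    unfolding definable_pred_def
    by (intro exI[of _ n] exI[of _ "rfm.Not \<phi>"] bexI[of _ e]) auto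
qed

lemma definable_pred_conj:
  assumes "definable_pred M P" "definable_pred M Q"
  shows "definable_pred M (\<lambda>x. P x \<and> Q x)"
proof -
  obtain m \<phi> d where d: "d \<in> UNIV \<rightarrow> carrier M"
    and P: "\<forall>x\<in>UNIV \<rightarrow> carrier M. P x \<longleftrightarrow> sat M (assign m x d) \<phi>"
    using assms(1) by (auto simp: definable_pred_def)
  obtain n \<psi> e where e: "e \<in> UNIV \<rightarrow> carrier M"
    and Q: "\<forall>x\<in>UNIV \<rightarrow> carrier M. Q x \<longleftrightarrow> sat M (assign n x e) \<psi>"
    using assms(2) by (auto simp: definable_pred_def)
  define N where "N = max m n"
  \<comment> \<open>The two formulas have separate parameters, which are interleaved above
    \<open>N\<close>: even offsets hold \<open>d\<close>, odd offsets hold \<open>e\<close>. Indices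
    below \<open>m\<close> or \<open>n\<close> still read the variables.\<close>
  define c where "c = (\<lambda>k. if even (k - N) then d ((k - N) div 2) else e ((k - N) div 2))"
  have "(\<lambda>i. assign N x c (if i < m then i else N + 2 * i)) = assign m x d"
    and "(\<lambda>i. assign N x c (if i < n then i else N + (2 * i + 1))) = assign n x e" for x
    by (rule ext; auto simp: assign_def c_def N_def)+
  then show ?thesis
    unfolding definable_pred_def
    by (intro exI[of _ N] exI[of _ "rfm.And (rename_fm \<phi> (\<lambda>i. if i < m then i else N + 2 * i))
       (rename_fm \<psi> (\<lambda>i. if i < n then i else N + (2 * i + 1)))"] bexI[of _ c])
      (use d e P Q in \<open>auto simp: sat_rename_fm c_def Pi_iff\<close>)
qed

text \<open>Even a formula without parameters needs some assignment of its remaining variables in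
  the carrier; hence the nonempty carrier here and in later lemmas.\<close>

lemma definable_pred_const:
  assumes "carrier M \<noteq> {}"
  shows "definable_pred M (\<lambda>_. b)"
proof -
  obtain a where "a \<in> carrier M" using assms by auto
  let ?t = "rfm.Eq rtm.Zero rtm.Zero"
  show ?thesis
    unfolding definable_pred_def
    by (intro exI[of _ 0] exI[of _ "if b then ?t else rfm.Not ?t"] bexI[of _ "\<lambda>_. a"])
      (use \<open>a \<in> carrier M\<close> in auto)
qed

text \<open>The bound is a number outside the language, so this is a finite conjunction and not a
  quantifier over the field.\<close>

lemma definable_pred_all_less:
  fixes m :: nat
  assumes "carrier M \<noteq> {}" "\<And>i. i < m \<Longrightarrow> definable_pred M (P i)"
  shows "definable_pred M (\<lambda>x. \<forall>i<m. P i x)"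
proof -
  have "definable_pred M (\<lambda>x. \<forall>i<k. P i x)" if "k \<le> m" for k
    using that
  proof (induction k)
    case 0
    then show ?case using definable_pred_const[OF assms(1)] by simp
  next
    case (Suc k)
    have "definable_pred M (\<lambda>x. (\<forall>i<k. P i x) \<and> P k x)"
      using Suc by (intro definable_pred_conj assms(2)) auto
    moreover have "(\<lambda>x. \<forall>i<Suc k. P i x) = (\<lambda>x. (\<forall>i<k. P i x) \<and> P k x)"
      by (auto simp: less_Suc_eq)
    ultimately show ?case by simp
  qed
  then show ?thesis by blast
qed

lemma definable_pred_ex_less:
  fixes m :: nat
  assumes "carrier M \<noteq> {}" "\<And>i. i < m \<Longrightarrow> definable_pred M (P i)"
  shows "definable_pred M (\<lambda>x. \<exists>i<m. P i x)"
  using definable_pred_not[OF definable_pred_all_less[of M m "\<lambda>i x. \<not> P i x"]] assms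
  by (auto dest: definable_pred_not)

lemma definable_pred_ex:
  assumes "definable_pred M P"
  shows "definable_pred M (\<lambda>x. \<exists>a\<in>carrier M. P (case_nat a x))"
proof -
  obtain n \<phi> e where e: "e \<in> UNIV \<rightarrow> carrier M"
    and P: "\<forall>x\<in>UNIV \<rightarrow> carrier M. P x \<longleftrightarrow> sat M (assign n x e) \<phi>"
    using assms by (auto simp: definable_pred_def)
  \<comment> \<open>Below the binder, index 0 is the new value and \<open>Suc j\<close> is the old
    variable \<open>j\<close>. A parameter \<open>i\<close> is read at \<open>Suc (n + i)\<close>,
    safely beyond the \<open>n\<close> old variables, which explains the shift by \<open>n\<close>
    in the new parameter assignment.\<close>
  define r where "r = (\<lambda>i. if i < n then i else Suc (n + i))"
  have "(\<lambda>i. case_nat a (assign n x (\<lambda>j. e (j - n))) (r i)) = assign n (case_nat a x) e" for a x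
    by (auto simp: assign_def r_def split: nat.split)
  moreover have "case_nat a x \<in> UNIV \<rightarrow> carrier M"
    if "a \<in> carrier M" "x \<in> UNIV \<rightarrow> carrier M" for a x
    using that by (auto simp: Pi_iff split: nat.split)
  ultimately show ?thesis
    unfolding definable_pred_def
    by (intro exI[of _ n] exI[of _ "rfm.Ex (rename_fm \<phi> r)"] bexI[of _ "\<lambda>j. e (j - n)"])
      (use e P in \<open>auto simp: sat_rename_fm\<close>)
qed

lemma tuples_Suc:
  "(\<exists>y\<in>tuples M (Suc n). Q y) \<longleftrightarrow> (\<exists>a\<in>carrier M. \<exists>y\<in>tuples M n. Q (y(n := a)))"
  by (auto simp: tuples_def lessThan_Suc PiE_insert_eq)

text \<open>A quantifier over an n-tuple is n nested quantifiers. Each of them inserts its value at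
  index 0, so inside the body the tuple occupies the first \<open>n\<close> variables and the outer
  variables are shifted by \<open>n\<close>.\<close>

lemma definable_pred_ex_tuple:
  assumes "definable_pred M (\<lambda>x. Q (\<lambda>i. x (n + i)) (\<lambda>i\<in>{..<n}. x i))"
  shows "definable_pred M (\<lambda>x. \<exists>y\<in>tuples M n. Q x y)"
  using assms
proof (induction n arbitrary: Q)
  case 0
  then show ?case by (simp add: tuples_def)
next
  case (Suc n)
  have *: "(\<lambda>i\<in>{..<Suc n}. x i) = (\<lambda>i\<in>{..<n}. x i)(n := x n)" for x :: "nat \<Rightarrow> 'a"
    by (auto simp: fun_eq_iff)
  \<comment> \<open>The outermost quantifier supplies the last coordinate: the \<open>n\<close>
    quantifiers inside push its value from index 0 to index \<open>n\<close>.\<close>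
  have "definable_pred M (\<lambda>w. \<exists>y\<in>tuples M n. Q (\<lambda>i. w (Suc i)) (y(n := w 0)))"
    by (rule Suc.IH) (use Suc.prems in \<open>simp only: * add_Suc add_Suc_right add_0_right\<close>)
  from definable_pred_ex[OF this] show ?case
    by (simp add: tuples_Suc)
qed

lemma tuple_term_restrict:
  assumes "carrier M \<noteq> {}"
  shows "tuple_term M n (\<lambda>x. \<lambda>i\<in>{..<n}. x (r i))"
proof -
  obtain a where "a \<in> carrier M" using assms by auto
  then show ?thesis
    unfolding tuple_term_def by (intro exI[of _ "\<lambda>i. Some (r i)"] bexI[of _ "\<lambda>_. a"]) auto
qed

lemma tuple_term_in_tuples:
  "tuple_term M n t \<Longrightarrow> x \<in> UNIV \<rightarrow> carrier M \<Longrightarrow> t x \<in> tuples M n"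
  unfolding tuple_term_def tuples_def
  by (elim exE bexE, drule spec[of _ x]) (auto simp: Pi_iff split: option.split)

text \<open>Substitution of a tuple term for the variables of a defining formula, done by renaming:
  entries that are constants become parameters.\<close>

lemma definable_pred_tuple_term:
  assumes "definable M n D" "tuple_term M n t"
  shows "definable_pred M (\<lambda>x. t x \<in> D)"
proof -
  obtain \<phi> e where e: "e \<in> UNIV \<rightarrow> carrier M"
    and D: "D = {x \<in> tuples M n. sat M (assign n x e) \<phi>}"
    using assms(1) by (auto simp: definable_def)
  obtain r c where c: "c \<in> UNIV \<rightarrow> carrier M"
    and t: "\<And>x. t x = (\<lambda>i\<in>{..<n}. case r i of None \<Rightarrow> c i | Some j \<Rightarrow> x j)"
    using assms(2) unfolding tuple_term_def by blast
  \<comment> \<open>Only finitely many variables occur in the term, so parameters can be stored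
    above a common bound \<open>N\<close>.\<close>
  have "finite (\<Union>i<n. set_option (r i))" by simp
  then obtain N where "\<forall>j\<in>(\<Union>i<n. set_option (r i)). j < N"
    unfolding finite_nat_set_iff_bounded by blast
  then have N: "j < N" if "i < n" "r i = Some j" for i j
    using that by force
  \<comment> \<open>Even offsets hold the constants of the term, odd offsets the parameters of the
    formula.\<close>
  define d where "d = (\<lambda>k. if even (k - N) then c ((k - N) div 2) else e ((k - N) div 2))"
  define \<rho> where "\<rho> = (\<lambda>i. if i < n then (case r i of None \<Rightarrow> N + 2 * i | Some j \<Rightarrow> j) else N + (2 * i + 1))"
  show ?thesis
  proof (rule definable_predI[where n = N and e = d and r = \<rho> and \<phi> = \<phi>])
    show "d \<in> UNIV \<rightarrow> carrier M" using c e by (auto simp: d_def Pi_iff)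
    fix x :: "nat \<Rightarrow> 'a" assume x: "x \<in> UNIV \<rightarrow> carrier M"
    have "(\<lambda>i. assign N x d (\<rho> i)) = assign n (t x) e"
      by (rule ext) (auto simp: assign_def \<rho>_def d_def t N split: option.split)
    then show "t x \<in> D \<longleftrightarrow> sat M (\<lambda>i. assign N x d (\<rho> i)) \<phi>"
      using tuple_term_in_tuples[OF assms(2) x] by (simp add: D)
  qed
qed

lemma definable_Collect:
  assumes "definable_pred M (\<lambda>x. P (\<lambda>i\<in>{..<n}. x i))"
  shows "definable M n {x \<in> tuples M n. P x}"
proof -
  obtain N \<phi> e where e: "e \<in> UNIV \<rightarrow> carrier M"
    and P: "\<forall>x\<in>UNIV \<rightarrow> carrier M. P (\<lambda>i\<in>{..<n}. x i) \<longleftrightarrow> sat M (assign N x e) \<phi>"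
    using assms by (auto simp: definable_pred_def)
  \<comment> \<open>The formula may read variables from \<open>n\<close> up to \<open>N\<close>,
    which are not coordinates of the tuple. The predicate does not depend on them, so they are all
    replaced by the parameter \<open>e 0\<close>; genuine parameters keep their value.\<close>
  define d where "d = (\<lambda>j. if j - n < N then e 0 else e (j - n))"
  define r where "r = (\<lambda>i. if i < n \<and> i < N then i else n + i)"
  have "P x \<longleftrightarrow> sat M (assign n x d) (rename_fm \<phi> r)" if x: "x \<in> tuples M n" for x
  proof -
    define x' where "x' = (\<lambda>i. if i < n then x i else e 0)"
    have "x' \<in> UNIV \<rightarrow> carrier M" "(\<lambda>i\<in>{..<n}. x' i) = x"
      using x e by (auto simp: x'_def tuples_def PiE_iff extensional_def)
    then have "P x \<longleftrightarrow> sat M (assign N x' e) \<phi>" using P by metis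
    moreover have "assign N x' e = (\<lambda>i. assign n x d (r i))"
      by (auto simp: assign_def x'_def d_def r_def)
    ultimately show ?thesis by (simp add: sat_rename_fm)
  qed
  then show ?thesis
    unfolding definable_def
    by (intro exI[of _ "rename_fm \<phi> r"] bexI[of _ d]) (use e in \<open>auto simp: d_def Pi_iff\<close>)
qed

section \<open>Relations between two tuples, encoded by concatenation\<close>

lemma tuple_append_in_tuples:
  "x \<in> tuples M m \<Longrightarrow> y \<in> tuples M n \<Longrightarrow> tuple_append m n x y \<in> tuples M (m + n)"
  by (auto simp: tuples_def tuple_append_def PiE_iff)

lemma fst_tuple_append: "x \<in> tuples M m \<Longrightarrow> (\<lambda>i\<in>{..<m}. tuple_append m n x y i) = x"
  by (auto simp: tuples_def tuple_append_def PiE_iff extensional_def)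

lemma snd_tuple_append: "y \<in> tuples M n \<Longrightarrow> (\<lambda>i\<in>{..<n}. tuple_append m n x y (m + i)) = y"
  by (auto simp: tuples_def tuple_append_def PiE_iff extensional_def)

lemma tuple_append_split:
  assumes "z \<in> tuples M (m + n)"
  shows "tuple_append m n (\<lambda>i\<in>{..<m}. z i) (\<lambda>i\<in>{..<n}. z (m + i)) = z"
  using assms by (auto simp: tuples_def tuple_append_def PiE_iff extensional_def fun_eq_iff)

text \<open>A concatenation can be cut again at position \<open>m\<close>, so a relation between
  tuples turns into a set of long tuples. This produces the encoding used in
  \<open>interpretable_set\<close> and \<open>interpretable_rel\<close>.\<close>

lemma definable_append:
  assumes "definable_pred M (\<lambda>x. P (\<lambda>i\<in>{..<m}. x i) (\<lambda>i\<in>{..<n}. x (m + i)))"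
    and "\<And>x y. P x y \<Longrightarrow> x \<in> tuples M m \<and> y \<in> tuples M n"
  shows "definable M (m + n) {tuple_append m n x y | x y. P x y}"
proof -
  have "{tuple_append m n x y | x y. P x y} =
      {z \<in> tuples M (m + n). P (\<lambda>i\<in>{..<m}. z i) (\<lambda>i\<in>{..<n}. z (m + i))}" (is "?L = ?R")
  proof
    show "?L \<subseteq> ?R"
      using assms(2) by (auto intro!: tuple_append_in_tuples)
        (metis fst_tuple_append snd_tuple_append)
    show "?R \<subseteq> ?L"
    proof
      fix z assume "z \<in> ?R"
      then show "z \<in> ?L"
        using tuple_append_split[of z M m n] by (intro CollectI) (metis (no_types, lifting) mem_Collect_eq)
    qed
  qed
  moreover have "definable M (m + n) ?R"
    by (rule definable_Collect) (use assms(1) in \<open>simp add: restrict_def cong: if_cong\<close>)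
  ultimately show ?thesis by simp
qed

section \<open>Interpretable relations\<close>

lemma definable_subset_tuples: "definable M n D \<Longrightarrow> D \<subseteq> tuples M n"
  by (auto simp: definable_def)

lemma definable_carrier_nonempty: "definable M n D \<Longrightarrow> carrier M \<noteq> {}"
  by (auto simp: definable_def)

context
  fixes M :: "('a, 'b) ring_scheme" and X :: "('a, 'c) iset_scheme"
  assumes X: "interpretable_set M X"
begin

lemma equiv_irel: "equiv (idom X) (irel X)"
  using X by (simp add: interpretable_set_def)

lemma idom_subset_tuples: "idom X \<subseteq> tuples M (amb_dim X)"
  using X definable_subset_tuples by (auto simp: interpretable_set_def)

lemma interpretable_set_carrier_nonempty: "carrier M \<noteq> {}"
  using X definable_carrier_nonempty by (auto simp: interpretable_set_def)

lemma class_in_points_iff: "irel X `` {x} \<in> points X \<longleftrightarrow> x \<in> idom X"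
proof
  assume "irel X `` {x} \<in> points X"
  then have "irel X `` {x} \<noteq> {}"
    using equiv_irel by (metis points_def in_quotient_imp_non_empty)
  then show "x \<in> idom X"
    using equiv_irel by (auto simp: equiv_def refl_on_def)
qed (simp add: points_def quotientI)

lemma points_image: "points X = (\<lambda>x. irel X `` {x}) ` idom X"
  by (auto simp: points_def quotient_def)

lemma class_eq_iff: "x \<in> idom X \<Longrightarrow> y \<in> idom X \<Longrightarrow> irel X `` {x} = irel X `` {y} \<longleftrightarrow> (x, y) \<in> irel X"
  using eq_equiv_class_iff[OF equiv_irel] by auto

text \<open>Formulas quantify over field elements, not over classes; a quantifier over points is
  therefore rewritten as one over tuples, and tuples that represent nothing are excluded by their
  empty class.\<close>

lemma ex_points_iff:
  "(\<exists>u\<in>points X. Q u) \<longleftrightarrow> (\<exists>y\<in>tuples M (amb_dim X). irel X `` {y} \<in> points X \<and> Q (irel X `` {y}))"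
  unfolding class_in_points_iff using idom_subset_tuples by (auto simp: points_image)

lemma definable_pred_idom:
  "tuple_term M (amb_dim X) t \<Longrightarrow> definable_pred M (\<lambda>x. t x \<in> idom X)"
  using X by (intro definable_pred_tuple_term) (auto simp: interpretable_set_def)

lemma definable_pred_points:
  "tuple_term M (amb_dim X) t \<Longrightarrow> definable_pred M (\<lambda>x. irel X `` {t x} \<in> points X)"
  unfolding class_in_points_iff by (rule definable_pred_idom)

end

lemma tuple_term_append:
  assumes "tuple_term M m s" "tuple_term M n t"
  shows "tuple_term M (m + n) (\<lambda>x. tuple_append m n (s x) (t x))"
proof -
  obtain q c where "c \<in> UNIV \<rightarrow> carrier M"
    and "\<forall>x. s x = (\<lambda>i\<in>{..<m}. case q i of None \<Rightarrow> c i | Some j \<Rightarrow> x j)"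
    using assms(1) unfolding tuple_term_def by blast
  moreover obtain r d where "d \<in> UNIV \<rightarrow> carrier M"
    and "\<forall>x. t x = (\<lambda>i\<in>{..<n}. case r i of None \<Rightarrow> d i | Some j \<Rightarrow> x j)"
    using assms(2) unfolding tuple_term_def by blast
  ultimately show ?thesis
    unfolding tuple_term_def
    by (intro exI[of _ "\<lambda>i. if i < m then q i else r (i - m)"]
        bexI[of _ "\<lambda>i. if i < m then c i else d (i - m)"]) (auto simp: tuple_append_def Pi_iff intro!: restrict_ext)
qed

lemma tuple_append_eq_iff:
  assumes "x \<in> tuples M m" "y \<in> tuples M n" "x' \<in> tuples M m" "y' \<in> tuples M n"
  shows "tuple_append m n x y = tuple_append m n x' y' \<longleftrightarrow> x = x' \<and> y = y'"
  using assms by (metis fst_tuple_append snd_tuple_append)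

text \<open>Reads the encoding backwards: concatenation at fixed lengths is injective, so membership
  of the long tuple determines the relation between its parts.\<close>

lemma definable_pred_append:
  assumes "definable M (m + n) {tuple_append m n x y | x y. P x y}"
    and "\<And>x y. P x y \<Longrightarrow> x \<in> tuples M m \<and> y \<in> tuples M n"
    and s: "tuple_term M m s" and t: "tuple_term M n t"
  shows "definable_pred M (\<lambda>x. P (s x) (t x))"
proof -
  have "P (s x) (t x) \<longleftrightarrow>
      tuple_append m n (s x) (t x) \<in> {tuple_append m n x y | x y. P x y}"
    if "x \<in> UNIV \<rightarrow> carrier M" for x
    using assms(2) tuple_append_eq_iff tuple_term_in_tuples[OF s that] tuple_term_in_tuples[OF t that]
    by (smt (verit) mem_Collect_eq)
  then show ?thesis
    using definable_pred_tuple_term[OF assms(1) tuple_term_append[OF s t]]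
    by (subst definable_pred_cong) 
qed

lemma definable_pred_irel:
  assumes X: "interpretable_set M X"
    and "tuple_term M (amb_dim X) s" "tuple_term M (amb_dim X) t"
  shows "definable_pred M (\<lambda>x. (s x, t x) \<in> irel X)"
proof (rule definable_pred_append[OF _ _ assms(2,3)])
  show "x \<in> tuples M (amb_dim X) \<and> y \<in> tuples M (amb_dim X)" if "(x, y) \<in> irel X" for x y
    using that idom_subset_tuples[OF X] equiv_irel[OF X] by (auto simp: equiv_def refl_on_def)
qed (use X in \<open>simp add: interpretable_set_def\<close>)

lemma interpretable_setI:
  assumes "idom X = {x \<in> tuples M (amb_dim X). P x}"
    and "definable_pred M (\<lambda>x. P (\<lambda>i\<in>{..<amb_dim X}. x i))"
    and "equiv (idom X) (irel X)"
    and "definable_pred M (\<lambda>x. (\<lambda>i\<in>{..<amb_dim X}. x i, \<lambda>i\<in>{..<amb_dim X}. x (amb_dim X + i)) \<in> irel X)"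
  shows "interpretable_set M X"
  unfolding interpretable_set_def
proof (intro conjI)
  show "definable M (amb_dim X) (idom X)"
    unfolding assms(1) by (rule definable_Collect) fact
  show "definable M (amb_dim X + amb_dim X)
     {tuple_append (amb_dim X) (amb_dim X) x y |x y. (x, y) \<in> irel X}"
    by (rule definable_append) (use assms in \<open>auto simp: equiv_def refl_on_def\<close>)
qed fact

text \<open>The domain conditions in \<open>interpretable_rel\<close> follow from \<open>R\<close>
  being a relation between points, so definability has to be checked only for the classes.\<close>

lemma interpretable_relI:
  assumes X: "interpretable_set M X" and Y: "interpretable_set M Y"
    and R: "R \<subseteq> points X \<times> points Y"
    and "definable_pred M (\<lambda>x. (irel X `` {\<lambda>i\<in>{..<amb_dim X}. x i},
                                irel Y `` {\<lambda>i\<in>{..<amb_dim Y}. x (amb_dim X + i)}) \<in> R)"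
  shows "interpretable_rel M X Y R"
proof -
  have *: "x \<in> idom X \<and> y \<in> idom Y \<and> (irel X `` {x}, irel Y `` {y}) \<in> R \<longleftrightarrow>
      (irel X `` {x}, irel Y `` {y}) \<in> R" for x y
    using R class_in_points_iff[OF X] class_in_points_iff[OF Y] by auto
  have **: "x \<in> tuples M (amb_dim X) \<and> y \<in> tuples M (amb_dim Y)"
    if "(irel X `` {x}, irel Y `` {y}) \<in> R" for x y
    using that * idom_subset_tuples[OF X] idom_subset_tuples[OF Y] by blast
  show ?thesis
    unfolding interpretable_rel_def * using definable_append[OF assms(4)] ** R by auto
qed

lemma definable_pred_rel:
  assumes X: "interpretable_set M X" and Y: "interpretable_set M Y"
    and R: "interpretable_rel M X Y R"
    and "tuple_term M (amb_dim X) s" "tuple_term M (amb_dim Y) t"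
  shows "definable_pred M (\<lambda>x. (irel X `` {s x}, irel Y `` {t x}) \<in> R)"
proof (rule definable_pred_append[OF _ _ assms(4,5)])
  have "x \<in> idom X \<and> y \<in> idom Y" if "(irel X `` {x}, irel Y `` {y}) \<in> R" for x y
    using that R class_in_points_iff[OF X] class_in_points_iff[OF Y] by (auto simp: interpretable_rel_def)
  moreover from this have "{tuple_append m n x y | x y. (irel X `` {x}, irel Y `` {y}) \<in> R}
    = {tuple_append m n x y | x y. x \<in> idom X \<and> y \<in> idom Y \<and> (irel X `` {x}, irel Y `` {y}) \<in> R}" for m n
    by blast
  ultimately show "definable M (amb_dim X + amb_dim Y)
     {tuple_append (amb_dim X) (amb_dim Y) x y |x y. (irel X `` {x}, irel Y `` {y}) \<in> R}"
    "\<And>x y. (irel X `` {x}, irel Y `` {y}) \<in> R \<Longrightarrow> x \<in> tuples M (amb_dim X) \<and> y \<in> tuples M (amb_dim Y)"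
    using R idom_subset_tuples[OF X] idom_subset_tuples[OF Y] by (auto simp: interpretable_rel_def)
qed

lemma interpretable_rel_converse:
  assumes X: "interpretable_set M X" and Y: "interpretable_set M Y"
    and R: "interpretable_rel M X Y R"
  shows "interpretable_rel M Y X (R\<inverse>)"
proof (rule interpretable_relI[OF Y X])
  show "R\<inverse> \<subseteq> points Y \<times> points X"
    using R by (auto simp: interpretable_rel_def)
  show "definable_pred M (\<lambda>x. (irel Y `` {\<lambda>i\<in>{..<amb_dim Y}. x i},
      irel X `` {\<lambda>i\<in>{..<amb_dim X}. x (amb_dim Y + i)}) \<in> R\<inverse>)"
    unfolding converse_iff
    by (intro definable_pred_rel[OF X Y R] tuple_term_restrict
      interpretable_set_carrier_nonempty[OF X])
qed

lemma interpretable_rel_comp: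
  assumes X: "interpretable_set M X" and Y: "interpretable_set M Y" and Z: "interpretable_set M Z"
    and R: "interpretable_rel M X Y R" and S: "interpretable_rel M Y Z S"
  shows "interpretable_rel M X Z (R O S)"
proof (rule interpretable_relI[OF X Z])
  have sub: "R \<subseteq> points X \<times> points Y" "S \<subseteq> points Y \<times> points Z"
    using R S by (auto simp: interpretable_rel_def)
  then show "R O S \<subseteq> points X \<times> points Z" by blast
  \<comment> \<open>The middle point must be bounded by \<open>points Y\<close> before it can be
    replaced by a representative tuple.\<close>
  have *: "(u, w) \<in> R O S \<longleftrightarrow> (\<exists>v\<in>points Y. (u, v) \<in> R \<and> (v, w) \<in> S)" for u w
    using sub by blast
  show "definable_pred M (\<lambda>x. (irel X `` {\<lambda>i\<in>{..<amb_dim X}. x i},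
      irel Z `` {\<lambda>i\<in>{..<amb_dim Z}. x (amb_dim X + i)}) \<in> R O S)"
    unfolding * ex_points_iff[OF Y]
    by (intro definable_pred_ex_tuple definable_pred_conj definable_pred_points[OF Y]
      definable_pred_rel[OF X Y R] definable_pred_rel[OF Y Z S] tuple_term_restrict
      interpretable_set_carrier_nonempty[OF X])
qed

text \<open>The explicit conditions on \<open>x\<close> and \<open>y\<close> make the case
  \<open>m = 0\<close> meaningful: the empty intersection is all pairs of points. Empty products
  rely on this.\<close>

lemma interpretable_rel_Inter:
  fixes m :: nat
  assumes X: "interpretable_set M X" and Y: "interpretable_set M Y"
    and R: "\<And>i. i < m \<Longrightarrow> interpretable_rel M X Y (R i)"
  shows "interpretable_rel M X Y {(x, y). x \<in> points X \<and> y \<in> points Y \<and> (\<forall>i<m. (x, y) \<in> R i)}"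
proof (rule interpretable_relI[OF X Y])
  show "definable_pred M (\<lambda>x. (irel X `` {\<lambda>i\<in>{..<amb_dim X}. x i},
      irel Y `` {\<lambda>i\<in>{..<amb_dim Y}. x (amb_dim X + i)}) \<in>
        {(x, y). x \<in> points X \<and> y \<in> points Y \<and> (\<forall>i<m. (x, y) \<in> R i)})"
    unfolding mem_Collect_eq prod.case
    by (intro definable_pred_conj definable_pred_all_less definable_pred_points[OF X]
      definable_pred_points[OF Y] definable_pred_rel[OF X Y R] tuple_term_restrict
      interpretable_set_carrier_nonempty[OF X])
qed auto

lemma interpretable_rel_Union:
  fixes m :: nat
  assumes X: "interpretable_set M X" and Y: "interpretable_set M Y"
    and R: "\<And>i. i < m \<Longrightarrow> interpretable_rel M X Y (R i)"
  shows "interpretable_rel M X Y {(x, y). \<exists>i<m. (x, y) \<in> R i}"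
proof (rule interpretable_relI[OF X Y])
  show "{(x, y). \<exists>i<m. (x, y) \<in> R i} \<subseteq> points X \<times> points Y"
    using R by (fastforce simp: interpretable_rel_def)
  show "definable_pred M (\<lambda>x. (irel X `` {\<lambda>i\<in>{..<amb_dim X}. x i},
      irel Y `` {\<lambda>i\<in>{..<amb_dim Y}. x (amb_dim X + i)}) \<in> {(x, y). \<exists>i<m. (x, y) \<in> R i})"
    unfolding mem_Collect_eq prod.case
    by (intro definable_pred_ex_less definable_pred_rel[OF X Y R] tuple_term_restrict
      interpretable_set_carrier_nonempty[OF X])
qed

section \<open>Products and disjoint unions of interpretable sets\<close>

text \<open>The content of \<open>is_product\<close> without topology and with the projections
  named. It also applies to plain index sets of bases, which carry no topology.\<close>

definition iset_product ::
  "('a, 'b) ring_scheme \<Rightarrow> nat \<Rightarrow> (nat \<Rightarrow> ('a, 'c) iset_scheme) \<Rightarrow> ('a, 'd) iset_scheme \<Rightarrow>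
    (nat \<Rightarrow> (nat \<Rightarrow> 'a) set \<Rightarrow> (nat \<Rightarrow> 'a) set) \<Rightarrow> bool" where
  "iset_product M m X Z pr \<longleftrightarrow> interpretable_set M Z \<and>
     (\<forall>i<m. interpretable_map_on M Z (points Z) (X i) (pr i)) \<and>
     bij_betw (\<lambda>z. \<lambda>i\<in>{..<m}. pr i z) (points Z) (\<Pi>\<^sub>E i\<in>{..<m}. points (X i))"

definition iset_sum ::
  "('a, 'b) ring_scheme \<Rightarrow> nat \<Rightarrow> (nat \<Rightarrow> ('a, 'c) iset_scheme) \<Rightarrow> ('a, 'd) iset_scheme \<Rightarrow>
    (nat \<Rightarrow> (nat \<Rightarrow> 'a) set \<Rightarrow> (nat \<Rightarrow> 'a) set) \<Rightarrow> bool" where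
  "iset_sum M m X Z inc \<longleftrightarrow> interpretable_set M Z \<and>
     (\<forall>i<m. interpretable_map_on M (X i) (points (X i)) Z (inc i)) \<and>
     bij_betw (\<lambda>(i, x). inc i x) (SIGMA i:{..<m}. points (X i)) (points Z)"

section \<open>Flattening a finite family of tuples into one tuple\<close>

text \<open>Any bijection between pairs (factor, position) and positions of the long tuple will do.
  An abstract choice avoids arithmetic with partial sums; the blocks need not be contiguous.\<close>

definition flat_index :: "(nat \<Rightarrow> nat) \<Rightarrow> nat \<Rightarrow> nat \<times> nat \<Rightarrow> nat" where
  "flat_index d m = (SOME h. bij_betw h (SIGMA i:{..<m}. {..<d i}) {..<sum d {..<m}})"

lemma bij_betw_flat_index: "bij_betw (flat_index d m) (SIGMA i:{..<m}. {..<d i}) {..<sum d {..<m}}"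
  unfolding flat_index_def
  by (rule someI_ex[of "\<lambda>h. bij_betw h (SIGMA i:{..<m}. {..<d i}) {..<sum d {..<m}}"],
      rule finite_same_card_bij) auto

lemma flat_index_less: "i < m \<Longrightarrow> j < d i \<Longrightarrow> flat_index d m (i, j) < sum d {..<m}"
  using bij_betwE[OF bij_betw_flat_index[of d m]] by auto

definition block :: "(nat \<Rightarrow> nat) \<Rightarrow> nat \<Rightarrow> nat \<Rightarrow> (nat \<Rightarrow> 'a) \<Rightarrow> nat \<Rightarrow> 'a" where
  "block d m i z = (\<lambda>j\<in>{..<d i}. z (flat_index d m (i, j)))"

definition unblock :: "(nat \<Rightarrow> nat) \<Rightarrow> nat \<Rightarrow> (nat \<Rightarrow> nat \<Rightarrow> 'a) \<Rightarrow> nat \<Rightarrow> 'a" where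
  "unblock d m w = (\<lambda>k\<in>{..<sum d {..<m}}.
     case inv_into (SIGMA i:{..<m}. {..<d i}) (flat_index d m) k of (i, j) \<Rightarrow> w i j)"

lemma unblock_flat_index:
  "i < m \<Longrightarrow> j < d i \<Longrightarrow> unblock d m w (flat_index d m (i, j)) = w i j"
  using bij_betw_flat_index[of d m]
  by (simp add: unblock_def flat_index_less bij_betw_def inv_into_f_f)

lemma flat_index_cases:
  assumes "k < sum d {..<m}"
  obtains i j where "i < m" "j < d i" "k = flat_index d m (i, j)"
proof -
  have "k \<in> flat_index d m ` (SIGMA i:{..<m}. {..<d i})"
    using assms bij_betw_imp_surj_on[OF bij_betw_flat_index[of d m]] by simp
  then show ?thesis using that by auto
qed

lemma unblock_in_tuples:
  assumes "\<And>i. i < m \<Longrightarrow> w i \<in> tuples M (d i)"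
  shows "unblock d m w \<in> tuples M (sum d {..<m})"
  unfolding tuples_def
proof
  fix k assume "k \<in> {..<sum d {..<m}}"
  then obtain i j where "i < m" "j < d i" "k = flat_index d m (i, j)"
    by (auto elim: flat_index_cases)
  then show "unblock d m w k \<in> carrier M"
    using assms[of i] by (auto simp: unblock_flat_index tuples_def)
qed (simp add: unblock_def)

lemma block_unblock:
  "w i \<in> tuples M (d i) \<Longrightarrow> i < m \<Longrightarrow> block d m i (unblock d m w) = w i"
  by (auto simp: block_def unblock_flat_index tuples_def PiE_iff extensional_def fun_eq_iff)

lemma block_eqI:
  assumes "z \<in> tuples M (sum d {..<m})" "w \<in> tuples M (sum d {..<m})"
    and "\<And>i. i < m \<Longrightarrow> block d m i z = block d m i w"
  shows "z = w"
proof
  fix k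
  show "z k = w k"
  proof (cases "k < sum d {..<m}")
    case True
    then obtain i j where "i < m" "j < d i" "k = flat_index d m (i, j)"
      by (elim flat_index_cases)
    then show ?thesis
      using fun_cong[OF assms(3)[of i], of j] by (simp add: block_def)
  next
    case False
    then show ?thesis using assms(1,2) by (auto simp: tuples_def PiE_iff extensional_def)
  qed
qed

lemma tuple_term_reindex:
  assumes "tuple_term M n t" "\<And>j. j < k \<Longrightarrow> h j < n"
  shows "tuple_term M k (\<lambda>x. \<lambda>j\<in>{..<k}. t x (h j))"
proof -
  obtain r c where "c \<in> UNIV \<rightarrow> carrier M"
    and "\<forall>x. t x = (\<lambda>i\<in>{..<n}. case r i of None \<Rightarrow> c i | Some j \<Rightarrow> x j)"
    using assms(1) unfolding tuple_term_def by blast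
  then show ?thesis
    unfolding tuple_term_def using assms(2)
    by (intro exI[of _ "\<lambda>j. r (h j)"] bexI[of _ "\<lambda>j. c (h j)"]) (auto simp: Pi_iff intro!: restrict_ext)
qed

lemma tuple_term_block:
  assumes "tuple_term M (sum d {..<m}) t" "i < m"
  shows "tuple_term M (d i) (\<lambda>x. block d m i (t x))"
  unfolding block_def
  by (rule tuple_term_reindex[OF assms(1)]) (rule flat_index_less[OF assms(2)])

text \<open>\<open>Q\<close> describes the graph on representatives and may say anything elsewhere,
  because membership in both domains is added as a conjunct.\<close>

lemma interpretable_map_onI:
  assumes X: "interpretable_set M X" and Y: "interpretable_set M Y"
    and UX: "U \<subseteq> points X" and fY: "f ` U \<subseteq> points Y"
    and "definable_pred M (\<lambda>x. Q (\<lambda>i\<in>{..<amb_dim X}. x i) (\<lambda>i\<in>{..<amb_dim Y}. x (amb_dim X + i)))"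
    and "\<And>x y. x \<in> idom X \<Longrightarrow> y \<in> idom Y \<Longrightarrow>
       Q x y \<longleftrightarrow> irel X `` {x} \<in> U \<and> irel Y `` {y} = f (irel X `` {x})"
  shows "interpretable_map_on M X U Y f"
  unfolding interpretable_map_on_def
proof (rule interpretable_relI[OF X Y])
  have ne: "carrier M \<noteq> {}" by (rule interpretable_set_carrier_nonempty[OF X])
  have "(irel X `` {x}, irel Y `` {y}) \<in> {(u, f u) |u. u \<in> U} \<longleftrightarrow>
      x \<in> idom X \<and> y \<in> idom Y \<and> Q x y" for x y
    using assms(6)[of x y] UX fY class_in_points_iff[OF X, of x] class_in_points_iff[OF Y, of y]
    by (auto simp: image_subset_iff)
  then show "definable_pred M (\<lambda>x. (irel X `` {\<lambda>i\<in>{..<amb_dim X}. x i},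
      irel Y `` {\<lambda>i\<in>{..<amb_dim Y}. x (amb_dim X + i)}) \<in> {(u, f u) |u. u \<in> U})"
    by (simp only:) (intro definable_pred_conj definable_pred_idom X Y tuple_term_restrict ne assms(5))
qed (use UX fY in auto)

text \<open>Equivalence of long tuples is blockwise equivalence, so a class corresponds to a family
  of classes. \<open>Z\<close> is given by its fields rather than constructed, so that the lemma
  serves both quotients and sets of tuples with equality, where a simpler form of \<open>pr\<close>
  is wanted.\<close>

lemma iset_product_blocks:
  fixes X :: "nat \<Rightarrow> ('a, 'c) iset_scheme" and Z :: "('a, 'd) iset_scheme"
  assumes X: "\<And>i. i < m \<Longrightarrow> interpretable_set M (X i)" and ne: "carrier M \<noteq> {}"
    and dim: "amb_dim Z = sum d {..<m}" "\<And>i. i < m \<Longrightarrow> d i = amb_dim (X i)"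
    and idom: "idom Z = {z \<in> tuples M (sum d {..<m}). \<forall>i<m. block d m i z \<in> idom (X i)}"
    and irel: "irel Z = {(z, w). z \<in> idom Z \<and> w \<in> idom Z \<and>
      (\<forall>i<m. (block d m i z, block d m i w) \<in> irel (X i))}"
    and pr: "\<And>i z. i < m \<Longrightarrow> z \<in> idom Z \<Longrightarrow> pr i (irel Z `` {z}) = irel (X i) `` {block d m i z}"
  shows "iset_product M m X Z pr"
proof -
  have eqX: "equiv (idom (X i)) (irel (X i))" if "i < m" for i
    using equiv_irel[OF X[OF that]] .
  have irel_iff: "(z, w) \<in> irel Z \<longleftrightarrow> z \<in> idom Z \<and> w \<in> idom Z \<and>
      (\<forall>i<m. (block d m i z, block d m i w) \<in> irel (X i))" for z w
    by (subst irel) simp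
  have eqZ: "equiv (idom Z) (irel Z)"
  proof (rule equivI)
    show "irel Z \<subseteq> idom Z \<times> idom Z" using irel_iff by auto
    show "refl_on (idom Z) (irel Z)"
    proof (rule refl_onI)
      fix z assume "z \<in> idom Z"
      then have "\<forall>i<m. block d m i z \<in> idom (X i)" by (simp add: idom)
      then show "(z, z) \<in> irel Z"
        using eqX \<open>z \<in> idom Z\<close> by (auto simp: irel_iff equiv_def refl_on_def)
    qed
    show "sym (irel Z)"
      using eqX unfolding irel_iff sym_def by (metis equiv_def symD)
    show "trans (irel Z)"
    proof (rule transI)
      fix u v w assume uvw: "(u, v) \<in> irel Z" "(v, w) \<in> irel Z"
      have "(block d m i u, block d m i w) \<in> irel (X i)" if "i < m" for i
        by (rule transE[of "irel (X i)" _ "block d m i v"])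
          (use uvw eqX[OF that] that in \<open>auto simp: irel_iff equiv_def\<close>)
      then show "(u, w) \<in> irel Z" using uvw by (simp add: irel_iff)
    qed
  qed
  have blockX: "definable_pred M (\<lambda>x. block d m i (t x) \<in> idom (X i))"
    if "i < m" "tuple_term M (sum d {..<m}) t" for i t
    using definable_pred_idom[OF X[OF that(1)]] tuple_term_block[OF that(2,1)] dim that by simp
  have blockX_rel: "definable_pred M (\<lambda>x. (block d m i (s x), block d m i (t x)) \<in> irel (X i))"
    if "i < m" "tuple_term M (sum d {..<m}) s" "tuple_term M (sum d {..<m}) t" for i s t
    using definable_pred_irel[OF X[OF that(1)]] tuple_term_block[OF that(2,1)]
      tuple_term_block[OF that(3,1)] dim that by simp
  have Z: "interpretable_set M Z"
  proof (rule interpretable_setI[where P = "\<lambda>z. \<forall>i<m. block d m i z \<in> idom (X i)"])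
    show "definable_pred M (\<lambda>x. \<forall>i<m. block d m i (\<lambda>i\<in>{..<amb_dim Z}. x i) \<in> idom (X i))"
      unfolding dim by (intro definable_pred_all_less ne blockX tuple_term_restrict)
    \<comment> \<open>Related blocks lie in the domains of their factors, so the domain conditions
      of \<open>irel Z\<close> come for free.\<close>
    have *: "(z, w) \<in> irel Z \<longleftrightarrow> (\<forall>i<m. (block d m i z, block d m i w) \<in> irel (X i))"
      if "z \<in> tuples M (sum d {..<m})" "w \<in> tuples M (sum d {..<m})" for z w
    proof -
      have "u \<in> idom (X i) \<and> v \<in> idom (X i)" if "i < m" "(u, v) \<in> irel (X i)" for i u v
        using that eqX[OF that(1)] by (auto simp: equiv_def)
      then show ?thesis using that unfolding irel_iff idom by blast
    qed
    have **: "definable_pred M (\<lambda>x. \<forall>i<m. (block d m i (\<lambda>i\<in>{..<amb_dim Z}. x i),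
      block d m i (\<lambda>i\<in>{..<amb_dim Z}. x (amb_dim Z + i))) \<in> irel (X i))"
      unfolding dim by (intro definable_pred_all_less ne blockX_rel tuple_term_restrict)
    show "definable_pred M (\<lambda>x. (\<lambda>i\<in>{..<amb_dim Z}. x i, \<lambda>i\<in>{..<amb_dim Z}. x (amb_dim Z + i)) \<in> irel Z)"
      by (rule definable_pred_cong[THEN iffD1, OF _ **]) (rule *[symmetric], auto simp: tuples_def dim)
  qed (use idom dim eqZ in auto)
  have "interpretable_map_on M Z (points Z) (X i) (pr i)" if i: "i < m" for i
  proof (rule interpretable_map_onI[OF Z X[OF i], where Q = "\<lambda>z x. (block d m i z, x) \<in> irel (X i)"])
    show "pr i ` points Z \<subseteq> points (X i)"
      using pr[OF i] idom i class_in_points_iff[OF X[OF i]] by (auto simp: points_image[OF Z])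
    show "definable_pred M (\<lambda>x. (block d m i (\<lambda>i\<in>{..<amb_dim Z}. x i),
        \<lambda>j\<in>{..<amb_dim (X i)}. x (amb_dim Z + j)) \<in> irel (X i))"
      using definable_pred_irel[OF X[OF i], of _ "\<lambda>x. \<lambda>j\<in>{..<amb_dim (X i)}. x (amb_dim Z + j)"]
        tuple_term_block[OF tuple_term_restrict[OF ne, of "sum d {..<m}" "\<lambda>i. i"] i]
        tuple_term_restrict[OF ne] dim i by simp
    fix z x assume z: "z \<in> idom Z" and x: "x \<in> idom (X i)"
    show "(block d m i z, x) \<in> irel (X i) \<longleftrightarrow>
        irel Z `` {z} \<in> points Z \<and> irel (X i) `` {x} = pr i (irel Z `` {z})"
      using pr[OF i z] z x idom i class_eq_iff[OF X[OF i], of "block d m i z" x]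
        class_in_points_iff[OF Z] by auto
  qed auto
  moreover have "bij_betw (\<lambda>z. \<lambda>i\<in>{..<m}. pr i z) (points Z) (\<Pi>\<^sub>E i\<in>{..<m}. points (X i))"
  proof (rule bij_betwI')
    fix u v assume "u \<in> points Z" "v \<in> points Z"
    then obtain z w where zw: "z \<in> idom Z" "w \<in> idom Z" "u = irel Z `` {z}" "v = irel Z `` {w}"
      by (auto simp: points_image[OF Z])
    have "(\<lambda>i\<in>{..<m}. pr i u) = (\<lambda>i\<in>{..<m}. pr i v) \<longleftrightarrow> (\<forall>i<m. pr i u = pr i v)"
      by (auto simp: fun_eq_iff restrict_def)
    also have "\<dots> \<longleftrightarrow> (\<forall>i<m. (block d m i z, block d m i w) \<in> irel (X i))"
      using zw pr idom class_eq_iff[OF X] by auto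
    also have "\<dots> \<longleftrightarrow> (z, w) \<in> irel Z"
      using zw irel_iff by simp
    finally show "(\<lambda>i\<in>{..<m}. pr i u) = (\<lambda>i\<in>{..<m}. pr i v) \<longleftrightarrow> u = v"
      using zw class_eq_iff[OF Z] by auto
  next
    fix u assume "u \<in> points Z"
    then show "(\<lambda>i\<in>{..<m}. pr i u) \<in> (\<Pi>\<^sub>E i\<in>{..<m}. points (X i))"
      using pr idom class_in_points_iff[OF X] by (auto simp: points_image[OF Z])
  next
    fix y assume y: "y \<in> (\<Pi>\<^sub>E i\<in>{..<m}. points (X i))"
    then have "y i \<in> points (X i)" if "i < m" for i
      using that by auto
    \<comment> \<open>Surjectivity: a representative is chosen in every factor, and the chosen
      tuples are flattened into one.\<close>
    then have "\<forall>i\<in>{..<m}. \<exists>x\<in>idom (X i). y i = irel (X i) `` {x}"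
      using points_image[OF X] by fastforce
    then obtain w where w: "\<And>i. i < m \<Longrightarrow> w i \<in> idom (X i)" "\<And>i. i < m \<Longrightarrow> y i = irel (X i) `` {w i}"
      by (metis lessThan_iff)
    have wt: "w i \<in> tuples M (d i)" if "i < m" for i
      using w(1)[OF that] idom_subset_tuples[OF X[OF that]] dim(2)[OF that] by auto
    have bw: "block d m i (unblock d m w) = w i" if "i < m" for i
      by (rule block_unblock) (use wt that in auto)
    have "unblock d m w \<in> tuples M (sum d {..<m})"
      by (rule unblock_in_tuples) (rule wt)
    then have zw: "unblock d m w \<in> idom Z"
      using w bw by (simp add: idom)
    have "y = (\<lambda>i\<in>{..<m}. pr i (irel Z `` {unblock d m w}))"
      using y pr[OF _ zw] w bw by (auto simp: PiE_iff extensional_def fun_eq_iff)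
    then show "\<exists>x\<in>points Z. y = (\<lambda>i\<in>{..<m}. pr i x)"
      using class_in_points_iff[OF Z] zw by blast
  qed
  ultimately show ?thesis using Z by (simp add: iset_product_def)
qed

lemma iset_product_exists:
  fixes X :: "nat \<Rightarrow> ('a, 'c) iset_scheme"
  assumes X: "\<And>i. i < m \<Longrightarrow> interpretable_set M (X i)" and ne: "carrier M \<noteq> {}"
  shows "\<exists>(Z :: 'a iset) pr. iset_product M m X Z pr"
proof -
  define d where "d = (\<lambda>i. amb_dim (X i))"
  define D where "D = {z \<in> tuples M (sum d {..<m}). \<forall>i<m. block d m i z \<in> idom (X i)}"
  define E where "E = {(z, w). z \<in> D \<and> w \<in> D \<and>
      (\<forall>i<m. (block d m i z, block d m i w) \<in> irel (X i))}"
  define Z where "Z = \<lparr>amb_dim = sum d {..<m}, idom = D, irel = E\<rparr>"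
  have Z: "amb_dim Z = sum d {..<m}" "idom Z = D" "irel Z = E"
    by (simp_all add: Z_def)
  \<comment> \<open>The union ranges over all representatives of the class; their i-th blocks are
    equivalent, so it is the union of one and the same class.\<close>
  have "iset_product M m X Z (\<lambda>i u. \<Union>z\<in>u. irel (X i) `` {block d m i z})"
  proof (rule iset_product_blocks[OF X ne Z(1)])
    fix i z assume i: "i < m" and "z \<in> idom Z"
    then have z: "z \<in> D" using Z by simp
    have eq: "equiv (idom (X i)) (irel (X i))" if "i < m" for i
      using equiv_irel[OF X[OF that]] .
    have "(block d m i z, block d m i z) \<in> irel (X i)" if "i < m" for i
      using eq[OF that] z that by (auto simp: D_def equiv_def refl_on_def)
    then have "z \<in> irel Z `` {z}"
      using z Z by (simp add: E_def)
    moreover have "irel (X i) `` {block d m i w} = irel (X i) `` {block d m i z}"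
      if "w \<in> irel Z `` {z}" for w
    proof -
      have "(block d m i z, block d m i w) \<in> irel (X i)"
        using that i Z by (simp add: E_def)
      from equiv_class_eq[OF eq[OF i] this] show ?thesis by simp
    qed
    ultimately show "(\<Union>z\<in>irel Z `` {z}. irel (X i) `` {block d m i z}) = irel (X i) `` {block d m i z}"
      by blast
  next
    show "idom Z = {z \<in> tuples M (sum d {..<m}). \<forall>i<m. block d m i z \<in> idom (X i)}"
      using Z by (simp add: D_def)
    show "irel Z = {(z, w). z \<in> idom Z \<and> w \<in> idom Z \<and>
        (\<forall>i<m. (block d m i z, block d m i w) \<in> irel (X i))}"
      using Z by (simp add: E_def)
  qed (simp_all add: d_def)
  then show ?thesis by blast
qed

section \<open>Tagged tuples as a coding of disjoint unions\<close>

text \<open>All summands must be placed in tuples of one length, so the unit vector and the tuple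
  are followed by zeros. The sum of the dimensions is simply a bound for each of them.\<close>

definition tag :: "('a, 'b) ring_scheme \<Rightarrow> (nat \<Rightarrow> nat) \<Rightarrow> nat \<Rightarrow> nat \<Rightarrow> (nat \<Rightarrow> 'a) \<Rightarrow> nat \<Rightarrow> 'a" where
  "tag M d m i x = (\<lambda>k\<in>{..<m + sum d {..<m}}.
     if k < m then (if k = i then \<one>\<^bsub>M\<^esub> else \<zero>\<^bsub>M\<^esub>)
     else if k - m < d i then x (k - m) else \<zero>\<^bsub>M\<^esub>)"

definition untag :: "(nat \<Rightarrow> nat) \<Rightarrow> nat \<Rightarrow> nat \<Rightarrow> (nat \<Rightarrow> 'a) \<Rightarrow> nat \<Rightarrow> 'a" where
  "untag d m i z = (\<lambda>j\<in>{..<d i}. z (m + j))"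

lemma le_sum_lessThan: "i < m \<Longrightarrow> d i \<le> sum d {..<m}" for d :: "nat \<Rightarrow> nat"
  by (simp add: member_le_sum)

lemma untag_tag: "x \<in> tuples M (d i) \<Longrightarrow> i < m \<Longrightarrow> untag d m i (tag M d m i x) = x"
  using le_sum_lessThan[of i m d]
  by (auto simp: untag_def tag_def tuples_def PiE_iff extensional_def fun_eq_iff)

lemma tag_in_tuples:
  "\<zero>\<^bsub>M\<^esub> \<in> carrier M \<Longrightarrow> \<one>\<^bsub>M\<^esub> \<in> carrier M \<Longrightarrow> i < m \<Longrightarrow> x \<in> tuples M (d i) \<Longrightarrow>
    tag M d m i x \<in> tuples M (m + sum d {..<m})"
  by (auto simp: tuples_def tag_def PiE_iff)

text \<open>Coordinate \<open>i\<close> is one under tag \<open>i\<close> and zero under every other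
  tag; equal tags can then be removed by \<open>untag\<close>.\<close>

lemma tag_eq_tag_iff:
  assumes "\<one>\<^bsub>M\<^esub> \<noteq> \<zero>\<^bsub>M\<^esub>" "i < m" "j < m" "x \<in> tuples M (d i)" "y \<in> tuples M (d j)"
  shows "tag M d m i x = tag M d m j y \<longleftrightarrow> i = j \<and> x = y"
proof
  assume eq: "tag M d m i x = tag M d m j y"
  have "i = j"
    using fun_cong[OF eq, of i] assms(1-3) by (auto simp: tag_def split: if_splits)
  with eq show "i = j \<and> x = y"
    using untag_tag[of x M d i m] untag_tag[of y M d j m] assms(2-5) by simp
qed simp

lemma tuple_term_tag:
  assumes "tuple_term M (d i) t" "i < m" "\<zero>\<^bsub>M\<^esub> \<in> carrier M" "\<one>\<^bsub>M\<^esub> \<in> carrier M"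
  shows "tuple_term M (m + sum d {..<m}) (\<lambda>x. tag M d m i (t x))"
proof -
  obtain r c where "c \<in> UNIV \<rightarrow> carrier M"
    and "\<forall>x. t x = (\<lambda>i\<in>{..<d i}. case r i of None \<Rightarrow> c i | Some j \<Rightarrow> x j)"
    using assms(1) unfolding tuple_term_def by blast
  then show ?thesis
    unfolding tuple_term_def using assms(2-)
    by (intro exI[of _ "\<lambda>k. if k < m then None else if k - m < d i then r (k - m) else None"]
        bexI[of _ "\<lambda>k. if k < m then (if k = i then \<one>\<^bsub>M\<^esub> else \<zero>\<^bsub>M\<^esub>)
          else if k - m < d i then c (k - m) else \<zero>\<^bsub>M\<^esub>"])
      (auto simp: tag_def Pi_iff intro!: restrict_ext)
qed

lemma tuple_term_untag:
  assumes "tuple_term M (m + sum d {..<m}) t" "i < m"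
  shows "tuple_term M (d i) (\<lambda>x. untag d m i (t x))"
  unfolding untag_def
  by (rule tuple_term_reindex[OF assms(1)]) (use le_sum_lessThan[OF assms(2), of d] in simp)

lemma definable_pred_var_eq:
  assumes "carrier M \<noteq> {}"
  shows "definable_pred M (\<lambda>x. x i = x j)"
proof -
  obtain a where "a \<in> carrier M" using assms by auto
  then show ?thesis
    unfolding definable_pred_def
    by (intro exI[of _ "i + j + 1"] exI[of _ "rfm.Eq (rtm.Var i) (rtm.Var j)"] bexI[of _ "\<lambda>_. a"])
      (auto simp: assign_def)
qed

lemma restrict_eq_restrict_iff:
  "restrict f {..<n} = restrict g {..<n} \<longleftrightarrow> (\<forall>i<n. f i = g i)" for n :: nat
  by (auto simp: restrict_def fun_eq_iff)

text \<open>The diagonal is a finite conjunction of equations between variables; the two terms are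
  substituted afterwards.\<close>

lemma definable_pred_eq:
  assumes ne: "carrier M \<noteq> {}" and s: "tuple_term M n s" and t: "tuple_term M n t"
  shows "definable_pred M (\<lambda>x. s x = t x)"
proof -
  have "definable M (n + n) {tuple_append n n x y |x y. x \<in> tuples M n \<and> x = y}"
  proof (rule definable_append)
    have iff: "(\<lambda>i\<in>{..<n}. x i) \<in> tuples M n \<and> (\<lambda>i\<in>{..<n}. x i) = (\<lambda>i\<in>{..<n}. x (n + i)) \<longleftrightarrow>
        (\<forall>i<n. x i = x (n + i))" if "x \<in> UNIV \<rightarrow> carrier M" for x
      using tuple_term_in_tuples[OF tuple_term_restrict[OF ne, of n "\<lambda>i. i"] that]
      unfolding restrict_eq_restrict_iff by simp
    have all: "definable_pred M (\<lambda>x. \<forall>i<n. x i = x (n + i))"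
      by (intro definable_pred_all_less definable_pred_var_eq ne)
    show "definable_pred M (\<lambda>x. (\<lambda>i\<in>{..<n}. x i) \<in> tuples M n \<and>
        (\<lambda>i\<in>{..<n}. x i) = (\<lambda>i\<in>{..<n}. x (n + i)))"
      by (rule definable_pred_cong[THEN iffD1, OF _ all]) (rule iff[symmetric])
  qed auto
  then have eq: "definable_pred M (\<lambda>x. s x \<in> tuples M n \<and> s x = t x)"
    by (rule definable_pred_append[OF _ _ s t]) auto
  have "s x \<in> tuples M n \<and> s x = t x \<longleftrightarrow> s x = t x" if "x \<in> UNIV \<rightarrow> carrier M" for x
    using tuple_term_in_tuples[OF s that] by simp
  with eq show ?thesis
    using definable_pred_cong[of M "\<lambda>x. s x \<in> tuples M n \<and> s x = t x" "\<lambda>x. s x = t x"] by blast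
qed

text \<open>Related tuples always carry the same tag. A class of the union is therefore the image of
  a class of one summand, and taking images under \<open>tag\<close> is the inclusion.\<close>

lemma iset_sum_tags:
  fixes X :: "nat \<Rightarrow> ('a, 'c) iset_scheme" and Z :: "('a, 'd) iset_scheme"
  assumes X: "\<And>i. i < m \<Longrightarrow> interpretable_set M (X i)"
    and M: "\<zero>\<^bsub>M\<^esub> \<in> carrier M" "\<one>\<^bsub>M\<^esub> \<in> carrier M" "\<one>\<^bsub>M\<^esub> \<noteq> \<zero>\<^bsub>M\<^esub>"
    and dim: "amb_dim Z = m + sum d {..<m}" "\<And>i. i < m \<Longrightarrow> d i = amb_dim (X i)"
    and idom: "idom Z = {tag M d m i x | i x. i < m \<and> x \<in> idom (X i)}"
    and irel: "irel Z = {(tag M d m i x, tag M d m i y) | i x y. i < m \<and> (x, y) \<in> irel (X i)}"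
  shows "iset_sum M m X Z (\<lambda>i u. tag M d m i ` u)"
proof -
  have ne: "carrier M \<noteq> {}" using M by auto
  have eqX: "equiv (idom (X i)) (irel (X i))" if "i < m" for i
    using equiv_irel[OF X[OF that]] .
  have tup: "x \<in> tuples M (d i)" if "i < m" "x \<in> idom (X i)" for i x
    using that idom_subset_tuples[OF X[OF that(1)]] dim(2)[OF that(1)] by auto
  have rel_idom: "x \<in> idom (X i) \<and> y \<in> idom (X i)" if "i < m" "(x, y) \<in> irel (X i)" for i x y
    using that eqX[OF that(1)] by (auto simp: equiv_def)
  have tag_inj: "tag M d m i x = tag M d m j y \<longleftrightarrow> i = j \<and> x = y"
    if "i < m" "j < m" "x \<in> idom (X i)" "y \<in> idom (X j)" for i j x y
    using tag_eq_tag_iff[OF M(3)] that tup by blast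
  have tag_rel: "(tag M d m i x, w) \<in> irel Z \<longleftrightarrow> (\<exists>y. w = tag M d m i y \<and> (x, y) \<in> irel (X i))"
    if "i < m" "x \<in> idom (X i)" for i x w
    using that tag_inj rel_idom by (subst irel) blast
  have eqZ: "equiv (idom Z) (irel Z)"
  proof (rule equivI)
    show "irel Z \<subseteq> idom Z \<times> idom Z"
      unfolding irel idom using rel_idom by fast
    show "refl_on (idom Z) (irel Z)"
      unfolding refl_on_def idom using tag_rel eqX by (blast dest: equiv_class_self)
    show "sym (irel Z)"
      proof (rule symI)
      fix u v assume "(u, v) \<in> irel Z"
      then obtain i x y where i: "i < m" "u = tag M d m i x" "v = tag M d m i y" "(x, y) \<in> irel (X i)"
        unfolding irel by blast
      then have "(y, x) \<in> irel (X i)"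
        using eqX[OF i(1)] by (meson equiv_def symD)
      with i show "(v, u) \<in> irel Z" unfolding irel by blast
    qed
    show "trans (irel Z)"
    proof (rule transI)
      fix u v w assume "(u, v) \<in> irel Z" "(v, w) \<in> irel Z"
      then obtain i x y where i: "i < m" "u = tag M d m i x" "v = tag M d m i y" "(x, y) \<in> irel (X i)"
        unfolding irel by blast
      with \<open>(v, w) \<in> irel Z\<close> obtain z where z: "w = tag M d m i z" "(y, z) \<in> irel (X i)"
        using tag_rel[of i y w] rel_idom by blast
      have "(x, z) \<in> irel (X i)"
        using i z eqX[OF i(1)] by (meson equiv_def transE)
      with i z show "(u, w) \<in> irel Z"
        unfolding irel by blast
    qed
  qed
  have class_tag: "irel Z `` {tag M d m i x} = tag M d m i ` (irel (X i) `` {x})"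
    if "i < m" "x \<in> idom (X i)" for i x
    using tag_rel[OF that] by auto
  have idomX: "definable_pred M (\<lambda>x. t x \<in> idom (X i))" if "i < m" "tuple_term M (d i) t" for i t
    using definable_pred_idom[OF X] that dim(2) by simp
  have irelX: "definable_pred M (\<lambda>x. (s x, t x) \<in> irel (X i))"
    if "i < m" "tuple_term M (d i) s" "tuple_term M (d i) t" for i s t
    using definable_pred_irel[OF X] that dim(2) by simp
  let ?N = "m + sum d {..<m}"
  \<comment> \<open>The equation says that the tuple has tag \<open>i\<close> and the correct
    padding. It replaces an existential quantifier over the untagged tuple, which
    \<open>untag\<close> recovers by a term.\<close>
  have tagged: "definable_pred M (\<lambda>x. t x = tag M d m i (untag d m i (t x)))"
    if "i < m" "tuple_term M ?N t" for i t
    using that by (intro definable_pred_eq[OF ne, of ?N] tuple_term_tag tuple_term_untag M)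
  have Z: "interpretable_set M Z"
  proof (rule interpretable_setI[where P = "\<lambda>z. \<exists>i<m. untag d m i z \<in> idom (X i) \<and>
      z = tag M d m i (untag d m i z)"])
    show "idom Z = {x \<in> tuples M (amb_dim Z).
        \<exists>i<m. untag d m i x \<in> idom (X i) \<and> x = tag M d m i (untag d m i x)}"
      (is "_ = ?R")
    proof
      show "idom Z \<subseteq> ?R"
      proof
        fix w assume "w \<in> idom Z"
        then obtain i x where i: "i < m" "x \<in> idom (X i)" and w: "w = tag M d m i x"
          unfolding idom by blast
        have "untag d m i w = x" and "w \<in> tuples M (amb_dim Z)"
          using untag_tag[of x M d i m] tag_in_tuples[of M i m x d] i tup[OF i] M
          by (simp_all only: w dim(1))
        with i w show "w \<in> ?R" by auto
      qed
      show "?R \<subseteq> idom Z" unfolding idom by blast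
    qed
    show "definable_pred M (\<lambda>x. \<exists>i<m. untag d m i (\<lambda>i\<in>{..<amb_dim Z}. x i) \<in> idom (X i) \<and>
        (\<lambda>i\<in>{..<amb_dim Z}. x i) = tag M d m i (untag d m i (\<lambda>i\<in>{..<amb_dim Z}. x i)))"
      unfolding dim
      by (intro definable_pred_ex_less definable_pred_conj ne idomX tagged
          tuple_term_untag tuple_term_restrict)
    have "(z, w) \<in> irel Z \<longleftrightarrow> (\<exists>i<m. (untag d m i z, untag d m i w) \<in> irel (X i) \<and>
         z = tag M d m i (untag d m i z) \<and> w = tag M d m i (untag d m i w))" (is "?l \<longleftrightarrow> ?r") for z w
    proof
      assume ?l
      then obtain i x y where i: "i < m" "z = tag M d m i x" "w = tag M d m i y" "(x, y) \<in> irel (X i)"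
        unfolding irel by blast
      then have "untag d m i z = x" "untag d m i w = y"
        using rel_idom[OF i(1,4)] tup[OF i(1)] by (auto intro: untag_tag)
      then show ?r using i by auto
    next
      show "?r \<Longrightarrow> ?l" unfolding irel by blast
    qed
    then show "definable_pred M (\<lambda>x. (\<lambda>i\<in>{..<amb_dim Z}. x i, \<lambda>i\<in>{..<amb_dim Z}. x (amb_dim Z + i)) \<in> irel Z)"
      unfolding dim
      by (simp only:) (intro definable_pred_ex_less definable_pred_conj ne irelX tagged
          tuple_term_untag tuple_term_restrict)
  qed (use eqZ in auto)
  have "interpretable_map_on M (X i) (points (X i)) Z ((`) (tag M d m i))" if i: "i < m" for i
  proof (rule interpretable_map_onI[OF X[OF i] Z, where Q = "\<lambda>x z. (tag M d m i x, z) \<in> irel Z"])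
    show "(`) (tag M d m i) ` points (X i) \<subseteq> points Z"
    proof
      fix v assume "v \<in> (`) (tag M d m i) ` points (X i)"
      then obtain x where x: "x \<in> idom (X i)" and "v = tag M d m i ` irel (X i) `` {x}"
        unfolding points_image[OF X[OF i]] by blast
      then have "v = irel Z `` {tag M d m i x}" by (simp only: class_tag[OF i])
      moreover have "tag M d m i x \<in> idom Z" using i x idom by blast
      ultimately show "v \<in> points Z" using class_in_points_iff[OF Z] by simp
    qed
    show "definable_pred M (\<lambda>x. (tag M d m i (\<lambda>i\<in>{..<amb_dim (X i)}. x i),
        \<lambda>j\<in>{..<amb_dim Z}. x (amb_dim (X i) + j)) \<in> irel Z)"
      unfolding dim(2)[OF i, symmetric]
      by (intro definable_pred_irel[OF Z]; unfold dim(1);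
          intro tuple_term_tag tuple_term_restrict ne i M)
    fix x z assume xz: "x \<in> idom (X i)" "z \<in> idom Z"
    then have "tag M d m i x \<in> idom Z" using i idom by blast
    then show "(tag M d m i x, z) \<in> irel Z \<longleftrightarrow>
        irel (X i) `` {x} \<in> points (X i) \<and> irel Z `` {z} = tag M d m i ` irel (X i) `` {x}"
      unfolding class_tag[OF i xz(1), symmetric] class_in_points_iff[OF X[OF i]]
      using class_eq_iff[OF Z, of "tag M d m i x" z] xz by auto
  qed auto
  moreover have "bij_betw (\<lambda>(i, u). tag M d m i ` u) (SIGMA i:{..<m}. points (X i)) (points Z)"
    unfolding bij_betw_def
  proof
    show "inj_on (\<lambda>(i, u). tag M d m i ` u) (SIGMA i:{..<m}. points (X i))"
    proof (rule inj_onI, clarify)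
      fix i u j v
      assume i: "i < m" "j < m" and u: "u \<in> points (X i)" and v: "v \<in> points (X j)"
        and eq: "tag M d m i ` u = tag M d m j ` v"
      have sub: "u \<subseteq> idom (X i)" "v \<subseteq> idom (X j)" and "u \<noteq> {}"
        using u v in_quotient_imp_subset[OF eqX[OF i(1)]] in_quotient_imp_subset[OF eqX[OF i(2)]]
          in_quotient_imp_non_empty[OF eqX[OF i(1)]]
        by (auto simp: points_def)
      from \<open>u \<noteq> {}\<close> obtain x where "x \<in> u" by auto
      then obtain y where "y \<in> v" "tag M d m i x = tag M d m j y"
        using eq by (metis imageE imageI)
      then have "i = j"
        using tag_inj[OF i] sub \<open>x \<in> u\<close> by auto
      moreover have "inj_on (tag M d m i) (idom (X i))"
        using tag_inj[OF i(1) i(1)] by (auto simp: inj_on_def)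
      ultimately show "i = j \<and> u = v"
        using eq sub by (auto simp: inj_on_image_eq_iff)
    qed
    show "(\<lambda>(i, u). tag M d m i ` u) ` (SIGMA i:{..<m}. points (X i)) = points Z"
    proof -
      have "points Z = (\<Union>i<m. (\<lambda>x. irel Z `` {tag M d m i x}) ` idom (X i))"
        unfolding points_image[OF Z] idom by blast
      also have "\<dots> = (\<Union>i<m. (\<lambda>x. tag M d m i ` irel (X i) `` {x}) ` idom (X i))"
        using class_tag by (intro SUP_cong image_cong) auto
      also have "\<dots> = (\<Union>i<m. (`) (tag M d m i) ` points (X i))"
        using points_image[OF X] by (intro SUP_cong) (auto simp: image_image)
      finally show ?thesis by auto
    qed
  qed
  ultimately show ?thesis using Z by (simp add: iset_sum_def)
qed

section \<open>Products and disjoint unions of topological spaces\<close>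

lemma image_product:
  "(\<lambda>x. \<lambda>i\<in>I. f i (x i)) ` Pi\<^sub>E I A = Pi\<^sub>E I (\<lambda>i. f i ` A i)"
proof
  show "Pi\<^sub>E I (\<lambda>i. f i ` A i) \<subseteq> (\<lambda>x. \<lambda>i\<in>I. f i (x i)) ` Pi\<^sub>E I A"
  proof
    fix w assume w: "w \<in> Pi\<^sub>E I (\<lambda>i. f i ` A i)"
    then have "\<forall>i\<in>I. \<exists>v\<in>A i. w i = f i v" by (auto simp: PiE_iff)
    then obtain v where v: "\<forall>i\<in>I. v i \<in> A i \<and> w i = f i (v i)" by metis
    then have "restrict v I \<in> Pi\<^sub>E I A" by auto
    moreover have "w = (\<lambda>i\<in>I. f i (restrict v I i))"
      using v w by (auto simp: PiE_iff extensional_def fun_eq_iff)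
    ultimately show "w \<in> (\<lambda>x. \<lambda>i\<in>I. f i (x i)) ` Pi\<^sub>E I A" by blast
  qed
qed auto

text \<open>A finite index set makes every box with open sides open. This matters because the maps
  need not be surjective, so all sides of the image box may be proper.\<close>

lemma open_map_product:
  assumes "finite I" "\<And>i. i \<in> I \<Longrightarrow> open_map (X i) (Y i) (f i)"
  shows "open_map (product_topology X I) (product_topology Y I) (\<lambda>x. \<lambda>i\<in>I. f i (x i))"
  unfolding open_map_def
proof (intro allI impI)
  fix U assume U: "openin (product_topology X I) U"
  show "openin (product_topology Y I) ((\<lambda>x. \<lambda>i\<in>I. f i (x i)) ` U)"
    unfolding openin_product_topology_alt
  proof
    fix y assume "y \<in> (\<lambda>x. \<lambda>i\<in>I. f i (x i)) ` U"
    then obtain x where x: "x \<in> U" "y = (\<lambda>i\<in>I. f i (x i))" by auto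
    then obtain V where V: "\<forall>i\<in>I. openin (X i) (V i)" "x \<in> Pi\<^sub>E I V" "Pi\<^sub>E I V \<subseteq> U"
      using U unfolding openin_product_topology_alt by blast
    have "Pi\<^sub>E I (\<lambda>i. f i ` V i) \<subseteq> (\<lambda>x. \<lambda>i\<in>I. f i (x i)) ` U"
      unfolding image_product[symmetric] using V(3) by (rule image_mono)
    then show "\<exists>W. finite {i \<in> I. W i \<noteq> topspace (Y i)} \<and> (\<forall>i\<in>I. openin (Y i) (W i)) \<and>
        y \<in> Pi\<^sub>E I W \<and> Pi\<^sub>E I W \<subseteq> (\<lambda>x. \<lambda>i\<in>I. f i (x i)) ` U"
      using assms V x by (intro exI[of _ "\<lambda>i. f i ` V i"]) (auto simp: open_map_def PiE_iff)
  qed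
qed

lemma continuous_map_product:
  assumes "\<And>i. i \<in> I \<Longrightarrow> continuous_map (X i) (Y i) (f i)"
  shows "continuous_map (product_topology X I) (product_topology Y I) (\<lambda>x. \<lambda>i\<in>I. f i (x i))"
  unfolding continuous_map_componentwise
proof (intro conjI ballI)
  fix k assume k: "k \<in> I"
  have "continuous_map (product_topology X I) (Y k) (f k \<circ> (\<lambda>x. x k))"
    by (intro continuous_map_compose[OF continuous_map_product_projection] k assms)
  then show "continuous_map (product_topology X I) (Y k) (\<lambda>x. (\<lambda>i\<in>I. f i (x i)) k)"
    using k by (simp add: o_def)
qed auto

lemma homeomorphic_map_product:
  assumes "finite I" "\<And>i. i \<in> I \<Longrightarrow> homeomorphic_map (X i) (Y i) (f i)"
  shows "homeomorphic_map (product_topology X I) (product_topology Y I) (\<lambda>x. \<lambda>i\<in>I. f i (x i))"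
proof (rule bijective_open_imp_homeomorphic_map)
  have f: "continuous_map (X i) (Y i) (f i)" "open_map (X i) (Y i) (f i)"
    "f i ` topspace (X i) = topspace (Y i)" "inj_on (f i) (topspace (X i))" if "i \<in> I" for i
    using assms(2)[OF that] by (simp_all add: homeomorphic_eq_everything_map)
  show "continuous_map (product_topology X I) (product_topology Y I) (\<lambda>x. \<lambda>i\<in>I. f i (x i))"
    by (rule continuous_map_product) (rule f)
  show "open_map (product_topology X I) (product_topology Y I) (\<lambda>x. \<lambda>i\<in>I. f i (x i))"
    by (rule open_map_product) (use assms f in auto)
  show "(\<lambda>x. \<lambda>i\<in>I. f i (x i)) ` topspace (product_topology X I) = topspace (product_topology Y I)"
    unfolding topspace_product_topology image_product using f(3) by (intro PiE_cong) auto
  show "inj_on (\<lambda>x. \<lambda>i\<in>I. f i (x i)) (topspace (product_topology X I))"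
  proof (rule inj_onI)
    fix x y assume xy: "x \<in> topspace (product_topology X I)" "y \<in> topspace (product_topology X I)"
      and eq: "(\<lambda>i\<in>I. f i (x i)) = (\<lambda>i\<in>I. f i (y i))"
    have "x i = y i" if "i \<in> I" for i
      using fun_cong[OF eq, of i] f(4)[OF that] xy that by (auto simp: PiE_iff inj_on_def)
    then show "x = y" using xy by (intro PiE_ext) auto
  qed
qed

lemma homeomorphic_map_pullback_topology:
  assumes "inj_on g A" "g ` A \<subseteq> topspace T"
  shows "homeomorphic_map (pullback_topology A g T) (subtopology T (g ` A)) g"
proof (rule bijective_open_imp_homeomorphic_map)
  have top: "topspace (pullback_topology A g T) = A"
    using assms(2) by (auto simp: topspace_pullback_topology)
  show "continuous_map (pullback_topology A g T) (subtopology T (g ` A)) g"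
    using continuous_map_pullback[OF continuous_map_id, of A g T] top
    by (simp add: continuous_map_in_subtopology id_comp)
  show "open_map (pullback_topology A g T) (subtopology T (g ` A)) g"
    unfolding open_map_def openin_pullback_topology openin_subtopology
  proof clarify
    fix U assume "openin T U"
    then show "\<exists>V. openin T V \<and> g ` (g -` U \<inter> A) = V \<inter> g ` A"
      by (intro exI[of _ U]) auto
  qed
  show "g ` topspace (pullback_topology A g T) = topspace (subtopology T (g ` A))"
    using assms(2) top by auto
  show "inj_on g (topspace (pullback_topology A g T))"
    using assms(1) top by simp
qed

text \<open>Transport of structure along a bijection. It supplies the topology when a product or sum
  has so far been built only as an interpretable set.\<close>

lemma
  assumes "bij_betw g A (topspace T)"
  shows topspace_pullback_bij: "topspace (pullback_topology A g T) = A"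
    and homeomorphic_map_pullback_bij: "homeomorphic_map (pullback_topology A g T) T g"
  using assms homeomorphic_map_pullback_topology[of g A T]
  unfolding bij_betw_def topspace_pullback_topology by (auto simp del: topspace_product_topology)

lemma Hausdorff_space_sum_topology:
  assumes "\<And>i. i \<in> I \<Longrightarrow> Hausdorff_space (X i)"
  shows "Hausdorff_space (sum_topology X I)"
  unfolding Hausdorff_space_def
proof (intro allI impI)
  fix u v assume uv: "u \<in> topspace (sum_topology X I) \<and> v \<in> topspace (sum_topology X I) \<and> u \<noteq> v"
  then obtain i x j y where ij: "u = (i, x)" "v = (j, y)" "i \<in> I" "j \<in> I"
    "x \<in> topspace (X i)" "y \<in> topspace (X j)" by (cases u, cases v) auto
  have op: "openin (sum_topology X I) (Pair k ` W)" if "k \<in> I" "openin (X k) W" for k W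
    using open_map_component_injection[OF that(1), of X] that(2) by (auto simp: open_map_def)
  show "\<exists>U V. openin (sum_topology X I) U \<and> openin (sum_topology X I) V \<and> u \<in> U \<and> v \<in> V \<and> disjnt U V"
  proof (cases "i = j")
    case True
    then obtain U V where "openin (X i) U" "openin (X i) V" "x \<in> U" "y \<in> V" "disjnt U V"
      using assms[OF ij(3)] ij uv unfolding Hausdorff_space_def by blast
    then show ?thesis
      using ij True by (intro exI[of _ "Pair i ` U"] exI[of _ "Pair i ` V"]) (auto simp: op disjnt_def)
  next
    case False
    then show ?thesis
      using ij by (intro exI[of _ "Pair i ` topspace (X i)"] exI[of _ "Pair j ` topspace (X j)"])
        (auto simp: op disjnt_def)
  qed
qed

lemma open_map_sum:
  assumes "\<And>i. i \<in> I \<Longrightarrow> open_map (X i) (Y i) (f i)"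
  shows "open_map (sum_topology X I) (sum_topology Y I) (\<lambda>(i, x). (i, f i x))"
  unfolding open_map_def forall_openin_sum_topology
proof (intro allI impI)
  fix T assume "\<forall>i\<in>I. openin (X i) (T i)"
  moreover have "(\<lambda>(i, x). (i, f i x)) ` Sigma I T = Sigma I (\<lambda>i. f i ` T i)" by force
  ultimately show "openin (sum_topology Y I) ((\<lambda>(i, x). (i, f i x)) ` Sigma I T)"
    using assms by (simp add: openin_disjoint_union open_map_def)
qed

lemma continuous_map_from_sum:
  assumes "\<And>i. i \<in> I \<Longrightarrow> continuous_map (X i) Y (\<lambda>x. f (i, x))"
  shows "continuous_map (sum_topology X I) Y f"
  unfolding continuous_map_def openin_sum_topology
proof (intro conjI allI impI ballI)
  show "f \<in> topspace (sum_topology X I) \<rightarrow> topspace Y"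
    using assms by (auto simp: continuous_map_def Pi_iff)
  fix U i assume "openin Y U" "i \<in> I"
  then have "openin (X i) {x \<in> topspace (X i). f (i, x) \<in> U}"
    using assms by (auto simp: continuous_map_def)
  moreover have "{x. (i, x) \<in> {x \<in> topspace (sum_topology X I). f x \<in> U}} =
      {x \<in> topspace (X i). f (i, x) \<in> U}" using \<open>i \<in> I\<close> by auto
  ultimately show "openin (X i) {x. (i, x) \<in> {x \<in> topspace (sum_topology X I). f x \<in> U}}" by simp
qed auto

lemma continuous_map_sum:
  assumes "\<And>i. i \<in> I \<Longrightarrow> continuous_map (X i) (Y i) (f i)"
  shows "continuous_map (sum_topology X I) (sum_topology Y I) (\<lambda>(i, x). (i, f i x))"
proof (rule continuous_map_from_sum)
  fix i assume i: "i \<in> I"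
  show "continuous_map (X i) (sum_topology Y I) (\<lambda>x. case (i, x) of (i, x) \<Rightarrow> (i, f i x))"
    using continuous_map_compose[OF assms[OF i] continuous_map_component_injection[OF i, of Y]]
    by (simp add: o_def)
qed

text \<open>Both notions see only the three fields of the interpretable set, so a set can be
  replaced by a space with the same fields once a topology has been chosen.\<close>

lemma
  assumes "amb_dim Z = amb_dim Y" "idom Z = idom Y" "irel Z = irel Y"
  shows iset_product_fields: "iset_product M m X Y pr \<Longrightarrow> iset_product M m X Z pr"
    and iset_sum_fields: "iset_sum M m X Y inc \<Longrightarrow> iset_sum M m X Z inc"
  unfolding iset_product_def iset_sum_def interpretable_map_on_def interpretable_rel_def
    interpretable_set_def points_def assms by assumption+

section \<open>Elementwise use of the product and sum bijections\<close>

context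
  fixes M :: "('a, 'b) ring_scheme" and m :: nat
    and X :: "nat \<Rightarrow> ('a, 'c) iset_scheme" and Z :: "('a, 'd) iset_scheme"
begin

lemma interpretable_map_on_in:
  "interpretable_map_on M Z U Y f \<Longrightarrow> u \<in> U \<Longrightarrow> f u \<in> points Y"
  by (auto simp: interpretable_map_on_def interpretable_rel_def)

lemma iset_product_in_points:
  "iset_product M m X Z pr \<Longrightarrow> i < m \<Longrightarrow> z \<in> points Z \<Longrightarrow> pr i z \<in> points (X i)"
  using interpretable_map_on_in[of "points Z" "X i" "pr i"] by (auto simp: iset_product_def)

lemma iset_product_eqI:
  assumes "iset_product M m X Z pr" "z \<in> points Z" "w \<in> points Z" "\<And>i. i < m \<Longrightarrow> pr i z = pr i w"
  shows "z = w"
proof -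
  have "(\<lambda>i\<in>{..<m}. pr i z) = (\<lambda>i\<in>{..<m}. pr i w)"
    by (rule restrict_ext) (use assms(4) in auto)
  then show ?thesis
    using assms(1-3) by (auto simp: iset_product_def bij_betw_def dest: inj_onD)
qed

lemma iset_product_surj:
  assumes "iset_product M m X Z pr" "\<And>i. i < m \<Longrightarrow> x i \<in> points (X i)"
  obtains z where "z \<in> points Z" "\<And>i. i < m \<Longrightarrow> pr i z = x i"
proof -
  have "restrict x {..<m} \<in> (\<Pi>\<^sub>E i\<in>{..<m}. points (X i))"
    using assms(2) by auto
  then have "restrict x {..<m} \<in> (\<lambda>z. \<lambda>i\<in>{..<m}. pr i z) ` points Z"
    using assms(1) by (auto simp: iset_product_def bij_betw_def)
  then obtain z where "z \<in> points Z" and eq: "restrict x {..<m} = (\<lambda>i\<in>{..<m}. pr i z)"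
    by auto
  moreover have "pr i z = x i" if "i < m" for i
    using fun_cong[OF eq, of i] that by simp
  ultimately show ?thesis using that by blast
qed

lemma iset_sum_in_points:
  "iset_sum M m X Z inc \<Longrightarrow> i < m \<Longrightarrow> x \<in> points (X i) \<Longrightarrow> inc i x \<in> points Z"
  by (auto simp: iset_sum_def bij_betw_def)

lemma iset_sum_inj:
  assumes "iset_sum M m X Z inc" "i < m" "j < m" "x \<in> points (X i)" "y \<in> points (X j)"
  shows "inc i x = inc j y \<longleftrightarrow> i = j \<and> x = y"
proof -
  have "inj_on (\<lambda>(i, x). inc i x) (SIGMA i:{..<m}. points (X i))"
    using assms(1) by (auto simp: iset_sum_def bij_betw_def)
  from inj_on_eq_iff[OF this, of "(i, x)" "(j, y)"] show ?thesis
    using assms(2-) by auto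
qed

lemma iset_sum_cases:
  assumes "iset_sum M m X Z inc" "z \<in> points Z"
  obtains i x where "i < m" "x \<in> points (X i)" "z = inc i x"
proof -
  have "z \<in> (\<lambda>(i, x). inc i x) ` (SIGMA i:{..<m}. points (X i))"
    using assms by (auto simp: iset_sum_def bij_betw_def)
  then show ?thesis using that by auto
qed

end

lemma iset_sum_exists:
  fixes X :: "nat \<Rightarrow> ('a, 'c) iset_scheme"
  assumes X: "\<And>i. i < m \<Longrightarrow> interpretable_set M (X i)"
    and M: "\<zero>\<^bsub>M\<^esub> \<in> carrier M" "\<one>\<^bsub>M\<^esub> \<in> carrier M" "\<one>\<^bsub>M\<^esub> \<noteq> \<zero>\<^bsub>M\<^esub>"
  shows "\<exists>(Z :: 'a iset) inc. iset_sum M m X Z inc"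
proof -
  define d where "d = (\<lambda>i. amb_dim (X i))"
  define Z where "Z = \<lparr>amb_dim = m + sum d {..<m},
    idom = {tag M d m i x | i x. i < m \<and> x \<in> idom (X i)},
    irel = {(tag M d m i x, tag M d m i y) | i x y. i < m \<and> (x, y) \<in> irel (X i)}\<rparr>"
  have "iset_sum M m X Z (\<lambda>i u. tag M d m i ` u)"
    by (rule iset_sum_tags[OF X M]) (simp_all add: Z_def d_def)
  then show ?thesis by blast
qed

abbreviation product_itop :: "nat \<Rightarrow> (nat \<Rightarrow> 'a ispace) \<Rightarrow> (nat \<Rightarrow> (nat \<Rightarrow> 'a) set) topology" where
  "product_itop m X \<equiv> product_topology (\<lambda>i. itop (X i)) {..<m}"

abbreviation sum_itop :: "nat \<Rightarrow> (nat \<Rightarrow> 'a ispace) \<Rightarrow> (nat \<times> (nat \<Rightarrow> 'a) set) topology" where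
  "sum_itop m X \<equiv> sum_topology (\<lambda>i. itop (X i)) {..<m}"

text \<open>Since the points are exactly the elements of the topological space, the bijection
  underlying the homeomorphism is the one that \<open>iset_product\<close> asks for.\<close>

lemma is_productE:
  assumes "is_product M m X Z" "\<And>i. i < m \<Longrightarrow> topologized_iset M (X i)"
  obtains pr where "iset_product M m X Z pr"
    "homeomorphic_map (itop Z) (product_itop m X) (\<lambda>z. \<lambda>i\<in>{..<m}. pr i z)"
proof -
  obtain pr where pr: "\<forall>i<m. interpretable_map_on M Z (points Z) (X i) (pr i)"
    and hom: "homeomorphic_map (itop Z) (product_itop m X) (\<lambda>z. \<lambda>i\<in>{..<m}. pr i z)"
    and Z: "topologized_iset M Z"
    using assms(1) by (auto simp: is_product_def)
  have "(\<Pi>\<^sub>E i\<in>{..<m}. points (X i)) = (\<Pi>\<^sub>E i\<in>{..<m}. topspace (itop (X i)))"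
    using assms(2) by (intro PiE_cong) (auto simp: topologized_iset_def)
  then have "iset_product M m X Z pr"
    using hom Z pr by (auto simp: iset_product_def topologized_iset_def bij_betw_def
        homeomorphic_eq_everything_map)
  then show ?thesis using hom that by blast
qed

lemma is_productI:
  assumes "iset_product M m X Z pr" "topspace (itop Z) = points Z"
    "homeomorphic_map (itop Z) (product_itop m X) (\<lambda>z. \<lambda>i\<in>{..<m}. pr i z)"
  shows "is_product M m X Z"
  using assms by (auto simp: is_product_def topologized_iset_def iset_product_def)

lemma is_disjoint_unionE:
  assumes "is_disjoint_union M m X Z" "\<And>i. i < m \<Longrightarrow> topologized_iset M (X i)"
  obtains inc where "iset_sum M m X Z inc"
    "homeomorphic_map (sum_itop m X) (itop Z) (\<lambda>(i, x). inc i x)"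
proof -
  obtain inc where inc: "\<forall>i<m. interpretable_map_on M (X i) (points (X i)) Z (inc i)"
    and hom: "homeomorphic_map (sum_itop m X) (itop Z) (\<lambda>(i, x). inc i x)"
    and Z: "topologized_iset M Z"
    using assms(1) by (auto simp: is_disjoint_union_def)
  have "(SIGMA i:{..<m}. points (X i)) = topspace (sum_itop m X)"
    using assms(2) by (auto simp: topologized_iset_def)
  then have "iset_sum M m X Z inc"
    using hom Z inc by (auto simp: iset_sum_def topologized_iset_def bij_betw_def
        homeomorphic_eq_everything_map)
  then show ?thesis using hom that by blast
qed

lemma is_disjoint_unionI:
  assumes "iset_sum M m X Z inc" "topspace (itop Z) = points Z"
    "homeomorphic_map (sum_itop m X) (itop Z) (\<lambda>(i, x). inc i x)"
  shows "is_disjoint_union M m X Z"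
  using assms by (auto simp: is_disjoint_union_def topologized_iset_def iset_sum_def)

text \<open>The interpretable product receives the topology pulled back along the tuple of its
  projections, which is a homeomorphism by construction.\<close>

lemma is_product_exists:
  assumes X: "\<And>i. i < m \<Longrightarrow> topologized_iset M (X i)" and ne: "carrier M \<noteq> {}"
  shows "\<exists>Z. is_product M m X Z"
proof -
  obtain Y :: "'a iset" and pr where Y: "iset_product M m X Y pr"
    using iset_product_exists[of m M X] X ne by (auto simp: topologized_iset_def)
  let ?g = "\<lambda>z. \<lambda>i\<in>{..<m}. pr i z"
  let ?T = "product_itop m X"
  define Z where "Z = \<lparr>amb_dim = amb_dim Y, idom = idom Y, irel = irel Y,
    itop = pullback_topology (points Y) ?g ?T\<rparr>"
  have pts: "points Z = points Y" by (simp add: Z_def points_def)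
  have "(\<Pi>\<^sub>E i\<in>{..<m}. points (X i)) = topspace ?T"
    unfolding topspace_product_topology using X by (intro PiE_cong) (simp add: topologized_iset_def)
  then have g: "bij_betw ?g (points Y) (topspace ?T)"
    using Y by (simp add: iset_product_def)
  have "homeomorphic_map (itop Z) ?T ?g"
    using homeomorphic_map_pullback_bij[OF g] by (simp only: Z_def ispace.simps)
  moreover have "topspace (itop Z) = points Z"
    using topspace_pullback_bij[OF g] by (simp only: pts) (simp only: Z_def ispace.simps)
  moreover have "iset_product M m X Z pr"
    by (rule iset_product_fields[OF _ _ _ Y]) (simp_all add: Z_def)
  ultimately have "is_product M m X Z" by (intro is_productI)
  then show ?thesis ..
qed

lemma is_disjoint_union_exists:
  assumes X: "\<And>i. i < m \<Longrightarrow> topologized_iset M (X i)"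
    and M: "\<zero>\<^bsub>M\<^esub> \<in> carrier M" "\<one>\<^bsub>M\<^esub> \<in> carrier M" "\<one>\<^bsub>M\<^esub> \<noteq> \<zero>\<^bsub>M\<^esub>"
  shows "\<exists>Z. is_disjoint_union M m X Z"
proof -
  obtain Y :: "'a iset" and inc where Y: "iset_sum M m X Y inc"
    using iset_sum_exists[of m M X] X M by (auto simp: topologized_iset_def)
  let ?T = "sum_itop m X"
  let ?g = "\<lambda>(i, x). inc i x"
  \<comment> \<open>A topology can be pulled back only along a map that starts at \<open>Z\<close>,
    so the inverse of the joint inclusion is used here.\<close>
  let ?h = "inv_into (topspace ?T) ?g"
  define Z where "Z = \<lparr>amb_dim = amb_dim Y, idom = idom Y, irel = irel Y,
    itop = pullback_topology (points Y) ?h ?T\<rparr>"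
  have pts: "points Z = points Y" by (simp add: Z_def points_def)
  have "(SIGMA i:{..<m}. points (X i)) = topspace ?T"
    using X by (auto simp: topologized_iset_def)
  then have g: "bij_betw ?g (topspace ?T) (points Y)"
    using Y by (simp add: iset_sum_def)
  then have h: "bij_betw ?h (points Y) (topspace ?T)"
    by (rule bij_betw_inv_into)
  have top: "topspace (itop Z) = points Z"
    using topspace_pullback_bij[OF h] by (simp only: pts) (simp only: Z_def ispace.simps)
  have "homeomorphic_map (itop Z) ?T ?h"
    using homeomorphic_map_pullback_bij[OF h] by (simp only: Z_def ispace.simps)
  then obtain k where k: "homeomorphic_maps (itop Z) ?T ?h k"
    unfolding homeomorphic_map_maps by blast
  \<comment> \<open>The homeomorphism comes with some inverse \<open>k\<close>. Applying
    \<open>?g\<close> to the equation \<open>?h (k u) = u\<close> identifies it with the joint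
    inclusion.\<close>
  have "k u = ?g u" if u: "u \<in> topspace ?T" for u
  proof -
    have "continuous_map ?T (itop Z) k" "?h (k u) = u"
      using k u unfolding homeomorphic_maps_def by (simp_all del: topspace_sum_topology)
    then have "k u \<in> points Y" "?h (k u) = u"
      using continuous_map_image_subset_topspace[of ?T "itop Z" k] u top pts by auto
    then show ?thesis
      using bij_betw_inv_into_right[OF g, of "k u"] by (simp only:)
  qed
  moreover have "homeomorphic_map ?T (itop Z) k"
    using k homeomorphic_maps_sym homeomorphic_map_maps by blast
  ultimately have "homeomorphic_map ?T (itop Z) ?g"
    by (intro homeomorphic_map_eq[of ?T "itop Z" k ?g])
  moreover have "iset_sum M m X Z inc"
    by (rule iset_sum_fields[OF _ _ _ Y]) (simp_all add: Z_def)
  ultimately have "is_disjoint_union M m X Z" using top by (intro is_disjoint_unionI)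
  then show ?thesis ..
qed

section \<open>Closure under products\<close>

definition graph_on :: "'u set \<Rightarrow> ('u \<Rightarrow> 'v) \<Rightarrow> ('u \<times> 'v) set" where
  "graph_on U f = {(u, f u) | u. u \<in> U}"

lemma in_graph_on [simp]: "(u, v) \<in> graph_on U f \<longleftrightarrow> u \<in> U \<and> v = f u"
  by (auto simp: graph_on_def)

lemma interpretable_map_on_graph_on:
  "interpretable_map_on M X U Y f \<longleftrightarrow> interpretable_rel M X Y (graph_on U f)"
  by (simp add: interpretable_map_on_def graph_on_def)

lemma interpretable_map_on_subset:
  "interpretable_map_on M X U Y f \<Longrightarrow> U \<subseteq> points X"
  by (auto simp: interpretable_map_on_def interpretable_rel_def)

text \<open>Universal property of the product: the graph is the intersection of the component
  conditions, each pulled back along the converse of a projection. The \<open>R i\<close> are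
  relations and not graphs of total maps, so the restriction to \<open>U\<close> can be hidden in
  them.\<close>

lemma interpretable_map_into_product:
  assumes Z: "iset_product M m X Z pr" and X: "\<And>i. i < m \<Longrightarrow> interpretable_set M (X i)"
    and W: "interpretable_set M W"
    and R: "\<And>i. i < m \<Longrightarrow> interpretable_rel M W (X i) (R i)"
    and U: "U \<subseteq> points W" "\<And>w. w \<in> U \<Longrightarrow> f w \<in> points Z"
    and f: "\<And>w z. w \<in> points W \<Longrightarrow> z \<in> points Z \<Longrightarrow> w \<in> U \<and> z = f w \<longleftrightarrow> (\<forall>i<m. (w, pr i z) \<in> R i)"
  shows "interpretable_map_on M W U Z f"
proof -
  have Z': "interpretable_set M Z" "\<And>i. i < m \<Longrightarrow> interpretable_rel M Z (X i) (graph_on (points Z) (pr i))"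
    using Z by (simp_all add: iset_product_def interpretable_map_on_graph_on)
  have "interpretable_rel M W Z {(w, z). w \<in> points W \<and> z \<in> points Z \<and>
     (\<forall>i<m. (w, z) \<in> R i O (graph_on (points Z) (pr i))\<inverse>)}"
  proof (rule interpretable_rel_Inter[OF W Z'(1)])
    fix i assume i: "i < m"
    show "interpretable_rel M W Z (R i O (graph_on (points Z) (pr i))\<inverse>)"
      by (rule interpretable_rel_comp[OF W X[OF i] Z'(1) R[OF i]
          interpretable_rel_converse[OF Z'(1) X[OF i] Z'(2)[OF i]]])
  qed
  moreover have "{(w, z). w \<in> points W \<and> z \<in> points Z \<and>
     (\<forall>i<m. (w, z) \<in> R i O (graph_on (points Z) (pr i))\<inverse>)} = graph_on U f" (is "?L = _")
  proof (rule Set.set_eqI)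
    fix v :: "(nat \<Rightarrow> 'a) set \<times> (nat \<Rightarrow> 'a) set"
    obtain w z where v: "v = (w, z)" by (cases v)
    have "(w, z) \<in> ?L \<longleftrightarrow> w \<in> points W \<and> z \<in> points Z \<and> (\<forall>i<m. (w, pr i z) \<in> R i)"
      by (auto simp: relcomp_unfold)
    also have "\<dots> \<longleftrightarrow> (w, z) \<in> graph_on U f"
      using f[of w z] subsetD[OF U(1), of w] U(2)[of w] by auto
    finally show "v \<in> ?L \<longleftrightarrow> v \<in> graph_on U f" unfolding v .
  qed
  ultimately show ?thesis by (simp add: interpretable_map_on_graph_on)
qed

lemma hausdorff_ispaceD:
  assumes "hausdorff_ispace M X"
  shows "topologized_iset M X" "interpretable_set M X" "topspace (itop X) = points X"
    "Hausdorff_space (itop X)"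
  using assms by (auto simp: hausdorff_ispace_def interpretable_space_def topologized_iset_def)

lemma continuous_map_product_homeo:
  assumes "homeomorphic_map Z (product_topology X {..<m}) (\<lambda>z. \<lambda>i\<in>{..<m}. pr i z)" "i < m"
  shows "continuous_map Z (X i) (pr i)"
proof -
  have "continuous_map Z (product_topology X {..<m}) (\<lambda>z. \<lambda>i\<in>{..<m}. pr i z)"
    using assms(1) by (rule homeomorphic_imp_continuous_map)
  then have "\<forall>k\<in>{..<m}. continuous_map Z (X k) (\<lambda>z. (\<lambda>i\<in>{..<m}. pr i z) k)"
    unfolding continuous_map_componentwise by blast
  then show ?thesis using assms(2) by simp
qed

lemma openin_finite_preimages:
  fixes m :: nat
  assumes "\<And>i. i < m \<Longrightarrow> continuous_map Z (X i) (f i)" "\<And>i. i < m \<Longrightarrow> openin (X i) (U i)"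
  shows "openin Z {z \<in> topspace Z. \<forall>i<m. f i z \<in> U i}"
  using assms
proof (induction m)
  case (Suc m)
  have "{z \<in> topspace Z. \<forall>i<Suc m. f i z \<in> U i} =
      {z \<in> topspace Z. \<forall>i<m. f i z \<in> U i} \<inter> {z \<in> topspace Z. f m z \<in> U m}"
    by (auto simp: less_Suc_eq)
  moreover have "openin Z {z \<in> topspace Z. f m z \<in> U m}"
    using Suc.prems[of m] by (auto intro: openin_continuous_map_preimage)
  ultimately show ?case using Suc by auto
qed simp

section \<open>Interpretable bases and the product topology\<close>

text \<open>The pointwise form of a basis: inside every open set each point has a basic
  neighbourhood. It is easier to verify than a presentation of open sets as unions.\<close>

definition interpretable_base ::
  "('a, 'b) ring_scheme \<Rightarrow> 'a ispace \<Rightarrow> 'a iset \<Rightarrow> ((nat \<Rightarrow> 'a) set \<Rightarrow> (nat \<Rightarrow> 'a) set set) \<Rightarrow> bool" where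
  "interpretable_base M X I S \<longleftrightarrow> interpretable_set M I \<and>
     interpretable_rel M I X {(a, u). a \<in> points I \<and> u \<in> S a} \<and>
     (\<forall>a\<in>points I. openin (itop X) (S a)) \<and>
     (\<forall>U. openin (itop X) U \<longrightarrow> (\<forall>x\<in>U. \<exists>a\<in>points I. x \<in> S a \<and> S a \<subseteq> U))"

lemma interpretable_space_iff_base:
  "interpretable_space M X \<longleftrightarrow> topologized_iset M X \<and> (\<exists>I S. interpretable_base M X I S)"
  unfolding interpretable_space_def interpretable_base_def openin_topology_base_unique
  by (intro arg_cong2[where f = "(\<and>)"] refl ex_cong1) auto

lemma interpretable_bases:
  assumes "\<And>i. i < m \<Longrightarrow> hausdorff_ispace M (X i)"
  obtains I S where "\<forall>i<m. interpretable_base M (X i) (I i) (S i)"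
proof -
  have "\<forall>i\<in>{..<m}. \<exists>I S. interpretable_base M (X i) I S"
    using assms by (auto simp: hausdorff_ispace_def interpretable_space_iff_base)
  then obtain I where "\<forall>i\<in>{..<m}. \<exists>S. interpretable_base M (X i) (I i) S"
    using bchoice[of "{..<m}" "\<lambda>i I. \<exists>S. interpretable_base M (X i) I S"] by auto
  then obtain S where "\<forall>i\<in>{..<m}. interpretable_base M (X i) (I i) (S i)"
    using bchoice[of "{..<m}" "\<lambda>i S. interpretable_base M (X i) (I i) S"] by auto
  then show ?thesis using that[of I S] by simp
qed

text \<open>The point is interpretability of the topology, which \<open>is_product\<close> does not
  grant: open boxes with basic sides form a basis.\<close>

lemma hausdorff_ispace_product:
  assumes Z: "is_product M m X Z" and X: "\<And>i. i < m \<Longrightarrow> hausdorff_ispace M (X i)"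
  shows "hausdorff_ispace M Z"
proof -
  let ?P = "product_itop m X"
  obtain pr where pr: "iset_product M m X Z pr"
    and hom: "homeomorphic_map (itop Z) ?P (\<lambda>z. \<lambda>i\<in>{..<m}. pr i z)"
    by (rule is_productE[OF Z hausdorff_ispaceD(1)[OF X]])
  have top: "topologized_iset M Z" "interpretable_set M Z" "topspace (itop Z) = points Z"
    using Z by (auto simp: is_product_def topologized_iset_def)
  obtain I S where IS: "\<forall>i<m. interpretable_base M (X i) (I i) (S i)"
    by (rule interpretable_bases[OF X])
  have I: "\<And>i. i < m \<Longrightarrow> interpretable_set M (I i)"
    and S: "\<And>i. i < m \<Longrightarrow> interpretable_rel M (I i) (X i) {(a, u). a \<in> points (I i) \<and> u \<in> S i a}"
    and op: "\<And>i a. i < m \<Longrightarrow> a \<in> points (I i) \<Longrightarrow> openin (itop (X i)) (S i a)"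
    and base: "\<And>i U x. i < m \<Longrightarrow> openin (itop (X i)) U \<Longrightarrow> x \<in> U \<Longrightarrow>
      \<exists>a\<in>points (I i). x \<in> S i a \<and> S i a \<subseteq> U"
    using IS unfolding interpretable_base_def by simp_all
  \<comment> \<open>A box is given by one index per factor, so boxes are indexed by the product of
    the index sets.\<close>
  have "\<exists>(J :: 'a iset) qr. iset_product M m I J qr"
    by (rule iset_product_exists) (simp_all add: I interpretable_set_carrier_nonempty[OF top(2)])
  then obtain J :: "'a iset" and qr where J: "iset_product M m I J qr"
    by (elim exE)
  have J': "interpretable_set M J" "\<And>i. i < m \<Longrightarrow> interpretable_rel M J (I i) (graph_on (points J) (qr i))"
    using J by (simp_all add: iset_product_def interpretable_map_on_graph_on)
  have pr': "\<And>i. i < m \<Longrightarrow> interpretable_rel M Z (X i) (graph_on (points Z) (pr i))"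
    using pr by (simp_all add: iset_product_def interpretable_map_on_graph_on)
  have X': "\<And>i. i < m \<Longrightarrow> interpretable_set M (X i)"
    using hausdorff_ispaceD(2)[OF X] .
  define B where "B = (\<lambda>c. {z \<in> topspace (itop Z). \<forall>i<m. pr i z \<in> S i (qr i c)})"
  have "interpretable_base M Z J B"
    unfolding interpretable_base_def
  proof (intro conjI J'(1) ballI allI impI)
    \<comment> \<open>From an index \<open>c\<close> to its i-th component, to a point of that basic
      set, and back along the i-th projection.\<close>
    let ?R = "\<lambda>i. (graph_on (points J) (qr i) O {(a, u). a \<in> points (I i) \<and> u \<in> S i a}) O
      (graph_on (points Z) (pr i))\<inverse>"
    have "interpretable_rel M J Z {(c, z). c \<in> points J \<and> z \<in> points Z \<and> (\<forall>i<m. (c, z) \<in> ?R i)}"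
    proof (rule interpretable_rel_Inter[OF J'(1) top(2)])
      fix i assume i: "i < m"
      show "interpretable_rel M J Z (?R i)"
        by (rule interpretable_rel_comp[OF J'(1) X'[OF i] top(2)
            interpretable_rel_comp[OF J'(1) I[OF i] X'[OF i] J'(2)[OF i] S[OF i]]
            interpretable_rel_converse[OF top(2) X'[OF i] pr'[OF i]]])
    qed
    moreover have "{(c, z). c \<in> points J \<and> z \<in> points Z \<and> (\<forall>i<m. (c, z) \<in> ?R i)} =
      {(c, z). c \<in> points J \<and> z \<in> B c}" (is "?L = _")
    proof (rule Set.set_eqI)
      fix v :: "(nat \<Rightarrow> 'a) set \<times> (nat \<Rightarrow> 'a) set"
      obtain c z where v: "v = (c, z)" by (cases v)
      have "(c, z) \<in> ?R i \<longleftrightarrow> pr i z \<in> S i (qr i c)"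
        if "c \<in> points J" "z \<in> points Z" "i < m" for i
        using iset_product_in_points[OF J that(3,1)] that by (simp add: relcomp_unfold)
      then show "v \<in> ?L \<longleftrightarrow> v \<in> {(c, z). c \<in> points J \<and> z \<in> B c}"
        unfolding v mem_Collect_eq prod.case B_def top(3) by blast
    qed
    ultimately show "interpretable_rel M J Z {(c, z). c \<in> points J \<and> z \<in> B c}" by simp
  next
    fix c assume "c \<in> points J"
    then show "openin (itop Z) (B c)"
      unfolding B_def
      by (intro openin_finite_preimages[of m _ "\<lambda>i. itop (X i)"] continuous_map_product_homeo[OF hom]
        op iset_product_in_points[OF J])
  next
    fix U z assume U: "openin (itop Z) U" "z \<in> U"
    then have z: "z \<in> points Z" and Usub: "U \<subseteq> points Z"
      using openin_subset top(3) by auto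
    \<comment> \<open>The image of \<open>U\<close> contains an open box around the image of
      \<open>z\<close>. Each side is shrunk to a basic set, and the chosen indices are joined to one
      point of \<open>J\<close>.\<close>
    have "openin ?P ((\<lambda>z. \<lambda>i\<in>{..<m}. pr i z) ` U)"
      using homeomorphic_imp_open_map[OF hom] U(1) by (simp add: open_map_def)
    from this[unfolded openin_product_topology_alt, THEN bspec, OF imageI[OF U(2)]]
    obtain V where V: "\<forall>i\<in>{..<m}. openin (itop (X i)) (V i)" "(\<lambda>i\<in>{..<m}. pr i z) \<in> Pi\<^sub>E {..<m} V"
      "Pi\<^sub>E {..<m} V \<subseteq> (\<lambda>z. \<lambda>i\<in>{..<m}. pr i z) ` U"
      by (elim exE conjE)
    have "\<forall>i. \<exists>a. i < m \<longrightarrow> a \<in> points (I i) \<and> pr i z \<in> S i a \<and> S i a \<subseteq> V i"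
    proof
      fix i
      show "\<exists>a. i < m \<longrightarrow> a \<in> points (I i) \<and> pr i z \<in> S i a \<and> S i a \<subseteq> V i"
        using base[of i "V i" "pr i z"] V(1,2) by (cases "i < m") (auto simp: PiE_iff)
    qed
    then obtain a where a': "\<forall>i. i < m \<longrightarrow> a i \<in> points (I i) \<and> pr i z \<in> S i (a i) \<and> S i (a i) \<subseteq> V i"
      unfolding choice_iff by (elim exE)
    then have a: "\<And>i. i < m \<Longrightarrow> a i \<in> points (I i)" "\<And>i. i < m \<Longrightarrow> pr i z \<in> S i (a i)"
      "\<And>i. i < m \<Longrightarrow> S i (a i) \<subseteq> V i"
      by simp_all
    obtain c where c: "c \<in> points J" "\<And>i. i < m \<Longrightarrow> qr i c = a i"
      by (rule iset_product_surj[OF J, of a]) (simp_all add: a(1))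
    have "z \<in> B c" using z a(2) c(2) by (simp add: B_def top(3))
    moreover have "B c \<subseteq> U"
    proof
      fix w assume w: "w \<in> B c"
      have "pr i w \<in> V i" if "i < m" for i
      proof -
        have "pr i w \<in> S i (qr i c)" using w that by (simp add: B_def)
        then show ?thesis using c(2)[OF that] a(3)[OF that] by auto
      qed
      then have "(\<lambda>i\<in>{..<m}. pr i w) \<in> Pi\<^sub>E {..<m} V" by auto
      then obtain w' where w': "w' \<in> U" "(\<lambda>i\<in>{..<m}. pr i w) = (\<lambda>i\<in>{..<m}. pr i w')"
        using V(3) by blast
      have "pr i w = pr i w'" if "i < m" for i
        using fun_cong[OF w'(2), of i] that by simp
      then have "w = w'"
        using iset_product_eqI[OF pr, of w w'] w w'(1) Usub by (auto simp: B_def top(3))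
      then show "w \<in> U" using w' by simp
    qed
    ultimately show "\<exists>c\<in>points J. z \<in> B c \<and> B c \<subseteq> U" using c(1) by blast
  qed
  then have "interpretable_space M Z"
    using top(1) interpretable_space_iff_base by auto
  moreover have "Hausdorff_space (itop Z)"
    using homeomorphic_Hausdorff_space[OF homeomorphic_map_imp_homeomorphic_space[OF hom]]
      hausdorff_ispaceD(4)[OF X] by (simp add: Hausdorff_space_product_topology)
  ultimately show ?thesis by (simp add: hausdorff_ispace_def)
qed

lemma homeomorphic_mapE:
  assumes "homeomorphic_map X Y f"
  obtains g where "continuous_map X Y f" "continuous_map Y X g" "homeomorphic_map Y X g"
    "\<And>x. x \<in> topspace X \<Longrightarrow> g (f x) = x" "\<And>y. y \<in> topspace Y \<Longrightarrow> f (g y) = y"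
proof -
  obtain g where g: "homeomorphic_maps X Y f g"
    using assms unfolding homeomorphic_map_maps by (elim exE)
  then have "homeomorphic_map Y X g" by (simp add: homeomorphic_maps_map)
  then show ?thesis using g that[of g] by (simp add: homeomorphic_maps_def)
qed

text \<open>The product of the maps is open because there are finitely many factors. Both ends are
  then replaced by the given spaces through their homeomorphisms with the topological
  products.\<close>

lemma open_surjection_product:
  assumes Y': "is_product M m Y Y'" and Z: "is_product M m X Z"
    and X: "\<And>i. i < m \<Longrightarrow> topologized_iset M (X i)" and Y: "\<And>i. i < m \<Longrightarrow> topologized_iset M (Y i)"
    and f: "\<And>i. i < m \<Longrightarrow> interp_open_surjection M (Y i) (X i) (f i)"
  shows "\<exists>f. interp_open_surjection M Y' Z f"
proof -
  let ?P = "product_itop m X" and ?Q = "product_itop m Y"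
  obtain pr where pr: "iset_product M m X Z pr"
    and hom: "homeomorphic_map (itop Z) ?P (\<lambda>z. \<lambda>i\<in>{..<m}. pr i z)"
    by (rule is_productE[OF Z X])
  obtain qr where qr: "iset_product M m Y Y' qr"
    and homY: "homeomorphic_map (itop Y') ?Q (\<lambda>z. \<lambda>i\<in>{..<m}. qr i z)"
    by (rule is_productE[OF Y' Y])
  have top: "interpretable_set M Z" "topspace (itop Z) = points Z"
    "interpretable_set M Y'" "topspace (itop Y') = points Y'"
    using Z Y' by (auto simp: is_product_def topologized_iset_def)
  have XY: "\<And>i. i < m \<Longrightarrow> interpretable_set M (X i)" "\<And>i. i < m \<Longrightarrow> interpretable_set M (Y i)"
    "\<And>i. i < m \<Longrightarrow> topspace (itop (X i)) = points (X i)" "\<And>i. i < m \<Longrightarrow> topspace (itop (Y i)) = points (Y i)"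
    using X Y by (auto simp: topologized_iset_def)
  obtain g where g: "homeomorphic_map ?P (itop Z) g"
    "\<And>y. y \<in> topspace ?P \<Longrightarrow> (\<lambda>i\<in>{..<m}. pr i (g y)) = y"
    using hom by (rule homeomorphic_mapE) simp
  let ?q = "\<lambda>z. \<lambda>i\<in>{..<m}. qr i z" and ?F = "\<lambda>y. \<lambda>i\<in>{..<m}. f i (y i)"
  define h where "h = g \<circ> (?F \<circ> ?q)"
  have F: "continuous_map ?Q ?P ?F" "open_map ?Q ?P ?F"
    using f by (auto intro!: continuous_map_product open_map_product simp: interp_open_surjection_def)
  have imF: "?F ` topspace ?Q = topspace ?P"
    unfolding topspace_product_topology image_product
    by (intro PiE_cong) (use f XY in \<open>auto simp: interp_open_surjection_def\<close>)
  have cont: "continuous_map (itop Y') (itop Z) h"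
    unfolding h_def using homY g(1) F(1)
    by (intro continuous_map_compose) (auto dest: homeomorphic_imp_continuous_map)
  have op: "open_map (itop Y') (itop Z) h"
    unfolding h_def using homY g(1) F(2)
    by (intro open_map_compose) (auto dest: homeomorphic_imp_open_map)
  have surj: "h ` points Y' = points Z"
  proof -
    have "?q ` points Y' = topspace ?Q"
      using homeomorphic_imp_surjective_map[OF homY] top(4) by simp
    moreover have "g ` topspace ?P = points Z"
      using homeomorphic_imp_surjective_map[OF g(1)] top(2) by simp
    ultimately show ?thesis
      unfolding h_def image_comp[symmetric] imF by (simp only: imF)
  qed
  have prh: "pr i (h y) = f i (qr i y)" if "y \<in> points Y'" "i < m" for y i
  proof -
    have "?F (?q y) \<in> topspace ?P"
      using imF homeomorphic_imp_surjective_map[OF homY] that(1) top(4) by blast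
    from fun_cong[OF g(2)[OF this], of i] show ?thesis
      using that(2) by (simp add: h_def)
  qed
  have "interpretable_map_on M Y' (points Y') Z h"
  proof (rule interpretable_map_into_product[OF pr XY(1) top(3), 
        where R = "\<lambda>i. graph_on (points Y') (qr i) O graph_on (points (Y i)) (f i)"])
    fix i assume i: "i < m"
    show "interpretable_rel M Y' (X i) (graph_on (points Y') (qr i) O graph_on (points (Y i)) (f i))"
      using qr f[OF i] i
      by (intro interpretable_rel_comp[OF top(3) XY(2)[OF i] XY(1)[OF i]])
        (auto simp: iset_product_def interp_open_surjection_def interpretable_map_on_graph_on)
  next
    fix y z assume y: "y \<in> points Y'" and z: "z \<in> points Z"
    have "h y \<in> points Z" using surj y by blast
    then have "z = h y \<longleftrightarrow> (\<forall>i<m. pr i z = f i (qr i y))"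
      using iset_product_eqI[OF pr z, of "h y"] prh[OF y] by auto
    then show "(y \<in> points Y' \<and> z = h y) \<longleftrightarrow>
        (\<forall>i<m. (y, pr i z) \<in> graph_on (points Y') (qr i) O graph_on (points (Y i)) (f i))"
      using y iset_product_in_points[OF qr _ y] by (auto simp: relcomp_unfold)
  qed (use surj in auto)
  then show ?thesis
    unfolding interp_open_surjection_def using surj cont op by blast
qed

text \<open>Restricting a product to a box is the same as taking the product of the restrictions, so
  the charts act factor by factor. The sets \<open>N i\<close> may be arbitrary, not only
  open.\<close>

lemma chart_product:
  assumes pr: "iset_product M m X Z pr"
    and hom: "homeomorphic_map (itop Z) (product_itop m X) (\<lambda>z. \<lambda>i\<in>{..<m}. pr i z)"
    and topZ: "topspace (itop Z) = points Z"
    and T: "is_product M m Y T"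
    and X: "\<And>i. i < m \<Longrightarrow> topologized_iset M (X i)" and Y: "\<And>i. i < m \<Longrightarrow> topologized_iset M (Y i)"
    and f: "\<And>i. i < m \<Longrightarrow> interpretable_map_on M (X i) (N i) (Y i) (f i)"
      "\<And>i. i < m \<Longrightarrow> homeomorphic_map (subtopology (itop (X i)) (N i)) (itop (Y i)) (f i)"
  defines "N' \<equiv> {z \<in> points Z. \<forall>i<m. pr i z \<in> N i}"
  shows "\<exists>f. interpretable_map_on M Z N' T f \<and> homeomorphic_map (subtopology (itop Z) N') (itop T) f"
proof -
  let ?P = "product_itop m X" and ?Q = "product_itop m Y"
  let ?p = "\<lambda>z. \<lambda>i\<in>{..<m}. pr i z" and ?F = "\<lambda>y. \<lambda>i\<in>{..<m}. f i (y i)"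
  obtain qr where qr: "iset_product M m Y T qr"
    and homT: "homeomorphic_map (itop T) ?Q (\<lambda>z. \<lambda>i\<in>{..<m}. qr i z)"
    by (rule is_productE[OF T Y])
  have top: "interpretable_set M Z" "interpretable_set M T" "topspace (itop T) = points T"
    using pr T by (auto simp: is_product_def topologized_iset_def iset_product_def)
  have XY: "\<And>i. i < m \<Longrightarrow> interpretable_set M (X i)" "\<And>i. i < m \<Longrightarrow> interpretable_set M (Y i)"
    "\<And>i. i < m \<Longrightarrow> topspace (itop (X i)) = points (X i)" "\<And>i. i < m \<Longrightarrow> topspace (itop (Y i)) = points (Y i)"
    using X Y by (auto simp: topologized_iset_def)
  obtain g where g: "homeomorphic_map ?Q (itop T) g"
    "\<And>y. y \<in> topspace ?Q \<Longrightarrow> (\<lambda>i\<in>{..<m}. qr i (g y)) = y"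
    using homT by (rule homeomorphic_mapE) simp
  have p: "homeomorphic_map (subtopology (itop Z) N') (subtopology ?P (Pi\<^sub>E {..<m} N)) ?p"
  proof (rule homeomorphic_map_subtopologies_alt[OF hom])
    fix z assume "z \<in> topspace (itop Z)"
    then show "?p z \<in> Pi\<^sub>E {..<m} N \<longleftrightarrow> z \<in> N'" by (auto simp: N'_def topZ PiE_iff)
  qed
  have "homeomorphic_map (product_topology (\<lambda>i. subtopology (itop (X i)) (N i)) {..<m}) ?Q ?F"
    by (rule homeomorphic_map_product) (use f in auto)
  then have F: "homeomorphic_map (subtopology ?P (Pi\<^sub>E {..<m} N)) ?Q ?F"
    by (simp only: subtopology_product_topology)
  define h where "h = g \<circ> (?F \<circ> ?p)"
  have h: "homeomorphic_map (subtopology (itop Z) N') (itop T) h"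
    unfolding h_def by (intro homeomorphic_map_compose[OF _ g(1)] homeomorphic_map_compose[OF p F])
  have topN: "topspace (subtopology (itop Z) N') = N'"
    by (auto simp: N'_def topZ)
  have surj: "h ` N' = points T"
    using homeomorphic_imp_surjective_map[OF h] top(3) topN by simp
  have qrh: "qr i (h z) = f i (pr i z)" if "z \<in> N'" "i < m" for z i
  proof -
    have "?F (?p z) \<in> topspace ?Q"
      using homeomorphic_imp_surjective_map[OF p] homeomorphic_imp_surjective_map[OF F] that(1) topN by blast
    from fun_cong[OF g(2)[OF this], of i] show ?thesis
      using that(2) by (simp add: h_def)
  qed
  have "interpretable_map_on M Z N' T h"
  proof (rule interpretable_map_into_product[OF qr XY(2) top(1),
        where R = "\<lambda>i. graph_on (points Z) (pr i) O graph_on (N i) (f i)"])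
    fix i assume i: "i < m"
    show "interpretable_rel M Z (Y i) (graph_on (points Z) (pr i) O graph_on (N i) (f i))"
      using pr f(1)[OF i] i
      by (intro interpretable_rel_comp[OF top(1) XY(1)[OF i] XY(2)[OF i]])
        (auto simp: iset_product_def interpretable_map_on_graph_on)
  next
    fix z t assume z: "z \<in> points Z" and t: "t \<in> points T"
    have "t = h z \<longleftrightarrow> (\<forall>i<m. qr i t = f i (pr i z))" if "z \<in> N'"
      using iset_product_eqI[OF qr t, of "h z"] qrh[OF that] surj that by auto
    then show "(z \<in> N' \<and> t = h z) \<longleftrightarrow>
        (\<forall>i<m. (z, qr i t) \<in> graph_on (points Z) (pr i) O graph_on (N i) (f i))"
      using z by (auto simp: relcomp_unfold N'_def)
  qed (use surj in \<open>auto simp: N'_def\<close>)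
  with h show ?thesis by blast
qed

section \<open>Closure under disjoint unions\<close>

lemma homeomorphic_map_sum_component:
  assumes hom: "homeomorphic_map (sum_topology X {..<m}) Z (\<lambda>(i, x). inc i x)" and i: "i < m"
  shows "continuous_map (X i) Z (inc i)" "open_map (X i) Z (inc i)" "inj_on (inc i) (topspace (X i))"
proof -
  have *: "inc i = (\<lambda>(i, x). inc i x) \<circ> Pair i" by (simp add: fun_eq_iff)
  have i': "i \<in> {..<m}" using i by simp
  show "continuous_map (X i) Z (inc i)"
    using continuous_map_compose[OF continuous_map_component_injection[OF i']
        homeomorphic_imp_continuous_map[OF hom]] unfolding *[symmetric] .
  show "open_map (X i) Z (inc i)"
    using open_map_compose[OF open_map_component_injection[OF i']
        homeomorphic_imp_open_map[OF hom]] unfolding *[symmetric] .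
  show "inj_on (inc i) (topspace (X i))"
  proof (rule inj_onI)
    fix x y assume "x \<in> topspace (X i)" "y \<in> topspace (X i)" "inc i x = inc i y"
    then show "x = y"
      using inj_onD[OF homeomorphic_imp_injective_map[OF hom], of "(i, x)" "(i, y)"] i by simp
  qed
qed

text \<open>The images of the basic sets of the summands form a basis. The elements zero and one
  enter through the tags that code the disjoint union of the index sets.\<close>

lemma hausdorff_ispace_sum:
  assumes Z: "is_disjoint_union M m X Z" and X: "\<And>i. i < m \<Longrightarrow> hausdorff_ispace M (X i)"
    and M: "\<zero>\<^bsub>M\<^esub> \<in> carrier M" "\<one>\<^bsub>M\<^esub> \<in> carrier M" "\<one>\<^bsub>M\<^esub> \<noteq> \<zero>\<^bsub>M\<^esub>"
  shows "hausdorff_ispace M Z"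
proof -
  let ?P = "sum_itop m X"
  obtain inc where inc: "iset_sum M m X Z inc"
    and hom: "homeomorphic_map ?P (itop Z) (\<lambda>(i, x). inc i x)"
    by (rule is_disjoint_unionE[OF Z hausdorff_ispaceD(1)[OF X]])
  note incmap = homeomorphic_map_sum_component[OF hom]
  have top: "topologized_iset M Z" "interpretable_set M Z" "topspace (itop Z) = points Z"
    using Z by (auto simp: is_disjoint_union_def topologized_iset_def)
  obtain I S where IS: "\<forall>i<m. interpretable_base M (X i) (I i) (S i)"
    by (rule interpretable_bases[OF X])
  have I: "\<And>i. i < m \<Longrightarrow> interpretable_set M (I i)"
    and S: "\<And>i. i < m \<Longrightarrow> interpretable_rel M (I i) (X i) {(a, u). a \<in> points (I i) \<and> u \<in> S i a}"
    and op: "\<And>i a. i < m \<Longrightarrow> a \<in> points (I i) \<Longrightarrow> openin (itop (X i)) (S i a)"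
    and base: "\<And>i U x. i < m \<Longrightarrow> openin (itop (X i)) U \<Longrightarrow> x \<in> U \<Longrightarrow>
      \<exists>a\<in>points (I i). x \<in> S i a \<and> S i a \<subseteq> U"
    using IS unfolding interpretable_base_def by simp_all
  have "\<exists>(J :: 'a iset) jnc. iset_sum M m I J jnc"
    by (rule iset_sum_exists[OF _ M]) (simp add: I)
  then obtain J :: "'a iset" and jnc where J: "iset_sum M m I J jnc"
    by (elim exE)
  have J': "interpretable_set M J" "\<And>i. i < m \<Longrightarrow> interpretable_rel M (I i) J (graph_on (points (I i)) (jnc i))"
    using J by (simp_all add: iset_sum_def interpretable_map_on_graph_on)
  have inc': "\<And>i. i < m \<Longrightarrow> interpretable_rel M (X i) Z (graph_on (points (X i)) (inc i))"
    using inc by (simp_all add: iset_sum_def interpretable_map_on_graph_on)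
  have X': "\<And>i. i < m \<Longrightarrow> interpretable_set M (X i)"
    using hausdorff_ispaceD(2)[OF X] .
  have Ssub: "S i a \<subseteq> points (X i)" if "i < m" "a \<in> points (I i)" for i a
    using openin_subset[OF op[OF that]] hausdorff_ispaceD(3)[OF X[OF that(1)]] by simp
  \<comment> \<open>From an index in \<open>J\<close> back to its summand, to a point of that basic
    set, and forward into \<open>Z\<close>. Defining \<open>B\<close> through this relation makes
    the family interpretable at once.\<close>
  define R where "R = (\<lambda>i. ((graph_on (points (I i)) (jnc i))\<inverse> O {(a, u). a \<in> points (I i) \<and> u \<in> S i a}) O
      graph_on (points (X i)) (inc i))"
  have R_iff: "(c, z) \<in> R i \<longleftrightarrow> (\<exists>a\<in>points (I i). c = jnc i a \<and> z \<in> inc i ` S i a)" if "i < m" for i c z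
    using Ssub[OF that] by (auto simp: R_def relcomp_unfold)
  define B where "B = (\<lambda>c. {z. \<exists>i<m. (c, z) \<in> R i})"
  \<comment> \<open>Since the inclusions of the index sets are jointly injective, exactly one
    summand contributes to each index.\<close>
  have B: "B (jnc i a) = inc i ` S i a" if i: "i < m" and a: "a \<in> points (I i)" for i a
  proof
    have "(jnc i a, z) \<in> R i" if "z \<in> inc i ` S i a" for z
      using that a unfolding R_iff[OF i] by blast
    then show "inc i ` S i a \<subseteq> B (jnc i a)" using i unfolding B_def by blast
    show "B (jnc i a) \<subseteq> inc i ` S i a"
    proof
      fix z assume "z \<in> B (jnc i a)"
      then obtain j where j: "j < m" "(jnc i a, z) \<in> R j" by (auto simp: B_def)
      then obtain b where b: "b \<in> points (I j)" "jnc i a = jnc j b" "z \<in> inc j ` S j b"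
        using R_iff[OF j(1)] by auto
      then have "i = j \<and> a = b"
        using iset_sum_inj[OF J i j(1) a b(1)] by simp
      then show "z \<in> inc i ` S i a" using b by simp
    qed
  qed
  have "interpretable_base M Z J B"
    unfolding interpretable_base_def
  proof (intro conjI J'(1) ballI allI impI)
    have "interpretable_rel M J Z {(c, z). \<exists>i<m. (c, z) \<in> R i}"
    proof (rule interpretable_rel_Union[OF J'(1) top(2)])
      fix i assume i: "i < m"
      show "interpretable_rel M J Z (R i)"
        unfolding R_def
        by (rule interpretable_rel_comp[OF J'(1) X'[OF i] top(2)
            interpretable_rel_comp[OF J'(1) I[OF i] X'[OF i]
              interpretable_rel_converse[OF I[OF i] J'(1) J'(2)[OF i]] S[OF i]] inc'[OF i]])
    qed
    moreover have "{(c, z). \<exists>i<m. (c, z) \<in> R i} = {(c, z). c \<in> points J \<and> z \<in> B c}"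
    proof -
      have "c \<in> points J" if "i < m" "(c, z) \<in> R i" for i c z
        using that R_iff[OF that(1)] iset_sum_in_points[OF J that(1)] by auto
      then show ?thesis by (auto simp: B_def)
    qed
    ultimately show "interpretable_rel M J Z {(c, z). c \<in> points J \<and> z \<in> B c}" by simp
  next
    fix c assume "c \<in> points J"
    then obtain i a where c: "i < m" "a \<in> points (I i)" "c = jnc i a"
      by (rule iset_sum_cases[OF J])
    then show "openin (itop Z) (B c)"
      using incmap(2)[OF c(1)] op[OF c(1,2)] by (simp add: B open_map_def)
  next
    fix U z assume U: "openin (itop Z) U" "z \<in> U"
    then have "z \<in> points Z" using openin_subset top(3) by auto
    then obtain i x where x: "i < m" "x \<in> points (X i)" "z = inc i x"
      by (rule iset_sum_cases[OF inc])
    have "openin (itop (X i)) {x \<in> topspace (itop (X i)). inc i x \<in> U}"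
      using incmap(1)[OF x(1)] U(1) by (rule openin_continuous_map_preimage)
    moreover have "x \<in> {x \<in> topspace (itop (X i)). inc i x \<in> U}"
      using x U(2) hausdorff_ispaceD(3)[OF X[OF x(1)]] by simp
    ultimately obtain a where a: "a \<in> points (I i)" "x \<in> S i a"
      "S i a \<subseteq> {x \<in> topspace (itop (X i)). inc i x \<in> U}"
      using base[OF x(1)] by meson
    show "\<exists>c\<in>points J. z \<in> B c \<and> B c \<subseteq> U"
    proof (intro bexI conjI)
      show "jnc i a \<in> points J" by (rule iset_sum_in_points[OF J x(1) a(1)])
      show "z \<in> B (jnc i a)" "B (jnc i a) \<subseteq> U"
        using B[OF x(1) a(1)] x(3) a(2,3) by auto
    qed
  qed
  then have "interpretable_space M Z"
    using top(1) interpretable_space_iff_base by auto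
  moreover have "Hausdorff_space ?P"
    by (rule Hausdorff_space_sum_topology) (simp add: hausdorff_ispaceD(4)[OF X])
  then have "Hausdorff_space (itop Z)"
    using homeomorphic_Hausdorff_space[OF homeomorphic_map_imp_homeomorphic_space[OF hom]] by simp
  ultimately show ?thesis by (simp add: hausdorff_ispace_def)
qed

text \<open>The disjoint sum of the maps is transported to the given spaces. Its graph is a finite
  union of graphs, one for each summand.\<close>

lemma open_surjection_sum:
  assumes Y': "is_disjoint_union M m Y Y'" and Z: "is_disjoint_union M m X Z"
    and X: "\<And>i. i < m \<Longrightarrow> topologized_iset M (X i)" and Y: "\<And>i. i < m \<Longrightarrow> topologized_iset M (Y i)"
    and f: "\<And>i. i < m \<Longrightarrow> interp_open_surjection M (Y i) (X i) (f i)"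
  shows "\<exists>f. interp_open_surjection M Y' Z f"
proof -
  let ?P = "sum_itop m X" and ?Q = "sum_itop m Y"
  obtain inc where inc: "iset_sum M m X Z inc"
    and hom: "homeomorphic_map ?P (itop Z) (\<lambda>(i, x). inc i x)"
    by (rule is_disjoint_unionE[OF Z X])
  obtain jnc where jnc: "iset_sum M m Y Y' jnc"
    and homY: "homeomorphic_map ?Q (itop Y') (\<lambda>(i, x). jnc i x)"
    by (rule is_disjoint_unionE[OF Y' Y])
  have top: "interpretable_set M Z" "topspace (itop Z) = points Z"
    "interpretable_set M Y'" "topspace (itop Y') = points Y'"
    using Z Y' by (auto simp: is_disjoint_union_def topologized_iset_def)
  have XY: "\<And>i. i < m \<Longrightarrow> interpretable_set M (X i)" "\<And>i. i < m \<Longrightarrow> interpretable_set M (Y i)"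
    "\<And>i. i < m \<Longrightarrow> topspace (itop (X i)) = points (X i)" "\<And>i. i < m \<Longrightarrow> topspace (itop (Y i)) = points (Y i)"
    using X Y by (auto simp: topologized_iset_def)
  obtain g where g: "homeomorphic_map (itop Y') ?Q g"
    "\<And>u. u \<in> topspace ?Q \<Longrightarrow> g ((\<lambda>(i, x). jnc i x) u) = u"
    using homY by (rule homeomorphic_mapE) simp
  have gj: "g (jnc i y) = (i, y)" if "i < m" "y \<in> points (Y i)" for i y
    using g(2)[of "(i, y)"] that XY(4) by simp
  let ?F = "\<lambda>(i, y). (i, f i y)"
  define h where "h = (\<lambda>(i, x). inc i x) \<circ> (?F \<circ> g)"
  have hj: "h (jnc i y) = inc i (f i y)" if "i < m" "y \<in> points (Y i)" for i y
    using gj[OF that] by (simp add: h_def)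
  have fi: "interpretable_map_on M (Y i) (points (Y i)) (X i) (f i)" "f i ` points (Y i) = points (X i)"
    "continuous_map (itop (Y i)) (itop (X i)) (f i)" "open_map (itop (Y i)) (itop (X i)) (f i)"
    if "i < m" for i
    using f[OF that] by (simp_all add: interp_open_surjection_def)
  have F: "continuous_map ?Q ?P ?F" "open_map ?Q ?P ?F"
    by (intro continuous_map_sum open_map_sum; simp add: fi)+
  have cont: "continuous_map (itop Y') (itop Z) h"
    unfolding h_def using hom g(1) F(1)
    by (intro continuous_map_compose) (auto dest: homeomorphic_imp_continuous_map)
  have op: "open_map (itop Y') (itop Z) h"
    unfolding h_def using hom g(1) F(2)
    by (intro open_map_compose) (auto dest: homeomorphic_imp_open_map)
  have surj: "h ` points Y' = points Z"
  proof
    show "h ` points Y' \<subseteq> points Z"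
      using continuous_map_image_subset_topspace[OF cont] top by simp
    show "points Z \<subseteq> h ` points Y'"
    proof
      fix z assume "z \<in> points Z"
      then obtain i x where x: "i < m" "x \<in> points (X i)" "z = inc i x"
        by (rule iset_sum_cases[OF inc])
      then obtain y where "y \<in> points (Y i)" "x = f i y"
        using fi(2)[OF x(1)] by blast
      then show "z \<in> h ` points Y'"
        using hj[OF x(1)] x(3) iset_sum_in_points[OF jnc x(1)] by (metis imageI)
    qed
  qed
  \<comment> \<open>A map out of a sum has to leave \<open>Y'\<close> backwards along an inclusion;
    hence the converse.\<close>
  let ?R = "\<lambda>i. ((graph_on (points (Y i)) (jnc i))\<inverse> O graph_on (points (Y i)) (f i)) O
      graph_on (points (X i)) (inc i)"
  have R_iff: "(u, z) \<in> ?R i \<longleftrightarrow> (\<exists>y\<in>points (Y i). u = jnc i y \<and> z = inc i (f i y))" if "i < m" for i u z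
    using fi(2)[OF that] by (auto simp: relcomp_unfold)
  have "interpretable_rel M Y' Z {(u, z). \<exists>i<m. (u, z) \<in> ?R i}"
  proof (rule interpretable_rel_Union[OF top(3,1)])
    fix i assume i: "i < m"
    have "interpretable_rel M (Y i) Y' (graph_on (points (Y i)) (jnc i))"
      "interpretable_rel M (X i) Z (graph_on (points (X i)) (inc i))"
      using jnc inc i by (simp_all add: iset_sum_def interpretable_map_on_graph_on)
    then show "interpretable_rel M Y' Z (?R i)"
      by (intro interpretable_rel_comp[OF top(3) XY(1)[OF i] top(1)]
          interpretable_rel_comp[OF top(3) XY(2)[OF i] XY(1)[OF i]]
          interpretable_rel_converse[OF XY(2)[OF i] top(3)]
          fi(1)[OF i, unfolded interpretable_map_on_graph_on])
  qed
  moreover have "(\<exists>i<m. (u, z) \<in> ?R i) \<longleftrightarrow> (u, z) \<in> graph_on (points Y') h" for u z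
  proof
    assume "\<exists>i<m. (u, z) \<in> ?R i"
    then obtain i y where "i < m" "y \<in> points (Y i)" "u = jnc i y" "z = inc i (f i y)"
      using R_iff by blast
    then show "(u, z) \<in> graph_on (points Y') h"
      using hj iset_sum_in_points[OF jnc] by simp
  next
    assume "(u, z) \<in> graph_on (points Y') h"
    then have u: "u \<in> points Y'" "z = h u" by simp_all
    obtain i y where "i < m" "y \<in> points (Y i)" "u = jnc i y"
      using u(1) by (rule iset_sum_cases[OF jnc])
    then show "\<exists>i<m. (u, z) \<in> ?R i"
      using u(2) hj R_iff by (intro exI[of _ i]) auto
  qed
  then have "{(u, z). \<exists>i<m. (u, z) \<in> ?R i} = graph_on (points Y') h"
    by (intro Set.set_eqI) (simp only: mem_Collect_eq split_paired_all prod.case)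
  ultimately have "interpretable_map_on M Y' (points Y') Z h"
    by (simp only: interpretable_map_on_graph_on)
  then show ?thesis
    unfolding interp_open_surjection_def using surj cont op by (intro exI[of _ h]) simp
qed

text \<open>An inclusion is an open embedding, so a chart of one summand is moved into
  \<open>Z\<close> by precomposing with the inverse of the inclusion.\<close>

lemma chart_sum:
  assumes inc: "iset_sum M m X Z inc"
    and hom: "homeomorphic_map (sum_itop m X) (itop Z) (\<lambda>(i, x). inc i x)"
    and i: "i < m" and X: "topologized_iset M (X i)" and T: "interpretable_set M T"
    and f: "interpretable_map_on M (X i) N T f" "homeomorphic_map (subtopology (itop (X i)) N) (itop T) f"
  shows "\<exists>f. interpretable_map_on M Z (inc i ` N) T f \<and>
    homeomorphic_map (subtopology (itop Z) (inc i ` N)) (itop T) f"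
proof -
  note incmap = homeomorphic_map_sum_component[OF hom i]
  have N: "N \<subseteq> topspace (itop (X i))"
    using interpretable_map_on_subset[OF f(1)] X by (simp add: topologized_iset_def)
  have Xi: "interpretable_set M (X i)" and Z: "interpretable_set M Z"
    using X inc by (simp_all add: topologized_iset_def iset_sum_def)
  have incN: "homeomorphic_map (subtopology (itop (X i)) N) (subtopology (itop Z) (inc i ` N)) (inc i)"
  proof (rule bijective_open_imp_homeomorphic_map)
    show "continuous_map (subtopology (itop (X i)) N) (subtopology (itop Z) (inc i ` N)) (inc i)"
      using incmap(1) by (auto simp: continuous_map_in_subtopology continuous_map_from_subtopology)
    show "open_map (subtopology (itop (X i)) N) (subtopology (itop Z) (inc i ` N)) (inc i)"
      unfolding open_map_def openin_subtopology
    proof clarify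
      fix U assume U: "openin (itop (X i)) U"
      then have "inc i ` (U \<inter> N) = inc i ` U \<inter> inc i ` N"
        by (intro inj_on_image_Int[OF incmap(3) openin_subset[OF U] N])
      then show "\<exists>V. openin (itop Z) V \<and> inc i ` (U \<inter> N) = V \<inter> inc i ` N"
        using incmap(2) U by (intro exI[of _ "inc i ` U"]) (simp add: open_map_def)
    qed
    show "inc i ` topspace (subtopology (itop (X i)) N) = topspace (subtopology (itop Z) (inc i ` N))"
      using N continuous_map_image_subset_topspace[OF incmap(1)] by auto
    show "inj_on (inc i) (topspace (subtopology (itop (X i)) N))"
      using incmap(3) by (rule inj_on_subset) auto
  qed
  obtain k where k: "homeomorphic_map (subtopology (itop Z) (inc i ` N)) (subtopology (itop (X i)) N) k"
    "\<And>x. x \<in> topspace (subtopology (itop (X i)) N) \<Longrightarrow> k (inc i x) = x"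
    using incN by (rule homeomorphic_mapE) simp
  have kx: "k (inc i x) = x" if "x \<in> N" for x
    using k(2)[of x] that N by auto
  have "graph_on (inc i ` N) (f \<circ> k) = (graph_on (points (X i)) (inc i))\<inverse> O graph_on N f"
    using kx interpretable_map_on_subset[OF f(1)] by (auto simp: relcomp_unfold graph_on_def)
  moreover have "interpretable_rel M Z T ((graph_on (points (X i)) (inc i))\<inverse> O graph_on N f)"
    using f(1) inc i by (intro interpretable_rel_comp[OF Z Xi T] interpretable_rel_converse[OF Xi Z])
      (simp_all add: iset_sum_def interpretable_map_on_graph_on)
  ultimately have "interpretable_map_on M Z (inc i ` N) T (f \<circ> k)"
    by (simp add: interpretable_map_on_graph_on)
  then show ?thesis
    using homeomorphic_map_compose[OF k(1) f(2)] by (intro exI[of _ "f \<circ> k"]) simp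
qed

section \<open>A nontrivial open set in the valuation topology\<close>

lemma free_vars_rename_tm: "tm_vars (rename_tm t r) = r ` tm_vars t"
  by (induction t) auto

lemma free_vars_rename_fm: "free_vars (rename_fm \<phi> r) \<subseteq> r ` free_vars \<phi>"
proof (induction \<phi> arbitrary: r)
  case (Ex \<phi>)
  show ?case
  proof
    fix i assume "i \<in> free_vars (rename_fm (rfm.Ex \<phi>) r)"
    then have "Suc i \<in> case_nat 0 (\<lambda>i. Suc (r i)) ` free_vars \<phi>"
      using Ex[of "case_nat 0 (\<lambda>i. Suc (r i))"] by auto
    then obtain j where j: "j \<in> free_vars \<phi>" "Suc i = case_nat 0 (\<lambda>i. Suc (r i)) j" by auto
    then obtain k where "j = Suc k" "i = r k" by (cases j) auto
    with j(1) show "i \<in> r ` free_vars (rfm.Ex \<phi>)" by auto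
  qed
qed (fastforce simp: free_vars_rename_tm)+

section \<open>The p-adic absolute value on the rationals\<close>

text \<open>The valuation ring is the localization of the integers at p. Allowing fractions that are
  not reduced turns closure under addition into arithmetic with denominators.\<close>

lemma padic_abs_le_1_iff:
  assumes "prime p"
  shows "padic_abs p x \<le> 1 \<longleftrightarrow> (\<exists>u v. \<not> int p dvd v \<and> x = of_int u / of_int v)"
proof -
  have p: "prime (int p)" "real p > 1" using assms prime_gt_1_nat by auto
  obtain a b where ab: "quotient_of x = (a, b)" by (cases "quotient_of x")
  then have b: "b > 0" "coprime a b" "x = of_int a / of_int b"
    using quotient_of_denom_pos quotient_of_coprime quotient_of_div by blast+
  have le: "padic_abs p x \<le> 1 \<longleftrightarrow> \<not> int p dvd b"
  proof (cases "x = 0")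
    case True
    then have "b = 1" using ab by simp
    then show ?thesis using True p by (auto simp: padic_abs_def)
  next
    case False
    then have "a \<noteq> 0" using b by auto
    have "padic_abs p x = real p powi (int (multiplicity (int p) b) - int (multiplicity (int p) a))"
      using False ab by (simp add: padic_abs_def)
    also have "\<dots> \<le> 1 \<longleftrightarrow> int (multiplicity (int p) b) - int (multiplicity (int p) a) \<le> 0"
      using power_int_increasing[of _ 0 "real p"] power_int_strict_increasing[of 0 _ "real p"] p(2)
      by (metis linorder_not_le order_less_imp_le power_int_0_right)
    also have "\<dots> \<longleftrightarrow> \<not> int p dvd b"
    proof (cases "int p dvd b")
      case True
      then have "\<not> int p dvd a"
        using b(2) p(1) by (meson coprime_common_divisor not_prime_unit)
      then have "multiplicity (int p) a = 0" by (rule not_dvd_imp_multiplicity_0)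
      moreover have "multiplicity (int p) b > 0"
        using True b(1) p(1) by (simp add: prime_multiplicity_gt_zero_iff)
      ultimately show ?thesis using True by simp
    qed (simp add: not_dvd_imp_multiplicity_0)
    finally show ?thesis .
  qed
  show ?thesis
  proof
    assume "padic_abs p x \<le> 1"
    then show "\<exists>u v. \<not> int p dvd v \<and> x = of_int u / of_int v"
      using le b(3) by blast
  next
    assume "\<exists>u v. \<not> int p dvd v \<and> x = of_int u / of_int v"
    then obtain u v where v: "\<not> int p dvd v" "x = of_int u / of_int v" by blast
    then have "v \<noteq> 0" by auto
    then have "of_int (a * v) = (of_int (u * b) :: rat)"
      using v(2) b(1,3) by (simp add: field_simps)
    then have eq: "a * v = u * b" by (simp only: of_int_eq_iff)
    \<comment> \<open>If p divided the reduced denominator \<open>b\<close>, then by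
      \<open>a * v = u * b\<close> it would divide \<open>a\<close> as well, contrary to
      coprimality.\<close>
    have "\<not> int p dvd b"
    proof
      assume pb: "int p dvd b"
      then have "int p dvd a * v" using eq by simp
      then have "int p dvd a" using v(1) p(1) prime_dvd_multD by blast
      then show False using pb b(2) p(1) by (meson coprime_common_divisor not_prime_unit)
    qed
    then show "padic_abs p x \<le> 1" by (rule le[THEN iffD2])
  qed
qed

text \<open>The value group is discrete: an absolute value below 1 forces p to divide the numerator
  of the reduced fraction, so a factor p can be split off.\<close>

lemma padic_abs_less_1E:
  assumes "prime p" "padic_abs p x < 1"
  obtains y where "padic_abs p y \<le> 1" "x = of_nat p * y"
proof (cases "x = 0")
  case True
  then show ?thesis using that[of 0] by (simp add: padic_abs_def)
next
  case False
  have p: "prime (int p)" "real p > 1" using assms prime_gt_1_nat by auto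
  obtain a b where ab: "quotient_of x = (a, b)" by (cases "quotient_of x")
  then have b: "b > 0" "coprime a b" "x = of_int a / of_int b"
    using quotient_of_denom_pos quotient_of_coprime quotient_of_div by blast+
  have "padic_abs p x = real p powi (int (multiplicity (int p) b) - int (multiplicity (int p) a))"
    using False ab by (simp add: padic_abs_def)
  then have "int (multiplicity (int p) b) - int (multiplicity (int p) a) < 0"
    using assms(2) p(2) one_le_power_int[of "real p"
        "int (multiplicity (int p) b) - int (multiplicity (int p) a)"] by linarith
  then have "multiplicity (int p) a \<noteq> 0" by simp
  then have pa: "int p dvd a" using not_dvd_imp_multiplicity_0[of "int p" a] by auto
  then have "\<not> int p dvd b"
    using b(2) p(1) by (meson coprime_common_divisor not_prime_unit)
  then have "padic_abs p (of_int (a div int p) / of_int b) \<le> 1"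
    using padic_abs_le_1_iff[OF assms(1)] by blast
  moreover have "x = of_nat p * (of_int (a div int p) / of_int b)"
  proof -
    have "of_nat p * of_int (a div int p) = (of_int (int p * (a div int p)) :: rat)" by simp
    also have "\<dots> = of_int a" using pa by simp
    finally show ?thesis using b(3) by simp
  qed
  ultimately show ?thesis using that by blast
qed

lemma padic_abs_add_le_1:
  assumes "prime p" "padic_abs p x \<le> 1" "padic_abs p y \<le> 1"
  shows "padic_abs p (x + y) \<le> 1"
proof -
  obtain u v u' v' where uv: "\<not> int p dvd v" "x = of_int u / of_int v"
    "\<not> int p dvd v'" "y = of_int u' / of_int v'"
    using assms padic_abs_le_1_iff by meson
  then have "v \<noteq> 0" "v' \<noteq> 0" by auto
  then have "x + y = of_int (u * v' + u' * v) / of_int (v * v')"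
    using uv by (simp add: add_frac_eq)
  moreover have "\<not> int p dvd v * v'"
    using uv assms(1) by (simp add: prime_dvd_mult_iff)
  ultimately show ?thesis using padic_abs_le_1_iff[OF assms(1)] by blast
qed

text \<open>Otherwise \<open>1 + p x = p y\<close> with \<open>x\<close> and \<open>y\<close> in the
  valuation ring, and p would be invertible there.\<close>

lemma padic_abs_one_plus:
  assumes "prime p" "padic_abs p x \<le> 1"
  shows "\<not> padic_abs p (1 + of_nat p * x) < 1"
proof
  assume "padic_abs p (1 + of_nat p * x) < 1"
  then obtain y where y: "padic_abs p y \<le> 1" "1 + of_nat p * x = of_nat p * y"
    by (rule padic_abs_less_1E[OF assms(1)])
  obtain u v where v: "\<not> int p dvd v" "x = of_int u / of_int v"
    using assms padic_abs_le_1_iff by meson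
  then have "- x = of_int (- u) / of_int v" by simp
  then have "padic_abs p (- x) \<le> 1"
    using v(1) padic_abs_le_1_iff[OF assms(1)] by blast
  then have "padic_abs p (y + - x) \<le> 1"
    using padic_abs_add_le_1 assms(1) y(1) by blast
  then obtain c d where d: "\<not> int p dvd d" "y + - x = of_int c / of_int d"
    using assms(1) padic_abs_le_1_iff by meson
  have "d \<noteq> 0" using d(1) by auto
  \<comment> \<open>Clearing the denominator \<open>d\<close> makes p divide \<open>d\<close>, which
    it does not.\<close>
  have "of_nat p * (y + - x) = 1" using y(2) by (simp add: algebra_simps)
  then have "of_int (int p * c) = (of_int d :: rat)"
    unfolding d(2) using \<open>d \<noteq> 0\<close> by (simp add: field_simps)
  then have "int p * c = d" by (simp only: of_int_eq_iff)
  then show False using d(1) by auto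
qed

section \<open>Computations in the field of p-adic numbers\<close>

lemma padic_abs_0: "padic_abs p 0 = 0"
  by (simp add: padic_abs_def)

lemma zero_in_padic_null: "(\<lambda>_. 0) \<in> padic_null p"
  by (simp add: padic_null_def padic_abs_0)

text \<open>Elements are cosets of null sequences, so arithmetic is unfolded to representatives. A
  product of cosets is the union of the cosets of all products, hence the extra null sequence
  \<open>h\<close>.\<close>

lemma padic_field_simps:
  "\<zero>\<^bsub>padic_field p\<^esub> = padic_null p"
  "\<one>\<^bsub>padic_field p\<^esub> = {\<lambda>n. h n + 1 | h. h \<in> padic_null p}"
  "carrier (padic_field p) =
    {{\<lambda>n. h n + s n | h. h \<in> padic_null p} | s. s \<in> carrier (padic_cauchy_ring p)}"
  "A \<oplus>\<^bsub>padic_field p\<^esub> B = {\<lambda>n. s n + t n | s t. s \<in> A \<and> t \<in> B}"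
  "A \<otimes>\<^bsub>padic_field p\<^esub> B = {\<lambda>n. h n + s n * t n | h s t. h \<in> padic_null p \<and> s \<in> A \<and> t \<in> B}"
  by (auto simp: padic_field_def FactRing_def A_RCOSETS_def' a_r_coset_def' set_add_def'
      rcoset_mult_def padic_cauchy_ring_def)

text \<open>That the sum lies in the carrier is a hypothesis because the sentence it serves
  quantifies over the sum as an element of the carrier.\<close>

lemma padic_integers_add:
  assumes "prime p" "A \<in> padic_integers p" "B \<in> padic_integers p"
    and "A \<oplus>\<^bsub>padic_field p\<^esub> B \<in> carrier (padic_field p)"
  shows "A \<oplus>\<^bsub>padic_field p\<^esub> B \<in> padic_integers p"
proof -
  obtain s t where "s \<in> A" "t \<in> B" "\<forall>n. padic_abs p (s n) \<le> 1" "\<forall>n. padic_abs p (t n) \<le> 1"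
    using assms(2,3) by (auto simp: padic_integers_def)
  then have "(\<lambda>n. s n + t n) \<in> A \<oplus>\<^bsub>padic_field p\<^esub> B" "\<forall>n. padic_abs p (s n + t n) \<le> 1"
    using padic_abs_add_le_1[OF assms(1)] by (auto simp: padic_field_simps)
  then show ?thesis
    unfolding padic_integers_def using assms(4)
    by (intro CollectI conjI bexI[of _ "\<lambda>n. s n + t n"])
qed

lemma padic_integers_zero:
  "\<zero>\<^bsub>padic_field p\<^esub> \<in> carrier (padic_field p) \<Longrightarrow> \<zero>\<^bsub>padic_field p\<^esub> \<in> padic_integers p"
  unfolding padic_integers_def using zero_in_padic_null
  by (intro CollectI conjI bexI[of _ "\<lambda>_. 0"]) (simp_all add: padic_field_simps(1) padic_abs_0)

text \<open>The witness is the class of p. The statement mentions only an unspecified nonzero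
  \<open>b\<close> and membership in the integers, so it becomes a sentence as soon as a formula
  defines the integers.\<close>

lemma padic_uniformizer:
  assumes "prime p"
  shows "\<exists>b\<in>carrier (padic_field p). b \<noteq> \<zero>\<^bsub>padic_field p\<^esub> \<and>
    (\<forall>z\<in>padic_integers p. \<one>\<^bsub>padic_field p\<^esub> \<oplus>\<^bsub>padic_field p\<^esub> b \<otimes>\<^bsub>padic_field p\<^esub> z \<noteq> \<zero>\<^bsub>padic_field p\<^esub>)"
proof
  let ?F = "padic_field p"
  define b where "b = {\<lambda>n :: nat. h n + rat_of_nat p | h. h \<in> padic_null p}"
  have pb: "(\<lambda>_. rat_of_nat p) \<in> b"
    unfolding b_def using zero_in_padic_null[of p] by force
  show "b \<in> carrier ?F"
  proof -
    have "(\<lambda>_ :: nat. rat_of_nat p) \<in> carrier (padic_cauchy_ring p)"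
      by (simp add: padic_cauchy_ring_def padic_abs_0)
    then show ?thesis
      unfolding padic_field_simps b_def by (intro CollectI exI[of _ "\<lambda>_. rat_of_nat p"]) simp
  qed
  show "b \<noteq> \<zero>\<^bsub>?F\<^esub> \<and> (\<forall>z\<in>padic_integers p.
     \<one>\<^bsub>?F\<^esub> \<oplus>\<^bsub>?F\<^esub> b \<otimes>\<^bsub>?F\<^esub> z \<noteq> \<zero>\<^bsub>?F\<^esub>)"
  proof (intro conjI ballI notI)
    assume "b = \<zero>\<^bsub>?F\<^esub>"
    then have "(\<lambda>_. rat_of_nat p) \<in> padic_null p" using pb by (simp add: padic_field_simps)
    then have "padic_abs p (rat_of_nat p) = 0"
      by (simp add: padic_null_def LIMSEQ_const_iff)
    moreover have "padic_abs p (rat_of_nat p) > 0"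
      using prime_gt_0_nat[OF assms] by (auto simp: padic_abs_def Let_def split: prod.split)
    ultimately show False by simp
  next
    fix z assume z: "z \<in> padic_integers p"
      and eq: "\<one>\<^bsub>?F\<^esub> \<oplus>\<^bsub>?F\<^esub> b \<otimes>\<^bsub>?F\<^esub> z = \<zero>\<^bsub>?F\<^esub>"
    obtain s where s: "s \<in> z" "\<forall>n. padic_abs p (s n) \<le> 1"
      using z by (auto simp: padic_integers_def)
    have "(\<lambda>n. 0 + rat_of_nat p * s n) \<in> b \<otimes>\<^bsub>?F\<^esub> z"
      unfolding padic_field_simps using zero_in_padic_null pb s(1)
      by (intro CollectI exI[of _ "\<lambda>_. 0"] exI[of _ "\<lambda>_. rat_of_nat p"] exI[of _ s]) simp
    moreover have "(\<lambda>n. 0 + 1) \<in> \<one>\<^bsub>?F\<^esub>"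
      unfolding padic_field_simps using zero_in_padic_null
      by (intro CollectI exI[of _ "\<lambda>_. 0"]) simp
    ultimately have "(\<lambda>n. (0 + 1) + (0 + rat_of_nat p * s n)) \<in>
        \<one>\<^bsub>?F\<^esub> \<oplus>\<^bsub>?F\<^esub> b \<otimes>\<^bsub>?F\<^esub> z"
      unfolding padic_field_simps(4)
      by (intro CollectI exI[of _ "\<lambda>_. 0 + 1"] exI[of _ "\<lambda>n. 0 + rat_of_nat p * s n"]) simp
    \<comment> \<open>If the sum were zero, this representative would be a null sequence, and some
      term would have absolute value below 1, which \<open>padic_abs_one_plus\<close>
      excludes.\<close>
    then have "(\<lambda>n. padic_abs p (1 + rat_of_nat p * s n)) \<longlonglongrightarrow> 0"
      unfolding eq by (simp add: padic_field_simps padic_null_def)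
    then have "\<forall>\<^sub>F n in sequentially. padic_abs p (1 + rat_of_nat p * s n) < 1"
      by (rule order_tendstoD(2)) simp
    then obtain n where "padic_abs p (1 + rat_of_nat p * s n) < 1"
      using eventually_happens'[OF sequentially_bot] by blast
    then show False using padic_abs_one_plus[OF assms] s(2) by blast
  qed
qed

section \<open>Transfer to p-adically closed fields\<close>

text \<open>Sending every variable to \<open>k\<close> evaluates the formula at a constant
  assignment, the form in which \<open>valuation_ring\<close> uses it, and leaves \<open>k\<close>
  as the only possible free variable.\<close>

abbreviation at_var :: "rfm \<Rightarrow> nat \<Rightarrow> rfm" where
  "at_var \<phi> k \<equiv> rename_fm \<phi> (\<lambda>_. k)"

lemma not_free_at_var: "i \<noteq> k \<Longrightarrow> i \<notin> free_vars (at_var \<phi> k)"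
  using free_vars_rename_fm[of \<phi> "\<lambda>_. k"] by auto

text \<open>The set is \<open>1 + b V\<close> with \<open>V\<close> the valuation ring. Since
  \<open>V\<close> is closed under addition, it absorbs translation by \<open>b V\<close>, so
  \<open>b\<close> witnesses openness at each of its points. It contains 1 because 0 is in
  \<open>V\<close>, and misses 0 by the choice of \<open>b\<close>. All these facts about
  \<open>V\<close> are transferred.\<close>

lemma valuation_topology_separates:
  fixes M :: "('a, 'b) ring_scheme" (structure)
  assumes p: "prime p" and M: "padically_closed p M"
  shows "\<exists>A. openin (valuation_topology p M) A \<and> \<one> \<in> A \<and> \<zero> \<notin> A"
proof -
  interpret field M using M by (simp add: padically_closed_def)
  let ?F = "padic_field p"
  have transfer: "sat M (\<lambda>_. \<zero>) \<psi> \<longleftrightarrow> sat ?F (\<lambda>_. \<zero>\<^bsub>?F\<^esub>) \<psi>" if "free_vars \<psi> = {}" for \<psi>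
    using M that by (simp add: padically_closed_def elementarily_equivalent_def)
  define defines_integers where "defines_integers = (\<lambda>\<phi>. free_vars \<phi> \<subseteq> {0} \<and>
    {a \<in> carrier ?F. sat ?F (\<lambda>_. a) \<phi>} = padic_integers p)"
  have openI: "openin (valuation_topology p M) U"
    if "U \<subseteq> carrier M" "\<And>x. x \<in> U \<Longrightarrow> \<exists>b\<in>carrier M - {\<zero>}.
      \<forall>z\<in>valuation_ring p M. x \<oplus> b \<otimes> z \<in> U" for U
    unfolding valuation_topology_def by (rule topology_generated_by_Basis) (use that in blast)
  show ?thesis
  proof (cases "\<exists>\<phi>. defines_integers \<phi>")
    case False
    \<comment> \<open>Here the defining condition of the topology is vacuous and the topology is discrete;
      this case does not occur, but excluding it would require a definition of the integers.\<close>
    then have "valuation_ring p M = {}"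
      by (auto simp: valuation_ring_def defines_integers_def)
    then have "openin (valuation_topology p M) {\<one>}"
      by (intro openI) (auto intro!: bexI[of _ "\<one>"])
    then show ?thesis by auto
  next
    case True
    then obtain \<phi> where \<phi>: "defines_integers \<phi>" by blast
    have int_iff: "sat ?F (\<lambda>_. a) \<psi> \<longleftrightarrow> a \<in> padic_integers p"
      if "defines_integers \<psi>" "a \<in> carrier ?F" for a \<psi>
      using that by (auto simp: defines_integers_def)
    define V where "V = {x \<in> carrier M. sat M (\<lambda>_. x) \<phi>}"
    \<comment> \<open>The equivalence of two formulas defining the integers is itself a sentence, so
      they also agree in \<open>M\<close>. Thus the existential quantifier over formulas in
      \<open>valuation_ring\<close> collapses to the single formula fixed above.\<close>
    have agree: "sat M (\<lambda>_. x) \<psi> \<longleftrightarrow> sat M (\<lambda>_. x) \<phi>" if "defines_integers \<psi>" "x \<in> carrier M" for \<psi> x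
    proof -
      let ?E = "rfm.Not (rfm.Ex (rfm.Not (rfm.And (rfm.Not (rfm.And (at_var \<phi> 0) (rfm.Not (at_var \<psi> 0))))
          (rfm.Not (rfm.And (at_var \<psi> 0) (rfm.Not (at_var \<phi> 0)))))))"
      have "free_vars ?E = {}" by (simp add: not_free_at_var)
      moreover have "sat ?F (\<lambda>_. \<zero>\<^bsub>?F\<^esub>) ?E"
        using int_iff[OF \<phi>] int_iff[OF that(1)] by (auto simp: sat_rename_fm)
      ultimately have "sat M (\<lambda>_. \<zero>) ?E" using transfer by blast
      then show ?thesis using that(2) by (auto simp: sat_rename_fm)
    qed
    have V: "valuation_ring p M = V"
    proof -
      have "valuation_ring p M = {x \<in> carrier M. \<exists>\<psi>. defines_integers \<psi> \<and> sat M (\<lambda>_. x) \<psi>}"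
        by (simp add: valuation_ring_def defines_integers_def conj_assoc)
      also have "\<dots> = V"
        unfolding V_def using \<phi> agree by (intro Collect_cong conj_cong refl) blast
      finally show ?thesis .
    qed
    have add: "x \<oplus> y \<in> V" if "x \<in> V" "y \<in> V" for x y
    proof -
      \<comment> \<open>No \<open>x\<close> (index 2), \<open>y\<close> (index 1) and
        \<open>w\<close> (index 0) satisfy \<open>w = x + y\<close> with \<open>x\<close> and
        \<open>y\<close> in the set and \<open>w\<close> outside.\<close>
      let ?E = "rfm.Not (rfm.Ex (rfm.Ex (rfm.Ex (rfm.And (rfm.And (at_var \<phi> 2) (at_var \<phi> 1))
          (rfm.And (rfm.Eq (rtm.Var 0) (rtm.Add (rtm.Var 2) (rtm.Var 1))) (rfm.Not (at_var \<phi> 0)))))))"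
      have "free_vars ?E = {}" by (simp add: not_free_at_var)
      moreover have "sat ?F (\<lambda>_. \<zero>\<^bsub>?F\<^esub>) ?E"
      proof -
        have "sat ?F (\<lambda>_. w) \<phi>"
          if "x \<in> carrier ?F" "y \<in> carrier ?F" "w \<in> carrier ?F"
            "sat ?F (\<lambda>_. x) \<phi>" "sat ?F (\<lambda>_. y) \<phi>" "w = x \<oplus>\<^bsub>?F\<^esub> y" for x y w
          using padic_integers_add[OF p, of x y] that int_iff[OF \<phi>] by metis
        then show ?thesis by (simp add: sat_rename_fm numeral_2_eq_2)
      qed
      ultimately have "sat M (\<lambda>_. \<zero>) ?E" using transfer by blast
      then show ?thesis using that by (auto simp: sat_rename_fm numeral_2_eq_2 V_def)
    qed
    have zero: "\<zero> \<in> V"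
    proof -
      let ?E = "rfm.Not (rfm.Ex (rfm.And (rfm.Eq (rtm.Var 0) rtm.Zero) (rfm.Not (at_var \<phi> 0))))"
      have "free_vars ?E = {}" by (simp add: not_free_at_var)
      moreover have "sat ?F (\<lambda>_. \<zero>\<^bsub>?F\<^esub>) ?E"
        using int_iff[OF \<phi>] padic_integers_zero[of p] by (auto simp: sat_rename_fm)
      ultimately have "sat M (\<lambda>_. \<zero>) ?E" using transfer by blast
      then show ?thesis by (auto simp: sat_rename_fm V_def)
    qed
    obtain b where b: "b \<in> carrier M" "b \<noteq> \<zero>"
      "\<And>z. z \<in> V \<Longrightarrow> \<one> \<oplus> b \<otimes> z \<noteq> \<zero>"
    proof -
      \<comment> \<open>Under the inner quantifier \<open>b\<close> has index 1 and the element
        \<open>z\<close> has index 0.\<close>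
      let ?E = "rfm.Ex (rfm.And (rfm.Not (rfm.Eq (rtm.Var 0) rtm.Zero)) (rfm.Not (rfm.Ex (rfm.And (at_var \<phi> 0)
          (rfm.Eq (rtm.Add rtm.One (rtm.Mul (rtm.Var 1) (rtm.Var 0))) rtm.Zero)))))"
      have "free_vars ?E = {}" by (simp add: not_free_at_var)
      moreover have "sat ?F (\<lambda>_. \<zero>\<^bsub>?F\<^esub>) ?E"
        using int_iff[OF \<phi>] padic_uniformizer[OF p] by (auto simp: sat_rename_fm)
      ultimately have "sat M (\<lambda>_. \<zero>) ?E" using transfer by blast
      then show ?thesis using that by (auto simp: sat_rename_fm V_def)
    qed
    have Ocar: "V \<subseteq> carrier M" by (auto simp: V_def)
    define A where "A = (\<lambda>z. \<one> \<oplus> b \<otimes> z) ` V"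
    have "openin (valuation_topology p M) A"
    proof (rule openI)
      show "A \<subseteq> carrier M" using Ocar b(1) by (auto simp: A_def)
      fix x assume "x \<in> A"
      then obtain y where y: "y \<in> V" "x = \<one> \<oplus> b \<otimes> y" by (auto simp: A_def)
      have "x \<oplus> b \<otimes> z \<in> A" if "z \<in> V" for z
      proof -
        have "x \<oplus> b \<otimes> z = \<one> \<oplus> b \<otimes> (y \<oplus> z)"
          using y that Ocar b(1) by (simp add: subset_iff r_distr a_assoc)
        then show ?thesis using add[OF y(1) that] by (auto simp: A_def)
      qed
      then show "\<exists>b\<in>carrier M - {\<zero>}. \<forall>z\<in>valuation_ring p M. x \<oplus> b \<otimes> z \<in> A"
        using b unfolding V by blast
    qed
    moreover have "\<one> \<in> A"
      using zero b(1) by (force simp: A_def)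
    moreover have "\<zero> \<notin> A"
    proof
      assume "\<zero> \<in> A"
      then obtain z where "z \<in> V" "\<zero> = \<one> \<oplus> b \<otimes> z"
        unfolding A_def by (rule imageE)
      then show False using b(3)[of z] by simp
    qed
    ultimately show ?thesis by blast
  qed
qed

section \<open>Products and disjoint unions of definable sets\<close>

lemma topspace_valuation_topology:
  assumes "field M"
  shows "topspace (valuation_topology p M) = carrier M"
proof -
  interpret field M by fact
  have "valuation_ring p M \<subseteq> carrier M" by (auto simp: valuation_ring_def)
  then have "carrier M \<in> {U. U \<subseteq> carrier M \<and> (\<forall>x\<in>U. \<exists>b\<in>carrier M - {\<zero>\<^bsub>M\<^esub>}.
      \<forall>z\<in>valuation_ring p M. x \<oplus>\<^bsub>M\<^esub> b \<otimes>\<^bsub>M\<^esub> z \<in> U)}"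
    by (auto intro!: bexI[of _ "\<one>\<^bsub>M\<^esub>"])
  then show ?thesis
    unfolding valuation_topology_def topology_generated_by_topspace by blast
qed

lemma topspace_tuple_topology:
  "field M \<Longrightarrow> topspace (tuple_topology p M n) = tuples M n"
  by (simp add: tuple_topology_def tuples_def topspace_valuation_topology)

section \<open>Sets of tuples as interpretable spaces\<close>

lemma tuple_space_simps [simp]:
  "amb_dim (tuple_space p M n D) = n"
  "idom (tuple_space p M n D) = D"
  "irel (tuple_space p M n D) = Id_on D"
  by (simp_all add: tuple_space_def)

lemma points_tuple_space: "points (tuple_space p M n D) = (\<lambda>x. {x}) ` D"
  by (auto simp: points_def quotient_def)

lemma interpretable_set_tuple_space:
  assumes D: "definable M n D"
  shows "interpretable_set M (tuple_space p M n D)"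
proof (rule interpretable_setI[where P = "\<lambda>x. x \<in> D"])
  have ne: "carrier M \<noteq> {}" by (rule definable_carrier_nonempty[OF D])
  show "idom (tuple_space p M n D) = {x \<in> tuples M (amb_dim (tuple_space p M n D)). x \<in> D}"
    using definable_subset_tuples[OF D] by auto
  show "definable_pred M (\<lambda>x. (\<lambda>i\<in>{..<amb_dim (tuple_space p M n D)}. x i) \<in> D)"
    unfolding tuple_space_simps by (rule definable_pred_tuple_term[OF D tuple_term_restrict[OF ne]])
  show "equiv (idom (tuple_space p M n D)) (irel (tuple_space p M n D))"
    by (auto intro!: equivI simp: refl_on_def sym_def trans_def)
  show "definable_pred M (\<lambda>x. (\<lambda>i\<in>{..<amb_dim (tuple_space p M n D)}. x i,
      \<lambda>i\<in>{..<amb_dim (tuple_space p M n D)}. x (amb_dim (tuple_space p M n D) + i)) \<in> irel (tuple_space p M n D))"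
    unfolding tuple_space_simps Id_on_iff
    by (intro definable_pred_conj definable_pred_eq[OF ne, of n] definable_pred_tuple_term[OF D]
        tuple_term_restrict ne)
qed

lemma topspace_tuple_space:
  assumes "field M" "D \<subseteq> tuples M n"
  shows "topspace (itop (tuple_space p M n D)) = points (tuple_space p M n D)"
  unfolding points_tuple_space using assms(2)
  by (auto simp: tuple_space_def topspace_pullback_topology topspace_tuple_topology[OF assms(1)])

lemma topologized_iset_tuple_space:
  assumes "field M" "definable M n D"
  shows "topologized_iset M (tuple_space p M n D)"
  using assms interpretable_set_tuple_space[OF assms(2)]
    topspace_tuple_space[OF assms(1) definable_subset_tuples[OF assms(2)]]
  by (simp add: topologized_iset_def)

text \<open>Points of a tuple space are singletons. Continuity of \<open>the_elem\<close>, together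
  with the criterion for maps into such a space, reduces every continuity question to tuples and
  then to coordinates.\<close>

lemma continuous_map_tuple_space_the_elem:
  "continuous_map (itop (tuple_space p M n D)) (tuple_topology p M n) the_elem"
  using continuous_map_pullback[OF continuous_map_id, of "(\<lambda>x. {x}) ` D" the_elem "tuple_topology p M n"]
  by (simp add: tuple_space_def id_comp)

lemma continuous_map_into_tuple_space:
  assumes "continuous_map W (tuple_topology p M n) g"
    and "\<And>w. w \<in> topspace W \<Longrightarrow> g w \<in> D" "\<And>w. w \<in> topspace W \<Longrightarrow> f w = {g w}"
  shows "continuous_map W (itop (tuple_space p M n D)) f"
proof -
  have "continuous_map W (itop (tuple_space p M n D)) (\<lambda>w. {g w})"
    unfolding tuple_space_def ispace.simps
    by (rule continuous_map_pullback') (use assms(1,2) in \<open>auto simp: o_def\<close>)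
  then show ?thesis
    by (rule continuous_map_eq) (simp add: assms(3))
qed

lemma continuous_map_tuple_coordinate:
  "j < n \<Longrightarrow> continuous_map (tuple_topology p M n) (valuation_topology p M) (\<lambda>x. x j)"
  unfolding tuple_topology_def by (rule continuous_map_product_projection) simp

lemma continuous_map_into_tuples:
  assumes "\<And>w. w \<in> topspace W \<Longrightarrow> f w \<in> extensional {..<n}"
    and "\<And>k. k < n \<Longrightarrow> continuous_map W (valuation_topology p M) (\<lambda>w. f w k)"
  shows "continuous_map W (tuple_topology p M n) f"
  unfolding tuple_topology_def continuous_map_componentwise using assms by auto

lemma continuous_map_block:
  assumes "i < m"
  shows "continuous_map (tuple_topology p M (sum d {..<m})) (tuple_topology p M (d i)) (block d m i)"
proof (rule continuous_map_into_tuples)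
  fix k assume k: "k < d i"
  show "continuous_map (tuple_topology p M (sum d {..<m})) (valuation_topology p M) (\<lambda>w. block d m i w k)"
    using continuous_map_tuple_coordinate[OF flat_index_less[of i m k d, OF assms k]] k
    by (simp add: block_def)
qed (simp add: block_def)

definition tuple_product ::
  "('a, 'b) ring_scheme \<Rightarrow> nat \<Rightarrow> (nat \<Rightarrow> nat) \<Rightarrow> (nat \<Rightarrow> (nat \<Rightarrow> 'a) set) \<Rightarrow> (nat \<Rightarrow> 'a) set" where
  "tuple_product M m d D = {z \<in> tuples M (sum d {..<m}). \<forall>i<m. block d m i z \<in> D i}"

lemma openin_tuple_product:
  assumes "field M" "\<And>i. i < m \<Longrightarrow> openin (tuple_topology p M (d i)) (D i)"
  shows "openin (tuple_topology p M (sum d {..<m})) (tuple_product M m d D)"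
  unfolding tuple_product_def topspace_tuple_topology[OF assms(1), of p, symmetric]
  by (rule openin_finite_preimages[of m _ "\<lambda>i. tuple_topology p M (d i)"])
    (use assms continuous_map_block in auto)

text \<open>A long tuple is determined by its blocks, so equality is blockwise equality and the
  general construction for quotients applies.\<close>

lemma iset_product_tuple_product:
  assumes M: "field M" and D: "\<And>i. i < m \<Longrightarrow> definable M (d i) (D i)"
  shows "iset_product M m (\<lambda>i. tuple_space p M (d i) (D i))
    (tuple_space p M (sum d {..<m}) (tuple_product M m d D)) (\<lambda>i u. {block d m i (the_elem u)})"
proof (rule iset_product_blocks)
  let ?T = "tuple_space p M (sum d {..<m}) (tuple_product M m d D)"
  interpret field M by fact
  show "carrier M \<noteq> {}" using zero_closed by blast
  show "interpretable_set M (tuple_space p M (d i) (D i))" if "i < m" for i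
    by (rule interpretable_set_tuple_space[OF D[OF that]])
  have eq: "z = w" if "z \<in> tuple_product M m d D" "w \<in> tuple_product M m d D"
    "\<forall>i<m. block d m i z = block d m i w" for z w
    using that by (intro block_eqI[of z M d m w]) (auto simp: tuple_product_def)
  show "irel ?T = {(z, w).
      z \<in> idom ?T \<and>
      w \<in> idom ?T \<and>
      (\<forall>i<m. (block d m i z, block d m i w) \<in> irel (tuple_space p M (d i) (D i)))}"
    (is "?L = ?R")
  proof (rule Set.set_eqI)
    fix v :: "(nat \<Rightarrow> 'a) \<times> (nat \<Rightarrow> 'a)"
    obtain z w where v: "v = (z, w)" by (cases v)
    show "v \<in> ?L \<longleftrightarrow> v \<in> ?R"
      unfolding v mem_Collect_eq prod.case tuple_space_simps Id_on_iff
    proof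
      assume "z = w \<and> z \<in> tuple_product M m d D"
      then show "z \<in> tuple_product M m d D \<and> w \<in> tuple_product M m d D \<and>
          (\<forall>i<m. block d m i z = block d m i w \<and> block d m i z \<in> D i)"
        by (elim conjE) (simp add: tuple_product_def)
    next
      assume "z \<in> tuple_product M m d D \<and> w \<in> tuple_product M m d D \<and>
          (\<forall>i<m. block d m i z = block d m i w \<and> block d m i z \<in> D i)"
      then show "z = w \<and> z \<in> tuple_product M m d D"
        using eq[of z w] by simp
    qed
  qed
  show "{block d m i (the_elem (irel ?T `` {z}))} =
      irel (tuple_space p M (d i) (D i)) `` {block d m i z}"
    if "i < m" "z \<in> idom ?T" for i z
  proof -
    have "Id_on (tuple_product M m d D) `` {z} = {z}" "Id_on (D i) `` {block d m i z} = {block d m i z}"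
      using that by (auto simp: tuple_product_def)
    then show ?thesis by simp
  qed
qed (auto simp: tuple_product_def)

lemma definable_tuple_product:
  assumes "field M" "\<And>i. i < m \<Longrightarrow> definable M (d i) (D i)"
  shows "definable M (sum d {..<m}) (tuple_product M m d D)"
  using iset_product_tuple_product[of M m d D, OF assms]
  by (auto simp: iset_product_def interpretable_set_def)

text \<open>Cutting into blocks and flattening only rearrange coordinates, so both directions are
  continuous coordinate by coordinate.\<close>

lemma is_product_tuple_space:
  assumes M: "field M" and D: "\<And>i. i < m \<Longrightarrow> definable M (d i) (D i)"
  shows "is_product M m (\<lambda>i. tuple_space p M (d i) (D i))
    (tuple_space p M (sum d {..<m}) (tuple_product M m d D))"
proof (rule is_productI[OF iset_product_tuple_product[OF M D]])
  let ?T = "tuple_space p M (sum d {..<m}) (tuple_product M m d D)"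
  let ?P = "product_topology (\<lambda>i. itop (tuple_space p M (d i) (D i))) {..<m}"
  let ?G = "\<lambda>z. \<lambda>i\<in>{..<m}. {block d m i (the_elem z)}"
  let ?H = "\<lambda>w. {unblock d m (\<lambda>i. the_elem (w i))}"
  have Dsub: "D i \<subseteq> tuples M (d i)" if "i < m" for i
    by (rule definable_subset_tuples[OF D[OF that]])
  have sub: "tuple_product M m d D \<subseteq> tuples M (sum d {..<m})"
    by (auto simp: tuple_product_def)
  show topT: "topspace (itop ?T) = points ?T"
    by (rule topspace_tuple_space[OF M sub])
  have topP: "w \<in> topspace ?P \<longleftrightarrow> w \<in> (\<Pi>\<^sub>E i\<in>{..<m}. (\<lambda>x. {x}) ` D i)" for w
    using topspace_tuple_space[OF M Dsub] by (auto simp: PiE_iff points_tuple_space)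
  have elem: "the_elem (w i) \<in> D i" "w i = {the_elem (w i)}" if "w \<in> topspace ?P" "i < m" for w i
  proof -
    have "w i \<in> (\<lambda>x. {x}) ` D i"
      using that unfolding topP by (auto simp: PiE_iff)
    then obtain x where "x \<in> D i" "w i = {x}" by (elim imageE)
    then show "the_elem (w i) \<in> D i" "w i = {the_elem (w i)}" by simp_all
  qed
  have blockH: "block d m i (unblock d m (\<lambda>i. the_elem (w i))) = the_elem (w i)"
    if "w \<in> topspace ?P" "i < m" for w i
    using elem[OF that] Dsub[OF that(2)] that(2) by (intro block_unblock) auto
  have unbl: "unblock d m (\<lambda>i. the_elem (w i)) \<in> tuple_product M m d D" if w: "w \<in> topspace ?P" for w
    unfolding tuple_product_def
  proof (intro CollectI conjI allI impI)
    show "unblock d m (\<lambda>i. the_elem (w i)) \<in> tuples M (sum d {..<m})"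
      by (rule unblock_in_tuples) (use elem(1)[OF w] Dsub in blast)
    show "block d m i (unblock d m (\<lambda>i. the_elem (w i))) \<in> D i" if "i < m" for i
      using blockH[OF w that] elem(1)[OF w that] by simp
  qed
  have "homeomorphic_maps (itop ?T) ?P ?G ?H"
    unfolding homeomorphic_maps_def
  proof (intro conjI ballI)
    show "continuous_map (itop ?T) ?P ?G"
      unfolding continuous_map_componentwise
    proof (intro conjI ballI)
      fix i assume "i \<in> {..<m}"
      then have i: "i < m" by simp
      have "continuous_map (itop ?T) (itop (tuple_space p M (d i) (D i))) (\<lambda>z. {block d m i (the_elem z)})"
      proof (rule continuous_map_into_tuple_space)
        show "continuous_map (itop ?T) (tuple_topology p M (d i)) (\<lambda>z. block d m i (the_elem z))"
          using continuous_map_compose[OF continuous_map_tuple_space_the_elem continuous_map_block[OF i]]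
          by (simp only: o_def)
        fix z assume "z \<in> topspace (itop ?T)"
        then show "block d m i (the_elem z) \<in> D i"
          unfolding topT points_tuple_space using i by (auto simp: tuple_product_def)
      qed simp
      then show "continuous_map (itop ?T) (itop (tuple_space p M (d i) (D i))) (\<lambda>z. ?G z i)"
        using i by simp
    qed auto
    show "continuous_map ?P (itop ?T) ?H"
    proof (rule continuous_map_into_tuple_space)
      show "continuous_map ?P (tuple_topology p M (sum d {..<m})) (\<lambda>w. unblock d m (\<lambda>i. the_elem (w i)))"
      proof (rule continuous_map_into_tuples)
        fix k assume "k < sum d {..<m}"
        then obtain i j where ij: "i < m" "j < d i" "k = flat_index d m (i, j)"
          by (rule flat_index_cases)
        \<comment> \<open>Coordinate \<open>k\<close> of the flattened tuple is coordinate
          \<open>j\<close> of the i-th factor.\<close>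
        have "continuous_map ?P (valuation_topology p M) ((\<lambda>x. x j) \<circ> (the_elem \<circ> (\<lambda>w. w i)))"
          using continuous_map_product_projection[of i "{..<m}" "\<lambda>i. itop (tuple_space p M (d i) (D i))"] ij(1)
          by (intro continuous_map_compose[OF _ continuous_map_tuple_coordinate[OF ij(2)]]
              continuous_map_compose[OF _ continuous_map_tuple_space_the_elem]) simp
        then show "continuous_map ?P (valuation_topology p M) (\<lambda>w. unblock d m (\<lambda>i. the_elem (w i)) k)"
          using ij by (simp add: unblock_flat_index o_def)
      qed (simp add: unblock_def)
    qed (use unbl in auto)
  next
    fix u assume "u \<in> topspace (itop ?T)"
    then obtain z where z: "u = {z}" "z \<in> tuple_product M m d D"
      unfolding topT points_tuple_space by blast
    have bz: "block d m i z \<in> tuples M (d i)" if "i < m" for i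
      using z(2) that Dsub[OF that] by (auto simp: tuple_product_def)
    have "unblock d m (\<lambda>i. the_elem (?G u i)) = z"
    proof (rule block_eqI)
      have *: "the_elem (?G u i) = block d m i z" if "i < m" for i using that z(1) by simp
      show "unblock d m (\<lambda>i. the_elem (?G u i)) \<in> tuples M (sum d {..<m})"
        by (rule unblock_in_tuples) (use * bz in auto)
      show "z \<in> tuples M (sum d {..<m})" using z(2) sub by blast
      show "block d m i (unblock d m (\<lambda>i. the_elem (?G u i))) = block d m i z" if "i < m" for i
        using block_unblock[of "\<lambda>i. the_elem (?G u i)" i M d m] *[OF that] bz[OF that] that by simp
    qed
    then show "?H (?G u) = u" using z(1) by simp
  next
    fix w assume w: "w \<in> topspace ?P"
    show "?G (?H w) = w"
    proof
      fix i
      show "?G (?H w) i = w i"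
      proof (cases "i < m")
        case True
        then show ?thesis using blockH[OF w True] elem(2)[OF w True] by simp
      next
        case False
        then show ?thesis using w unfolding topP by (auto simp: PiE_iff extensional_def)
      qed
    qed
  qed
  then show "homeomorphic_map (itop ?T) ?P ?G"
    unfolding homeomorphic_map_maps by (rule exI[of _ ?H])
qed

section \<open>Disjoint unions of sets of tuples\<close>

definition tuple_sum ::
  "('a, 'b) ring_scheme \<Rightarrow> nat \<Rightarrow> (nat \<Rightarrow> nat) \<Rightarrow> (nat \<Rightarrow> (nat \<Rightarrow> 'a) set) \<Rightarrow> (nat \<Rightarrow> 'a) set" where
  "tuple_sum M m d D = {tag M d m i x | i x. i < m \<and> x \<in> D i}"

lemma iset_sum_tuple_sum:
  assumes M: "field M" and D: "\<And>i. i < m \<Longrightarrow> definable M (d i) (D i)"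
  shows "iset_sum M m (\<lambda>i. tuple_space p M (d i) (D i))
    (tuple_space p M (m + sum d {..<m}) (tuple_sum M m d D)) (\<lambda>i u. tag M d m i ` u)"
proof (rule iset_sum_tags)
  interpret field M by fact
  show "\<zero>\<^bsub>M\<^esub> \<in> carrier M" "\<one>\<^bsub>M\<^esub> \<in> carrier M" "\<one>\<^bsub>M\<^esub> \<noteq> \<zero>\<^bsub>M\<^esub>" by simp_all
  show "interpretable_set M (tuple_space p M (d i) (D i))" if "i < m" for i
    by (rule interpretable_set_tuple_space[OF D[OF that]])
qed (auto simp: tuple_sum_def)

lemma definable_tuple_sum:
  assumes "field M" "\<And>i. i < m \<Longrightarrow> definable M (d i) (D i)"
  shows "definable M (m + sum d {..<m}) (tuple_sum M m d D)"
  using iset_sum_tuple_sum[of M m d D, OF assms]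
  by (auto simp: iset_sum_def interpretable_set_def)

lemma continuous_map_tag:
  assumes M: "field M" and i: "i < m"
  shows "continuous_map (tuple_topology p M (d i)) (tuple_topology p M (m + sum d {..<m})) (tag M d m i)"
proof (rule continuous_map_into_tuples)
  interpret field M by fact
  fix k assume k: "k < m + sum d {..<m}"
  have const: "continuous_map (tuple_topology p M (d i)) (valuation_topology p M) (\<lambda>_. c)"
    if "c \<in> carrier M" for c
    using that topspace_valuation_topology[OF M] by simp
  consider "k < m" | "\<not> k < m" "k - m < d i" | "\<not> k < m" "\<not> k - m < d i" by blast
  then show "continuous_map (tuple_topology p M (d i)) (valuation_topology p M) (\<lambda>w. tag M d m i w k)"
  proof cases
    case 1
    then show ?thesis using k const[OF zero_closed] const[OF one_closed] by (simp add: tag_def)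
  next
    case 2
    then show ?thesis using k continuous_map_tuple_coordinate[OF 2(2)] by (simp add: tag_def)
  next
    case 3
    then show ?thesis using k const[OF zero_closed] by (simp add: tag_def)
  qed
qed (simp add: tag_def)

lemma continuous_map_untag:
  assumes "i < m"
  shows "continuous_map (tuple_topology p M (m + sum d {..<m})) (tuple_topology p M (d i)) (untag d m i)"
proof (rule continuous_map_into_tuples)
  fix k assume k: "k < d i"
  then have "m + k < m + sum d {..<m}" using le_sum_lessThan[OF assms, of d] by simp
  then show "continuous_map (tuple_topology p M (m + sum d {..<m})) (valuation_topology p M) (\<lambda>w. untag d m i w k)"
    using continuous_map_tuple_coordinate[of "m + k" "m + sum d {..<m}" p M] k by (simp add: untag_def)
qed (simp add: untag_def)

text \<open>Continuity of the tagging maps holds coordinatewise. Openness needs \<open>A\<close>: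
  coordinate \<open>i\<close> is one on the i-th piece and zero on all others, so the condition that
  it lies in \<open>A\<close> cuts out the i-th piece by an open set.\<close>

lemma is_disjoint_union_tuple_space:
  assumes M: "field M" and D: "\<And>i. i < m \<Longrightarrow> definable M (d i) (D i)"
    and A: "openin (valuation_topology p M) A" "\<one>\<^bsub>M\<^esub> \<in> A" "\<zero>\<^bsub>M\<^esub> \<notin> A"
  shows "is_disjoint_union M m (\<lambda>i. tuple_space p M (d i) (D i))
    (tuple_space p M (m + sum d {..<m}) (tuple_sum M m d D))"
proof (rule is_disjoint_unionI[OF iset_sum_tuple_sum[OF M D]])
  interpret field M by fact
  let ?N = "m + sum d {..<m}"
  let ?Y = "\<lambda>i. tuple_space p M (d i) (D i)"
  let ?T = "tuple_space p M ?N (tuple_sum M m d D)"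
  let ?S = "sum_topology (\<lambda>i. itop (?Y i)) {..<m}"
  let ?inc = "\<lambda>(i, u). tag M d m i ` u"
  have Dsub: "D i \<subseteq> tuples M (d i)" if "i < m" for i
    by (rule definable_subset_tuples[OF D[OF that]])
  have sub: "tuple_sum M m d D \<subseteq> tuples M ?N"
    by (rule definable_subset_tuples[OF definable_tuple_sum[OF M D]])
  show topT: "topspace (itop ?T) = points ?T"
    by (rule topspace_tuple_space[OF M sub])
  have topY: "topspace (itop (?Y i)) = points (?Y i)" if "i < m" for i
    by (rule topspace_tuple_space[OF M Dsub[OF that]])
  have topS: "topspace ?S = (SIGMA i:{..<m}. points (?Y i))"
    using topY by auto
  have bij: "bij_betw ?inc (topspace ?S) (points ?T)"
  proof -
    have "iset_sum M m ?Y ?T (\<lambda>i u. tag M d m i ` u)"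
      by (rule iset_sum_tuple_sum[OF M D])
    then show ?thesis unfolding iset_sum_def topS by (elim conjE)
  qed
  show "homeomorphic_map ?S (itop ?T) ?inc"
  proof (rule bijective_open_imp_homeomorphic_map)
    show "?inc ` topspace ?S = topspace (itop ?T)" "inj_on ?inc (topspace ?S)"
      using bij unfolding bij_betw_def topT by blast+
    show "continuous_map ?S (itop ?T) ?inc"
    proof (rule continuous_map_from_sum)
      fix i assume "i \<in> {..<m}"
      then have i: "i < m" by simp
      have "continuous_map (itop (?Y i)) (itop ?T) (\<lambda>u. tag M d m i ` u)"
      proof (rule continuous_map_into_tuple_space)
        show "continuous_map (itop (?Y i)) (tuple_topology p M ?N) (\<lambda>u. tag M d m i (the_elem u))"
          using continuous_map_compose[OF continuous_map_tuple_space_the_elem continuous_map_tag[OF M i]]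
          by (simp only: o_def)
        fix u assume "u \<in> topspace (itop (?Y i))"
        then obtain x where x: "x \<in> D i" "u = {x}"
          unfolding topY[OF i] points_tuple_space by blast
        then show "tag M d m i (the_elem u) \<in> tuple_sum M m d D" "tag M d m i ` u = {tag M d m i (the_elem u)}"
          using i by (auto simp: tuple_sum_def)
      qed
      then show "continuous_map (itop (?Y i)) (itop ?T) (\<lambda>u. ?inc (i, u))" by simp
    qed
    show "open_map ?S (itop ?T) ?inc"
      unfolding open_map_def forall_openin_sum_topology
    proof (intro allI impI)
      fix U assume U: "\<forall>i\<in>{..<m}. openin (itop (?Y i)) (U i)"
      have "openin (itop ?T) ((`) (tag M d m i) ` U i)" if i: "i < m" for i
      proof -
        obtain W where W: "openin (tuple_topology p M (d i)) W" "U i = the_elem -` W \<inter> (\<lambda>x. {x}) ` D i"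
        proof -
          have "openin (itop (?Y i)) (U i)" using U i by simp
          then have "\<exists>W. openin (tuple_topology p M (d i)) W \<and> U i = the_elem -` W \<inter> (\<lambda>x. {x}) ` D i"
            by (simp add: tuple_space_def openin_pullback_topology)
          then show ?thesis using that by (elim exE conjE)
        qed
        \<comment> \<open>The first condition selects the piece with tag \<open>i\<close>, the
          second asks the untagged tuple to lie in \<open>W\<close>; the image of \<open>U i\<close>
          is the trace of \<open>V\<close> on the union.\<close>
        define V where "V = {z \<in> topspace (tuple_topology p M ?N). z i \<in> A} \<inter>
          {z \<in> topspace (tuple_topology p M ?N). untag d m i z \<in> W}"
        have iN: "i < ?N" using i by simp
        have "openin (tuple_topology p M ?N) V"
          unfolding V_def
          by (intro openin_Int openin_continuous_map_preimage[OF continuous_map_tuple_coordinate[OF iN] A(1)]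
              openin_continuous_map_preimage[OF continuous_map_untag[OF i, of p M d] W(1)])
        moreover have "(`) (tag M d m i) ` U i = the_elem -` V \<inter> (\<lambda>x. {x}) ` tuple_sum M m d D"
        proof
          show "(`) (tag M d m i) ` U i \<subseteq> the_elem -` V \<inter> (\<lambda>x. {x}) ` tuple_sum M m d D"
          proof
            fix v assume "v \<in> (`) (tag M d m i) ` U i"
            then obtain x where x: "x \<in> D i" "x \<in> W" "v = {tag M d m i x}"
              unfolding W(2) by auto
            have t: "tag M d m i x \<in> tuple_sum M m d D"
              using x(1) i by (auto simp: tuple_sum_def)
            moreover have "tag M d m i x i = \<one>\<^bsub>M\<^esub>" using i by (simp add: tag_def)
            moreover have "untag d m i (tag M d m i x) = x"
              using x(1) Dsub[OF i] i by (intro untag_tag) auto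
            ultimately have "tag M d m i x \<in> V"
              using sub x(2) A(2) topspace_tuple_topology[OF M] by (auto simp: V_def)
            then show "v \<in> the_elem -` V \<inter> (\<lambda>x. {x}) ` tuple_sum M m d D"
              using t x(3) by auto
          qed
          show "the_elem -` V \<inter> (\<lambda>x. {x}) ` tuple_sum M m d D \<subseteq> (`) (tag M d m i) ` U i"
          proof
            fix v assume "v \<in> the_elem -` V \<inter> (\<lambda>x. {x}) ` tuple_sum M m d D"
            then obtain z where z: "v = {z}" "z \<in> V" "z \<in> tuple_sum M m d D" by auto
            then obtain j x where j: "j < m" "x \<in> D j" "z = tag M d m j x"
              unfolding tuple_sum_def by blast
            have "z i = (if i = j then \<one>\<^bsub>M\<^esub> else \<zero>\<^bsub>M\<^esub>)"
              using i j(3) by (simp add: tag_def)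
            then have "i = j" using z(2) A(3) by (auto simp: V_def split: if_splits)
            moreover have "untag d m j z = x"
              unfolding j(3) using j(1,2) Dsub[OF j(1)] by (intro untag_tag) auto
            ultimately have x: "x \<in> W" "x \<in> D i" "v = tag M d m i ` {x}"
              using z(1,2) j by (simp_all add: V_def)
            then have "{x} \<in> U i" unfolding W(2) by simp
            then show "v \<in> (`) (tag M d m i) ` U i" unfolding x(3) by (rule imageI)
          qed
        qed
        ultimately show ?thesis
          unfolding tuple_space_def ispace.simps openin_pullback_topology by (intro exI[of _ V] conjI)
      qed
      then have open_img: "openin (itop ?T) V" if "V \<in> (\<lambda>i. (`) (tag M d m i) ` U i) ` {..<m}" for V
        using that by blast
      have img: "?inc ` Sigma {..<m} U = (\<Union>i\<in>{..<m}. (`) (tag M d m i) ` U i)" by force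
      show "openin (itop ?T) (?inc ` Sigma {..<m} U)"
        unfolding img
        by (rule openin_Union[of "(\<lambda>i. (`) (tag M d m i) ` U i) ` {..<m}" "itop ?T", OF open_img])
    qed
  qed
qed

section \<open>Charts\<close>

text \<open>The switch \<open>b\<close> demands an open image. With \<open>True\<close> it gives the
  charts of locally Euclidean spaces and manifolds, with \<open>False\<close> those of locally
  definable spaces, so one argument covers all of them.\<close>

definition has_chart ::
  "nat \<Rightarrow> ('a, 'b) ring_scheme \<Rightarrow> bool \<Rightarrow> 'a ispace \<Rightarrow> (nat \<Rightarrow> 'a) set set \<Rightarrow> bool" where
  "has_chart p M b X N \<longleftrightarrow> (\<exists>n D. definable M n D \<and> (b \<longrightarrow> openin (tuple_topology p M n) D) \<and>
     interp_homeomorphic_to_tuples p M X N n D)"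

definition locally_charted ::
  "nat \<Rightarrow> ('a, 'b) ring_scheme \<Rightarrow> bool \<Rightarrow> 'a ispace \<Rightarrow> bool" where
  "locally_charted p M b X \<longleftrightarrow> hausdorff_ispace M X \<and>
     (\<forall>x\<in>points X. \<exists>N. is_neighborhood X x N \<and> has_chart p M b X N)"

lemma locally_euclidean_iff: "locally_euclidean p M = locally_charted p M True"
  by (intro ext) (simp add: locally_euclidean_def locally_charted_def has_chart_def)

lemma locally_definable_iff: "locally_definable p M = locally_charted p M False"
  by (intro ext) (simp add: locally_definable_def locally_charted_def has_chart_def)

lemma definable_manifold_iff:
  "definable_manifold p M X \<longleftrightarrow> hausdorff_ispace M X \<and>
    (\<exists>\<U>. finite \<U> \<and> \<Union>\<U> = points X \<and> (\<forall>U\<in>\<U>. openin (itop X) U \<and> has_chart p M True X U))"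
  by (simp add: definable_manifold_def has_chart_def)

lemma has_chart_subset: "has_chart p M b X N \<Longrightarrow> N \<subseteq> points X"
  by (auto simp: has_chart_def interp_homeomorphic_to_tuples_def dest: interpretable_map_on_subset)

lemma has_chart_sum:
  assumes inc: "iset_sum M m X Z inc"
    and hom: "homeomorphic_map (sum_itop m X) (itop Z) (\<lambda>(i, x). inc i x)"
    and i: "i < m" and X: "topologized_iset M (X i)" and N: "has_chart p M b (X i) N"
  shows "has_chart p M b Z (inc i ` N)"
proof -
  obtain n D f where D: "definable M n D" "b \<longrightarrow> openin (tuple_topology p M n) D"
    and f: "interpretable_map_on M (X i) N (tuple_space p M n D) f"
      "homeomorphic_map (subtopology (itop (X i)) N) (itop (tuple_space p M n D)) f"
    using N by (auto simp: has_chart_def interp_homeomorphic_to_tuples_def)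
  show ?thesis
    unfolding has_chart_def interp_homeomorphic_to_tuples_def
    using D chart_sum[OF inc hom i X interpretable_set_tuple_space[OF D(1)] f]
    by (intro exI[of _ n] exI[of _ D] conjI)
qed

lemma has_chart_product:
  assumes M: "field M" and pr: "iset_product M m X Z pr"
    and hom: "homeomorphic_map (itop Z) (product_itop m X) (\<lambda>z. \<lambda>i\<in>{..<m}. pr i z)"
    and topZ: "topspace (itop Z) = points Z"
    and X: "\<And>i. i < m \<Longrightarrow> topologized_iset M (X i)" and N: "\<And>i. i < m \<Longrightarrow> has_chart p M b (X i) (N i)"
  shows "has_chart p M b Z {z \<in> points Z. \<forall>i<m. pr i z \<in> N i}"
proof -
  have "\<forall>i\<in>{..<m}. \<exists>n D f. definable M n D \<and> (b \<longrightarrow> openin (tuple_topology p M n) D) \<and>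
      interpretable_map_on M (X i) (N i) (tuple_space p M n D) f \<and>
      homeomorphic_map (subtopology (itop (X i)) (N i)) (itop (tuple_space p M n D)) f"
    using N by (auto simp: has_chart_def interp_homeomorphic_to_tuples_def) 
  then obtain d D f where "\<forall>i\<in>{..<m}. definable M (d i) (D i) \<and> (b \<longrightarrow> openin (tuple_topology p M (d i)) (D i)) \<and>
      interpretable_map_on M (X i) (N i) (tuple_space p M (d i) (D i)) (f i) \<and>
      homeomorphic_map (subtopology (itop (X i)) (N i)) (itop (tuple_space p M (d i) (D i))) (f i)"
    unfolding bchoice_iff by (elim exE)
  then have D: "\<And>i. i < m \<Longrightarrow> definable M (d i) (D i)"
    and op: "\<And>i. i < m \<Longrightarrow> b \<Longrightarrow> openin (tuple_topology p M (d i)) (D i)"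
    and f: "\<And>i. i < m \<Longrightarrow> interpretable_map_on M (X i) (N i) (tuple_space p M (d i) (D i)) (f i)"
      "\<And>i. i < m \<Longrightarrow> homeomorphic_map (subtopology (itop (X i)) (N i)) (itop (tuple_space p M (d i) (D i))) (f i)"
    by simp_all
  show ?thesis
    unfolding has_chart_def interp_homeomorphic_to_tuples_def
  proof (intro exI[of _ "sum d {..<m}"] exI[of _ "tuple_product M m d D"] conjI impI)
    show "definable M (sum d {..<m}) (tuple_product M m d D)"
      by (rule definable_tuple_product[OF M D])
    show "openin (tuple_topology p M (sum d {..<m})) (tuple_product M m d D)" if b
      by (rule openin_tuple_product[OF M op[OF _ that]])
    show "\<exists>f. interpretable_map_on M Z {z \<in> points Z. \<forall>i<m. pr i z \<in> N i}
          (tuple_space p M (sum d {..<m}) (tuple_product M m d D)) f \<and>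
        homeomorphic_map (subtopology (itop Z) {z \<in> points Z. \<forall>i<m. pr i z \<in> N i})
          (itop (tuple_space p M (sum d {..<m}) (tuple_product M m d D))) f"
      by (rule chart_product[OF pr hom topZ is_product_tuple_space[OF M D] X
            topologized_iset_tuple_space[OF M D] f])
  qed
qed

lemma locally_charted_sum:
  assumes M: "field M" and Z: "is_disjoint_union M m X Z" and X: "\<And>i. i < m \<Longrightarrow> locally_charted p M b (X i)"
  shows "locally_charted p M b Z"
proof -
  interpret field M by fact
  have Xh: "\<And>i. i < m \<Longrightarrow> hausdorff_ispace M (X i)"
    using X by (simp add: locally_charted_def)
  obtain inc where inc: "iset_sum M m X Z inc"
    and hom: "homeomorphic_map (sum_itop m X) (itop Z) (\<lambda>(i, x). inc i x)"
    by (rule is_disjoint_unionE[OF Z hausdorff_ispaceD(1)[OF Xh]])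
  have haus: "hausdorff_ispace M Z"
    by (rule hausdorff_ispace_sum[OF Z Xh]) simp_all
  show ?thesis
    unfolding locally_charted_def
  proof (intro conjI haus ballI)
    fix z assume "z \<in> points Z"
    then obtain i x where x: "i < m" "x \<in> points (X i)" "z = inc i x"
      by (rule iset_sum_cases[OF inc])
    obtain N where N: "is_neighborhood (X i) x N" "has_chart p M b (X i) N"
      using X[OF x(1)] x(2) unfolding locally_charted_def by blast
    obtain W where W: "openin (itop (X i)) W" "x \<in> W" "W \<subseteq> N"
      using N(1) unfolding is_neighborhood_def by blast
    have chart: "has_chart p M b Z (inc i ` N)"
      by (rule has_chart_sum[OF inc hom x(1) hausdorff_ispaceD(1)[OF Xh[OF x(1)]] N(2)])
    have "openin (itop Z) (inc i ` W)"
      using homeomorphic_map_sum_component(2)[OF hom x(1)] W(1) by (simp add: open_map_def)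
    then have "is_neighborhood Z z (inc i ` N)"
      unfolding is_neighborhood_def using has_chart_subset[OF chart] W x(3)
      by (intro conjI exI[of _ "inc i ` W"]) auto
    with chart show "\<exists>N. is_neighborhood Z z N \<and> has_chart p M b Z N" by (intro exI conjI)
  qed
qed

lemma locally_charted_product:
  assumes M: "field M" and Z: "is_product M m X Z" and X: "\<And>i. i < m \<Longrightarrow> locally_charted p M b (X i)"
  shows "locally_charted p M b Z"
proof -
  have Xh: "\<And>i. i < m \<Longrightarrow> hausdorff_ispace M (X i)"
    using X by (simp add: locally_charted_def)
  obtain pr where pr: "iset_product M m X Z pr"
    and hom: "homeomorphic_map (itop Z) (product_itop m X) (\<lambda>z. \<lambda>i\<in>{..<m}. pr i z)"
    by (rule is_productE[OF Z hausdorff_ispaceD(1)[OF Xh]])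
  have haus: "hausdorff_ispace M Z"
    by (rule hausdorff_ispace_product[OF Z Xh])
  note topZ = hausdorff_ispaceD(3)[OF haus]
  show ?thesis
    unfolding locally_charted_def
  proof (intro conjI haus ballI)
    fix z assume z: "z \<in> points Z"
    have "\<forall>i\<in>{..<m}. \<exists>N. is_neighborhood (X i) (pr i z) N \<and> has_chart p M b (X i) N"
      using X iset_product_in_points[OF pr _ z] unfolding locally_charted_def by simp
    then obtain N where "\<forall>i\<in>{..<m}. is_neighborhood (X i) (pr i z) (N i) \<and> has_chart p M b (X i) (N i)"
      unfolding bchoice_iff by (elim exE)
    then have nb: "\<And>i. i < m \<Longrightarrow> is_neighborhood (X i) (pr i z) (N i)"
      and ch: "\<And>i. i < m \<Longrightarrow> has_chart p M b (X i) (N i)" by simp_all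
    have "\<forall>i\<in>{..<m}. \<exists>W. openin (itop (X i)) W \<and> pr i z \<in> W \<and> W \<subseteq> N i"
      using nb by (simp add: is_neighborhood_def)
    then obtain W where "\<forall>i\<in>{..<m}. openin (itop (X i)) (W i) \<and> pr i z \<in> W i \<and> W i \<subseteq> N i"
      unfolding bchoice_iff by (elim exE)
    then have W: "\<And>i. i < m \<Longrightarrow> openin (itop (X i)) (W i)" "\<And>i. i < m \<Longrightarrow> pr i z \<in> W i"
      "\<And>i. i < m \<Longrightarrow> W i \<subseteq> N i" by simp_all
    \<comment> \<open>The chart lives on the box \<open>?N\<close>, whose sides may fail to be open;
      the smaller box \<open>?W\<close> shows that it is still a neighbourhood.\<close>
    let ?N = "{z \<in> points Z. \<forall>i<m. pr i z \<in> N i}"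
    let ?W = "{z \<in> topspace (itop Z). \<forall>i<m. pr i z \<in> W i}"
    have "openin (itop Z) ?W"
      by (rule openin_finite_preimages[of m _ "\<lambda>i. itop (X i)"])
        (use continuous_map_product_homeo[OF hom] W(1) in auto)
    moreover have "z \<in> ?W" using z W(2) topZ by simp
    moreover have "?W \<subseteq> ?N" using W(3) topZ by blast
    ultimately have "is_neighborhood Z z ?N"
      unfolding is_neighborhood_def by (intro conjI exI[of _ ?W]) auto
    moreover have "has_chart p M b Z ?N"
      by (rule has_chart_product[OF M pr hom topZ hausdorff_ispaceD(1)[OF Xh] ch])
    ultimately show "\<exists>N. is_neighborhood Z z N \<and> has_chart p M b Z N" by (intro exI[of _ ?N] conjI)
  qed
qed

section \<open>Finite atlases of sums and products of manifolds\<close>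

lemma definable_manifold_covers:
  assumes "\<And>i. i < m \<Longrightarrow> definable_manifold p M (X i)"
  obtains \<U> where "\<forall>i<m. finite (\<U> i) \<and> \<Union>(\<U> i) = points (X i) \<and>
    (\<forall>U\<in>\<U> i. openin (itop (X i)) U \<and> has_chart p M True (X i) U)"
proof -
  have "\<forall>i\<in>{..<m}. \<exists>\<U>. finite \<U> \<and> \<Union>\<U> = points (X i) \<and>
      (\<forall>U\<in>\<U>. openin (itop (X i)) U \<and> has_chart p M True (X i) U)"
    using assms unfolding definable_manifold_iff by simp
  then obtain \<U> where "\<forall>i\<in>{..<m}. finite (\<U> i) \<and> \<Union>(\<U> i) = points (X i) \<and>
      (\<forall>U\<in>\<U> i. openin (itop (X i)) U \<and> has_chart p M True (X i) U)"
    unfolding bchoice_iff by (elim exE)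
  then show ?thesis using that[of \<U>] by simp
qed

lemma definable_manifold_sum:
  assumes M: "field M" and Z: "is_disjoint_union M m X Z" and X: "\<And>i. i < m \<Longrightarrow> definable_manifold p M (X i)"
  shows "definable_manifold p M Z"
proof -
  interpret field M by fact
  have Xh: "\<And>i. i < m \<Longrightarrow> hausdorff_ispace M (X i)"
    using X by (simp add: definable_manifold_def)
  obtain inc where inc: "iset_sum M m X Z inc"
    and hom: "homeomorphic_map (sum_itop m X) (itop Z) (\<lambda>(i, x). inc i x)"
    by (rule is_disjoint_unionE[OF Z hausdorff_ispaceD(1)[OF Xh]])
  have haus: "hausdorff_ispace M Z"
    by (rule hausdorff_ispace_sum[OF Z Xh]) simp_all
  obtain \<U> where \<U>: "\<forall>i<m. finite (\<U> i) \<and> \<Union>(\<U> i) = points (X i) \<and>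
      (\<forall>U\<in>\<U> i. openin (itop (X i)) U \<and> has_chart p M True (X i) U)"
    by (rule definable_manifold_covers[OF X])
  define \<V> where "\<V> = (\<Union>i\<in>{..<m}. (`) (inc i) ` \<U> i)"
  have "finite \<V>" using \<U> by (simp add: \<V>_def)
  moreover have "\<Union>\<V> = points Z"
  proof
    show "\<Union>\<V> \<subseteq> points Z"
    proof
      fix z assume "z \<in> \<Union>\<V>"
      then obtain i U x where "i < m" "U \<in> \<U> i" "x \<in> U" "z = inc i x" by (auto simp: \<V>_def)
      then show "z \<in> points Z" using \<U> iset_sum_in_points[OF inc] by blast
    qed
    show "points Z \<subseteq> \<Union>\<V>"
    proof
      fix z assume "z \<in> points Z"
      then obtain i x where x: "i < m" "x \<in> points (X i)" "z = inc i x"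
        by (rule iset_sum_cases[OF inc])
      then obtain U where U: "U \<in> \<U> i" "x \<in> U" using \<U> by blast
      then have "inc i ` U \<in> \<V>" using x(1) by (auto simp: \<V>_def)
      then show "z \<in> \<Union>\<V>" using U(2) x(3) by blast
    qed
  qed
  moreover have "openin (itop Z) V \<and> has_chart p M True Z V" if "V \<in> \<V>" for V
  proof -
    obtain i U where i: "i < m" and U: "U \<in> \<U> i" "V = inc i ` U" using \<open>V \<in> \<V>\<close> by (auto simp: \<V>_def)
    then have "openin (itop (X i)) U" "has_chart p M True (X i) U" using \<U> by auto
    then show ?thesis
      using homeomorphic_map_sum_component(2)[OF hom i] U(2)
        has_chart_sum[OF inc hom i hausdorff_ispaceD(1)[OF Xh[OF i]]] by (simp add: open_map_def)
  qed
  ultimately show ?thesis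
    unfolding definable_manifold_iff using haus by (intro conjI exI[of _ \<V>] ballI) simp_all
qed

lemma definable_manifold_product:
  assumes M: "field M" and Z: "is_product M m X Z" and X: "\<And>i. i < m \<Longrightarrow> definable_manifold p M (X i)"
  shows "definable_manifold p M Z"
proof -
  have Xh: "\<And>i. i < m \<Longrightarrow> hausdorff_ispace M (X i)"
    using X by (simp add: definable_manifold_def)
  obtain pr where pr: "iset_product M m X Z pr"
    and hom: "homeomorphic_map (itop Z) (product_itop m X) (\<lambda>z. \<lambda>i\<in>{..<m}. pr i z)"
    by (rule is_productE[OF Z hausdorff_ispaceD(1)[OF Xh]])
  have haus: "hausdorff_ispace M Z"
    by (rule hausdorff_ispace_product[OF Z Xh])
  note topZ = hausdorff_ispaceD(3)[OF haus]
  obtain \<U> where \<U>: "\<forall>i<m. finite (\<U> i) \<and> \<Union>(\<U> i) = points (X i) \<and>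
      (\<forall>U\<in>\<U> i. openin (itop (X i)) U \<and> has_chart p M True (X i) U)"
    by (rule definable_manifold_covers[OF X])
  define box where "box = (\<lambda>V. {z \<in> points Z. \<forall>i<m. pr i z \<in> V i})"
  \<comment> \<open>One box for each choice of a chart domain in every factor, finitely many in all.
    For \<open>m = 0\<close> there is one empty choice, whose box is the whole one-point
    space.\<close>
  define \<V> where "\<V> = box ` Pi\<^sub>E {..<m} \<U>"
  have "finite \<V>" unfolding \<V>_def by (intro finite_imageI finite_PiE) (simp_all add: \<U>)
  moreover have "\<Union>\<V> = points Z"
  proof
    show "\<Union>\<V> \<subseteq> points Z" by (auto simp: \<V>_def box_def)
    show "points Z \<subseteq> \<Union>\<V>"
    proof
      fix z assume z: "z \<in> points Z"
      have "\<exists>U. U \<in> \<U> i \<and> pr i z \<in> U" if "i < m" for i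
        using iset_product_in_points[OF pr that z] \<U> that by blast
      then have "\<forall>i\<in>{..<m}. \<exists>U. U \<in> \<U> i \<and> pr i z \<in> U" by simp
      then obtain V where V: "\<forall>i\<in>{..<m}. V i \<in> \<U> i \<and> pr i z \<in> V i"
        unfolding bchoice_iff by (elim exE)
      then have "restrict V {..<m} \<in> Pi\<^sub>E {..<m} \<U>" by simp
      then have "box (restrict V {..<m}) \<in> \<V>" unfolding \<V>_def by (rule imageI)
      moreover have "z \<in> box (restrict V {..<m})" using z V by (simp add: box_def)
      ultimately show "z \<in> \<Union>\<V>" by (rule UnionI)
    qed
  qed
  moreover have "openin (itop Z) V \<and> has_chart p M True Z V" if "V \<in> \<V>" for V
  proof -
    obtain U where U: "U \<in> Pi\<^sub>E {..<m} \<U>" "V = box U" using \<open>V \<in> \<V>\<close> by (auto simp: \<V>_def)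
    then have Ui: "openin (itop (X i)) (U i)" "has_chart p M True (X i) (U i)" if "i < m" for i
      using \<U> that PiE_mem[OF U(1), of i] by simp_all
    have "openin (itop Z) V"
      unfolding U(2) box_def topZ[symmetric]
      by (rule openin_finite_preimages[of m _ "\<lambda>i. itop (X i)"])
        (use continuous_map_product_homeo[OF hom] Ui(1) in auto)
    moreover have "has_chart p M True Z V"
      unfolding U(2) box_def
      by (rule has_chart_product[OF M pr hom topZ hausdorff_ispaceD(1)[OF Xh] Ui(2)])
    ultimately show ?thesis ..
  qed
  ultimately show ?thesis
    unfolding definable_manifold_iff using haus by (intro conjI exI[of _ \<V>] ballI) simp_all
qed

section \<open>Dominated spaces\<close>

lemma definably_dominated_covers:
  assumes "\<And>i. i < m \<Longrightarrow> definably_dominated p M (X i)"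
  obtains d D f where "\<forall>i<m. definable M (d i) (D i)"
    "\<forall>i<m. interp_open_surjection M (tuple_space p M (d i) (D i)) (X i) (f i)"
proof -
  have "\<forall>i\<in>{..<m}. \<exists>n D f. definable M n D \<and> interp_open_surjection M (tuple_space p M n D) (X i) f"
    using assms unfolding definably_dominated_def by simp
  then obtain d D f where "\<forall>i\<in>{..<m}. definable M (d i) (D i) \<and>
      interp_open_surjection M (tuple_space p M (d i) (D i)) (X i) (f i)"
    unfolding bchoice_iff by (elim exE)
  then show ?thesis using that[of d D f] by simp
qed

lemma manifold_dominated_covers:
  assumes "\<And>i. i < m \<Longrightarrow> manifold_dominated p M (X i)"
  obtains Y f where "\<forall>i<m. definable_manifold p M (Y i)"
    "\<forall>i<m. interp_open_surjection M (Y i) (X i) (f i)"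
proof -
  have "\<forall>i\<in>{..<m}. \<exists>Y f. definable_manifold p M Y \<and> interp_open_surjection M Y (X i) f"
    using assms unfolding manifold_dominated_def by simp
  then obtain Y f where "\<forall>i\<in>{..<m}. definable_manifold p M (Y i) \<and>
      interp_open_surjection M (Y i) (X i) (f i)"
    unfolding bchoice_iff by (elim exE)
  then show ?thesis using that[of Y f] by simp
qed

text \<open>The dominating set has to carry the subspace topology of one power of the field, so the
  tagged pieces must be open there. This is where p being prime and \<open>M\<close> being
  p-adically closed enter.\<close>

lemma definably_dominated_sum:
  assumes p: "prime p" and M: "padically_closed p M"
    and Z: "is_disjoint_union M m X Z" and X: "\<And>i. i < m \<Longrightarrow> definably_dominated p M (X i)"
  shows "definably_dominated p M Z"
proof -
  have Mf: "field M" using M by (simp add: padically_closed_def)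
  interpret field M by fact
  have Xh: "\<And>i. i < m \<Longrightarrow> hausdorff_ispace M (X i)"
    using X by (simp add: definably_dominated_def)
  obtain A where A: "openin (valuation_topology p M) A" "\<one>\<^bsub>M\<^esub> \<in> A" "\<zero>\<^bsub>M\<^esub> \<notin> A"
    using valuation_topology_separates[OF p M] by (elim exE conjE)
  obtain d D f where "\<forall>i<m. definable M (d i) (D i)"
    "\<forall>i<m. interp_open_surjection M (tuple_space p M (d i) (D i)) (X i) (f i)"
    by (rule definably_dominated_covers[OF X])
  then have D: "\<And>i. i < m \<Longrightarrow> definable M (d i) (D i)"
    and f: "\<And>i. i < m \<Longrightarrow> interp_open_surjection M (tuple_space p M (d i) (D i)) (X i) (f i)" by simp_all
  have haus: "hausdorff_ispace M Z"
    by (rule hausdorff_ispace_sum[OF Z Xh]) simp_all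
  have "\<exists>f. interp_open_surjection M (tuple_space p M (m + sum d {..<m}) (tuple_sum M m d D)) Z f"
    by (rule open_surjection_sum[OF is_disjoint_union_tuple_space[OF Mf D A] Z hausdorff_ispaceD(1)[OF Xh]
          topologized_iset_tuple_space[OF Mf D] f])
  then show ?thesis
    unfolding definably_dominated_def using haus definable_tuple_sum[OF Mf D]
    by (intro conjI exI[of _ "m + sum d {..<m}"] exI[of _ "tuple_sum M m d D"]) simp_all
qed

lemma definably_dominated_product:
  assumes M: "field M"
    and Z: "is_product M m X Z" and X: "\<And>i. i < m \<Longrightarrow> definably_dominated p M (X i)"
  shows "definably_dominated p M Z"
proof -
  have Xh: "\<And>i. i < m \<Longrightarrow> hausdorff_ispace M (X i)"
    using X by (simp add: definably_dominated_def)
  obtain d D f where "\<forall>i<m. definable M (d i) (D i)"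
    "\<forall>i<m. interp_open_surjection M (tuple_space p M (d i) (D i)) (X i) (f i)"
    by (rule definably_dominated_covers[OF X])
  then have D: "\<And>i. i < m \<Longrightarrow> definable M (d i) (D i)"
    and f: "\<And>i. i < m \<Longrightarrow> interp_open_surjection M (tuple_space p M (d i) (D i)) (X i) (f i)" by simp_all
  have haus: "hausdorff_ispace M Z"
    by (rule hausdorff_ispace_product[OF Z Xh])
  have "\<exists>f. interp_open_surjection M (tuple_space p M (sum d {..<m}) (tuple_product M m d D)) Z f"
    by (rule open_surjection_product[OF is_product_tuple_space[OF M D] Z hausdorff_ispaceD(1)[OF Xh]
          topologized_iset_tuple_space[OF M D] f])
  then show ?thesis
    unfolding definably_dominated_def using haus definable_tuple_product[OF M D]
    by (intro conjI exI[of _ "sum d {..<m}"] exI[of _ "tuple_product M m d D"]) simp_all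
qed

text \<open>A manifold may carry any suitable interpretable topology, so the dominating manifolds
  are joined by an abstract disjoint union whose atlas consists of theirs.\<close>

lemma manifold_dominated_sum:
  assumes M: "field M"
    and Z: "is_disjoint_union M m X Z" and X: "\<And>i. i < m \<Longrightarrow> manifold_dominated p M (X i)"
  shows "manifold_dominated p M Z"
proof -
  interpret field M by fact
  have Xh: "\<And>i. i < m \<Longrightarrow> hausdorff_ispace M (X i)"
    using X by (simp add: manifold_dominated_def)
  obtain Y f where "\<forall>i<m. definable_manifold p M (Y i)"
    "\<forall>i<m. interp_open_surjection M (Y i) (X i) (f i)"
    by (rule manifold_dominated_covers[OF X])
  then have Y: "\<And>i. i < m \<Longrightarrow> definable_manifold p M (Y i)"
    and f: "\<And>i. i < m \<Longrightarrow> interp_open_surjection M (Y i) (X i) (f i)" by simp_all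
  have Yt: "topologized_iset M (Y i)" if "i < m" for i
    using Y[OF that] hausdorff_ispaceD(1)[of M "Y i"] by (simp add: definable_manifold_def)
  have "\<exists>Y'. is_disjoint_union M m Y Y'"
    by (rule is_disjoint_union_exists[OF Yt]) simp_all
  then obtain Y' where Y': "is_disjoint_union M m Y Y'" by (elim exE)
  have haus: "hausdorff_ispace M Z"
    by (rule hausdorff_ispace_sum[OF Z Xh]) simp_all
  have "\<exists>f. interp_open_surjection M Y' Z f"
    by (rule open_surjection_sum[OF Y' Z hausdorff_ispaceD(1)[OF Xh] Yt f])
  then show ?thesis
    unfolding manifold_dominated_def using haus definable_manifold_sum[OF M Y' Y]
    by (intro conjI exI[of _ Y']) simp_all
qed

lemma manifold_dominated_product:
  assumes M: "field M"
    and Z: "is_product M m X Z" and X: "\<And>i. i < m \<Longrightarrow> manifold_dominated p M (X i)"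
  shows "manifold_dominated p M Z"
proof -
  interpret field M by fact
  have Xh: "\<And>i. i < m \<Longrightarrow> hausdorff_ispace M (X i)"
    using X by (simp add: manifold_dominated_def)
  obtain Y f where "\<forall>i<m. definable_manifold p M (Y i)"
    "\<forall>i<m. interp_open_surjection M (Y i) (X i) (f i)"
    by (rule manifold_dominated_covers[OF X])
  then have Y: "\<And>i. i < m \<Longrightarrow> definable_manifold p M (Y i)"
    and f: "\<And>i. i < m \<Longrightarrow> interp_open_surjection M (Y i) (X i) (f i)" by simp_all
  have Yt: "topologized_iset M (Y i)" if "i < m" for i
    using Y[OF that] hausdorff_ispaceD(1)[of M "Y i"] by (simp add: definable_manifold_def)
  have "carrier M \<noteq> {}" using zero_closed by blast
  with Yt have "\<exists>Y'. is_product M m Y Y'" by (rule is_product_exists)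
  then obtain Y' where Y': "is_product M m Y Y'" by (elim exE)
  have haus: "hausdorff_ispace M Z"
    by (rule hausdorff_ispace_product[OF Z Xh])
  have "\<exists>f. interp_open_surjection M Y' Z f"
    by (rule open_surjection_product[OF Y' Z hausdorff_ispaceD(1)[OF Xh] Yt f])
  then show ?thesis
    unfolding manifold_dominated_def using haus definable_manifold_product[OF M Y' Y]
    by (intro conjI exI[of _ Y']) simp_all
qed

section \<open>Assembling the closure statements\<close>

text \<open>Closure has two halves. Existence of a union follows from the general construction for
  topologized sets, so only stability of the class remains to be supplied.\<close>

lemma closed_under_disjoint_unionsI:
  fixes M :: "('a, 'b) ring_scheme"
  assumes "field M" "\<And>X. C X \<Longrightarrow> topologized_iset M X"
    and "\<And>m X Z. is_disjoint_union M m X Z \<Longrightarrow> (\<And>i. i < m \<Longrightarrow> C (X i)) \<Longrightarrow> C Z"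
  shows "closed_under_disjoint_unions M C"
  unfolding closed_under_disjoint_unions_def
proof (intro allI impI conjI)
  interpret field M by fact
  fix m :: nat and X :: "nat \<Rightarrow> 'a ispace"
  assume X: "\<forall>i<m. C (X i)"
  show "\<exists>Z. is_disjoint_union M m X Z"
    by (rule is_disjoint_union_exists) (use X assms(2) in simp_all)
  show "C Z" if "is_disjoint_union M m X Z" for Z
    by (rule assms(3)[OF that]) (simp add: X)
qed

lemma closed_under_productsI:
  fixes M :: "('a, 'b) ring_scheme"
  assumes "field M" "\<And>X. C X \<Longrightarrow> topologized_iset M X"
    and "\<And>m X Z. is_product M m X Z \<Longrightarrow> (\<And>i. i < m \<Longrightarrow> C (X i)) \<Longrightarrow> C Z"
  shows "closed_under_products M C"
  unfolding closed_under_products_def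
proof (intro allI impI conjI)
  interpret field M by fact
  fix m :: nat and X :: "nat \<Rightarrow> 'a ispace"
  assume X: "\<forall>i<m. C (X i)"
  have ne: "carrier M \<noteq> {}" using zero_closed by blast
  show "\<exists>Z. is_product M m X Z"
    by (rule is_product_exists) (use X assms(2) ne in simp_all)
  show "C Z" if "is_product M m X Z" for Z
    by (rule assms(3)[OF that]) (simp add: X)
qed

lemma closed_under_disjoint_unions_conj:
  fixes M :: "('a, 'b) ring_scheme"
  assumes "closed_under_disjoint_unions M C" "closed_under_disjoint_unions M D"
  shows "closed_under_disjoint_unions M (\<lambda>X. C X \<and> D X)"
  unfolding closed_under_disjoint_unions_def
proof (intro allI impI)
  fix m :: nat and X :: "nat \<Rightarrow> 'a ispace"
  assume "\<forall>i<m. C (X i) \<and> D (X i)"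
  then have "\<forall>i<m. C (X i)" "\<forall>i<m. D (X i)" by simp_all
  then show "(\<exists>Z. is_disjoint_union M m X Z) \<and> (\<forall>Z. is_disjoint_union M m X Z \<longrightarrow> C Z \<and> D Z)"
    using assms unfolding closed_under_disjoint_unions_def by simp
qed

lemma closed_under_products_conj:
  fixes M :: "('a, 'b) ring_scheme"
  assumes "closed_under_products M C" "closed_under_products M D"
  shows "closed_under_products M (\<lambda>X. C X \<and> D X)"
  unfolding closed_under_products_def
proof (intro allI impI)
  fix m :: nat and X :: "nat \<Rightarrow> 'a ispace"
  assume "\<forall>i<m. C (X i) \<and> D (X i)"
  then have "\<forall>i<m. C (X i)" "\<forall>i<m. D (X i)" by simp_all
  then show "(\<exists>Z. is_product M m X Z) \<and> (\<forall>Z. is_product M m X Z \<longrightarrow> C Z \<and> D Z)"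
    using assms unfolding closed_under_products_def by simp
qed

theorem proposition4p12:
  fixes p :: nat and \<kappa> :: "'k rel" and M :: "'a ring"
  assumes "prime p" and "monster_model p \<kappa> M"
  shows "closed_under_disjoint_unions M (locally_definable p M) \<and>
         closed_under_products M (locally_definable p M) \<and>
         closed_under_disjoint_unions M (locally_euclidean p M) \<and>
         closed_under_products M (locally_euclidean p M) \<and>
         closed_under_disjoint_unions M (definably_dominated p M) \<and>
         closed_under_products M (definably_dominated p M) \<and>
         closed_under_disjoint_unions M (manifold_dominated p M) \<and>
         closed_under_products M (manifold_dominated p M) \<and>
         closed_under_disjoint_unions M (admissible p M) \<and>
         closed_under_products M (admissible p M) \<and>
         closed_under_disjoint_unions M (strongly_admissible p M) \<and>
         closed_under_products M (strongly_admissible p M)"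
proof -
  have M: "padically_closed p M" using assms(2) by (simp add: monster_model_def)
  then have F: "field M" by (simp add: padically_closed_def)
  have top: "locally_charted p M b X \<Longrightarrow> topologized_iset M X"
    "definably_dominated p M X \<Longrightarrow> topologized_iset M X"
    "manifold_dominated p M X \<Longrightarrow> topologized_iset M X" for b X
    by (simp_all add: locally_charted_def definably_dominated_def manifold_dominated_def hausdorff_ispaceD(1))
  note sums = locally_charted_sum[OF F] definably_dominated_sum[OF assms(1) M] manifold_dominated_sum[OF F]
  note products = locally_charted_product[OF F] definably_dominated_product[OF F] manifold_dominated_product[OF F]
  \<comment> \<open>Both admissible classes are intersections of a dominated and a charted class. A
    class is closed as soon as every union or product of its members belongs to it, so closure
    passes to the intersection.\<close>
  have adm: "admissible p M = (\<lambda>X. definably_dominated p M X \<and> locally_charted p M False X)"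
    "strongly_admissible p M = (\<lambda>X. manifold_dominated p M X \<and> locally_charted p M True X)"
    by (simp_all add: fun_eq_iff admissible_def strongly_admissible_def
        locally_definable_iff locally_euclidean_iff)
  have "closed_under_disjoint_unions M (locally_charted p M b)" for b
    by (rule closed_under_disjoint_unionsI[OF F top(1) sums(1)])
  moreover have "closed_under_products M (locally_charted p M b)" for b
    by (rule closed_under_productsI[OF F top(1) products(1)])
  moreover have "closed_under_disjoint_unions M (definably_dominated p M)"
    by (rule closed_under_disjoint_unionsI[OF F top(2) sums(2)])
  moreover have "closed_under_products M (definably_dominated p M)"
    by (rule closed_under_productsI[OF F top(2) products(2)])
  moreover have "closed_under_disjoint_unions M (manifold_dominated p M)"
    by (rule closed_under_disjoint_unionsI[OF F top(3) sums(3)])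
  moreover have "closed_under_products M (manifold_dominated p M)"
    by (rule closed_under_productsI[OF F top(3) products(3)])
  ultimately show ?thesis
    unfolding locally_euclidean_iff locally_definable_iff adm
    by (intro conjI closed_under_disjoint_unions_conj closed_under_products_conj)
qed

end
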